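(* Let $N\ge2$, $\alpha\in(0,1)$ and $2<p<2^*$. Then there exists $m_0>0$ such that $$\mathscr C_{\alpha,m,p}(\mathbf B)<\mathscr C_{0,m,p}(\mathbf B)\qquad\text{for all }m\ge m_0,$$ and therefore, for all $m\ge m_0$, every ground state solution of $$-\Delta u+\alpha^2\partial_\theta^2u+mu=|u|^{p-2}u\ \text{ in }\mathbf B,\qquad u=0\ \text{ on }\partial\mathbf B\qquad(\ast)$$ is $x_1$-$x_2$-nonradial.
   Context: $\mathbf B$ is the open unit ball in $\mathbb R^N$. $2^*=\frac{2N}{N-2}$ for $N\ge3$, $2^*=\infty$ for $N=2$. All functions are real-valued. $\partial_\theta=x_1\partial_{x_2}-x_2\partial_{x_1}$. For $m\in\mathbb R$, $\alpha\in[0,1]$, $p\in[2,2^* )$ and $u\in H_0^1(\mathbf B)\setminus\{0\}$, $$R_{\alpha,m,p}(u)=\frac{\int_{\mathbf B}\left(|\nabla u|^2-\alpha^2|\partial_\theta u|^2+mu^2\right)dx}{\left(\int_{\mathbf B}|u|^p\,dx\right)^{2/p}},\qquad \mathscr C_{\alpha,m,p}(\mathbf B)=\inf_{u\in H^1_0(\mathbf B)\setminus\{0\}}R_{\alpha,m,p}(u).$$ For $0\le\alpha<1$, a ground state solution of $(\ast)$ is a weak solution $u\in H_0^1(\mathbf B)\setminus\{0\}$ of $(\ast)$ with $R_{\alpha,m,p}(u)=\mathscr C_{\alpha,m,p}(\mathbf B)$. For $\theta\in\mathbb R$ let $R_\theta(x)=(x_1\cos\theta+x_2\sin\theta,-x_1\sin\theta+x_2\cos\theta,x_3,\dots,x_N)$.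 A function $u$ on $\mathbf B$ is $x_1$-$x_2$-nonradial if $u\circ R_\theta\ne u$ for at least one $\theta\in\mathbb R$. *)

theory Defs
  imports "HOL-Analysis.Analysis"
begin

text \<open>
  The ambient space \<open>\<real>\<^sup>N\<close> is \<open>real ^ 'n\<close> with \<open>N = CARD('n)\<close>. An index type has no
  distinguished first and second element, so the coordinates called \<open>x\<^sub>1\<close> and \<open>x\<^sub>2\<close> are given by two
  index parameters \<open>i\<close> and \<open>j\<close> (assumed distinct wherever it matters). Elements of Lebesgue and
  Sobolev spaces on the unit ball are represented by functions on \<open>real ^ 'n\<close>; their values
  outside the ball are irrelevant, and equality of elements is equality almost everywhere in the
  ball.
\<close>

abbreviation ball_measure :: "(real ^ 'n) measure"
  where "ball_measure \<equiv> lebesgue_on (ball 0 1)"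

definition critical_exponent :: "nat \<Rightarrow> ereal"
  where "critical_exponent N =
    (if N \<le> 2 then \<infinity> else ereal (2 * real N / (real N - 2)))"

subsection \<open>Test functions\<close>

definition partial_deriv :: "'n \<Rightarrow> (real ^ 'n \<Rightarrow> real) \<Rightarrow> real ^ 'n \<Rightarrow> real"
  where "partial_deriv k f x = frechet_derivative f (at x) (axis k 1)"

primrec C_k :: "nat \<Rightarrow> (real ^ 'n \<Rightarrow> real) \<Rightarrow> bool"
  where
    "C_k 0 f \<longleftrightarrow> continuous_on UNIV f"
  | "C_k (Suc r) f \<longleftrightarrow> f differentiable_on UNIV \<and> (\<forall>k. C_k r (partial_deriv k f))"

definition test_function :: "(real ^ 'n \<Rightarrow> real) \<Rightarrow> bool"
  where "test_function \<phi> \<longleftrightarrow>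
    (\<forall>r. C_k r \<phi>) \<and>
    (\<exists>K. compact K \<and> K \<subseteq> ball 0 1 \<and> (\<forall>x. x \<notin> K \<longrightarrow> \<phi> x = 0))"

subsection \<open>Sobolev spaces on the unit ball\<close>

definition L2_ball :: "(real ^ 'n \<Rightarrow> real) \<Rightarrow> bool"
  where "L2_ball u \<longleftrightarrow>
    u \<in> borel_measurable ball_measure \<and> integrable ball_measure (\<lambda>x. (u x)\<^sup>2)"

definition has_weak_gradient :: "(real ^ 'n \<Rightarrow> real) \<Rightarrow> (real ^ 'n \<Rightarrow> real ^ 'n) \<Rightarrow> bool"
  where "has_weak_gradient u G \<longleftrightarrow>
    (\<forall>k. L2_ball (\<lambda>x. G x $ k)) \<and>
    (\<forall>\<phi> k. test_function \<phi> \<longrightarrow>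
      (LINT x|ball_measure. u x * partial_deriv k \<phi> x) =
      - (LINT x|ball_measure. G x $ k * \<phi> x))"

definition H1_ball :: "(real ^ 'n \<Rightarrow> real) \<Rightarrow> bool"
  where "H1_ball u \<longleftrightarrow> L2_ball u \<and> (\<exists>G. has_weak_gradient u G)"

text \<open>The weak gradient is unique up to null sets; the choice does not affect any integral below.\<close>

definition weak_grad :: "(real ^ 'n \<Rightarrow> real) \<Rightarrow> real ^ 'n \<Rightarrow> real ^ 'n"
  where "weak_grad u = (SOME G. has_weak_gradient u G)"

definition H1_norm :: "(real ^ 'n \<Rightarrow> real) \<Rightarrow> real"
  where "H1_norm u = sqrt (LINT x|ball_measure. (norm (weak_grad u x))\<^sup>2 + (u x)\<^sup>2)"

definition H10_ball :: "(real ^ 'n \<Rightarrow> real) \<Rightarrow> bool"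
  where "H10_ball u \<longleftrightarrow>
    H1_ball u \<and> (\<forall>\<epsilon>>0. \<exists>\<phi>. test_function \<phi> \<and> H1_norm (\<lambda>x. u x - \<phi> x) < \<epsilon>)"

definition H10_nonzero :: "(real ^ 'n \<Rightarrow> real) set"
  where "H10_nonzero = {u. H10_ball u \<and> \<not> (AE x in ball_measure. u x = 0)}"

subsection \<open>Angular derivative, Rayleigh quotient and ground states\<close>

definition ang_deriv :: "'n \<Rightarrow> 'n \<Rightarrow> (real ^ 'n \<Rightarrow> real) \<Rightarrow> real ^ 'n \<Rightarrow> real"
  where "ang_deriv i j u x = x $ i * weak_grad u x $ j - x $ j * weak_grad u x $ i"

definition rayleigh :: "'n \<Rightarrow> 'n \<Rightarrow> real \<Rightarrow> real \<Rightarrow> real \<Rightarrow> (real ^ 'n \<Rightarrow> real) \<Rightarrow> real"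
  where "rayleigh i j \<alpha> m p u =
    (LINT x|ball_measure.
       (norm (weak_grad u x))\<^sup>2 - \<alpha>\<^sup>2 * (ang_deriv i j u x)\<^sup>2 + m * (u x)\<^sup>2) /
    (LINT x|ball_measure. \<bar>u x\<bar> powr p) powr (2 / p)"

text \<open>
  For \<open>0 \<le> \<alpha> \<le> 1\<close> and \<open>2 \<le> p < critical_exponent N\<close> the quotient is bounded below on
  \<open>H10_nonzero\<close>, so the real-valued infimum is the genuine one.
\<close>

definition ground_level :: "'n::finite \<Rightarrow> 'n \<Rightarrow> real \<Rightarrow> real \<Rightarrow> real \<Rightarrow> real"
  where "ground_level i j \<alpha> m p = (INF u\<in>H10_nonzero. rayleigh i j \<alpha> m p u)"

text \<open>
  Since \<open>\<partial>\<^sub>\<theta>\<close> is skew-adjoint, the term \<open>\<alpha>\<^sup>2 \<partial>\<^sub>\<theta>\<^sup>2 u\<close> contributes \<open>- \<alpha>\<^sup>2 \<integral> \<partial>\<^sub>\<theta>u \<partial>\<^sub>\<theta>\<phi>\<close> to the weak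
  formulation. The boundary condition is membership in \<open>H\<^sub>0\<^sup>1\<close>.
\<close>

definition weak_solution :: "'n \<Rightarrow> 'n \<Rightarrow> real \<Rightarrow> real \<Rightarrow> real \<Rightarrow> (real ^ 'n \<Rightarrow> real) \<Rightarrow> bool"
  where "weak_solution i j \<alpha> m p u \<longleftrightarrow>
    H10_ball u \<and>
    (\<forall>\<phi>. H10_ball \<phi> \<longrightarrow>
      (LINT x|ball_measure.
         weak_grad u x \<bullet> weak_grad \<phi> x - \<alpha>\<^sup>2 * (ang_deriv i j u x * ang_deriv i j \<phi> x)
           + m * (u x * \<phi> x)) =
      (LINT x|ball_measure. \<bar>u x\<bar> powr (p - 2) * u x * \<phi> x))"

definition ground_state :: "'n \<Rightarrow> 'n \<Rightarrow> real \<Rightarrow> real \<Rightarrow> real \<Rightarrow> (real ^ 'n \<Rightarrow> real) \<Rightarrow> bool"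
  where "ground_state i j \<alpha> m p u \<longleftrightarrow>
    u \<in> H10_nonzero \<and> weak_solution i j \<alpha> m p u \<and>
    rayleigh i j \<alpha> m p u = ground_level i j \<alpha> m p"

definition rotation :: "'n \<Rightarrow> 'n \<Rightarrow> real \<Rightarrow> real ^ 'n \<Rightarrow> real ^ 'n"
  where "rotation i j \<theta> x = (\<chi> k.
    if k = i then x $ i * cos \<theta> + x $ j * sin \<theta>
    else if k = j then - x $ i * sin \<theta> + x $ j * cos \<theta>
    else x $ k)"

definition nonradial :: "'n \<Rightarrow> 'n \<Rightarrow> (real ^ 'n \<Rightarrow> real) \<Rightarrow> bool"
  where "nonradial i j u \<longleftrightarrow>
    (\<exists>\<theta>. \<not> (AE x in ball_measure. u (rotation i j \<theta> x) = u x))"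

end

theory Submission
  imports Defs
begin

text \<open>
  Let \<open>S\<close> be the infimum of \<open>(\<integral>|\<nabla>v|\<^sup>2 + v\<^sup>2) / \<parallel>v\<parallel>\<^sub>p\<^sup>2\<close> over the nonzero smooth functions of compact support on the
  whole space. Functions on the ball are functions on the space, so a dilation by \<open>\<surd>m\<close> and
  a density argument give \<open>S m\<^sup>\<gamma>\<close> with \<open>\<gamma> = 1 - N/2 + N/p\<close> as a lower bound for the level with
  \<open>\<alpha> = 0\<close> (lemma \<open>rayleigh_lower_bound\<close>; there \<open>m\<^sup>\<gamma>\<close> appears as \<open>m (\<surd>m\<^sup>N)\<^bsup>2/p - 1\<^esup>\<close>).

  For \<open>\<alpha> > 0\<close> a nearly optimal \<open>v\<close>, shrunk to the scale \<open>1/\<surd>m\<close>, is placed at the point \<open>e\<^sub>i/2\<close>. There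
  the angular derivative is close to \<open>\<partial>\<^sub>j/2\<close>, so the term \<open>- \<alpha>\<^sup>2 |\<partial>\<^sub>\<theta>u|\<^sup>2\<close> lowers the coefficient of
  \<open>|\<partial>\<^sub>ju|\<^sup>2\<close>, certainly to \<open>s\<^sup>2 = 1 - \<alpha>\<^sup>2/16\<close>. Compressing \<open>v\<close> by the factor \<open>s\<close> in
  direction \<open>j\<close> restores the isotropic energy, and the change of volume leaves the quotient
  \<open>s\<^bsup>1 - 2/p\<^esup> S m\<^sup>\<gamma>\<close>, up to relative errors that are arbitrarily small for large \<open>m\<close>
  (lemma \<open>concentrated_competitor\<close>). Since \<open>p > 2\<close>, the factor \<open>s\<^bsup>1 - 2/p\<^esup>\<close> is less than \<open>1\<close>, and the
  strict inequality follows as soon as \<open>S > 0\<close>.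

  The positivity of \<open>S\<close> is the subcritical Sobolev inequality (lemma \<open>Sobolev_subcritical\<close>). It comes from
  averaging the fundamental theorem of calculus along the segments \<open>x + t z\<close>, with \<open>z\<close> in the unit cube:
  \<open>|v(x)|\<close> is at most the integral over \<open>t \<in> (0, 1)\<close> of the means of \<open>F = |v| + N |\<nabla>v|\<close> over cubes of
  size \<open>t\<close> at \<open>x\<close>. Such a mean is bounded by \<open>t\<^bsup>-N/2\<^esup> \<parallel>F\<parallel>\<^sub>2\<close> pointwise and by \<open>\<parallel>F\<parallel>\<^sub>2\<close> in \<open>L\<^sup>2\<close>, hence by
  \<open>t\<^bsup>-N(1/2 - 1/p)\<^esup> \<parallel>F\<parallel>\<^sub>2\<close> in \<open>L\<^sup>p\<close>, and this power of \<open>t\<close> is integrable exactly for subcritical \<open>p\<close>.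

  Finally, a function that is invariant under the rotations has vanishing angular derivative (lemma
  \<open>radial_imp_angular_derivative_0\<close>), so the two Rayleigh quotients agree on it. If it were a ground state
  for \<open>\<alpha>\<close>, its level would be at least the one for \<open>\<alpha> = 0\<close>.
\<close>

section \<open>Calculus of smooth functions\<close>

definition grad :: "(real ^ 'n \<Rightarrow> real) \<Rightarrow> real ^ 'n \<Rightarrow> real ^ 'n"
  where "grad f x = (\<chi> k. partial_deriv k f x)"

lemma C_k_Suc_D: "C_k (Suc r) f \<Longrightarrow> C_k r f"
proof (induction r arbitrary: f)
  case 0
  then show ?case by (simp add: differentiable_imp_continuous_on)
next
  case (Suc r)
  then show ?case by auto
qed

lemma C_k_differentiable: "C_k (Suc r) f \<Longrightarrow> f differentiable (at x)"
  by (simp add: differentiable_on_def)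

lemma has_derivative_grad:
  assumes "f differentiable (at x)"
  shows "(f has_derivative (\<lambda>h. grad f x \<bullet> h)) (at x)"
proof -
  have d: "(f has_derivative frechet_derivative f (at x)) (at x)"
    using assms frechet_derivative_works by blast
  have "frechet_derivative f (at x) h = grad f x \<bullet> h" for h
  proof -
    have l: "linear (frechet_derivative f (at x))"
      using d has_derivative_linear by blast
    have "frechet_derivative f (at x) h = frechet_derivative f (at x) (\<Sum>k\<in>UNIV. (h $ k) *\<^sub>R axis k 1)"
      by (simp add: basis_expansion flip: scalar_mult_eq_scaleR)
    also have "\<dots> = (\<Sum>k\<in>UNIV. h $ k * partial_deriv k f x)"
      by (simp add: linear_sum[OF l] linear_cmul[OF l] partial_deriv_def)
    also have "\<dots> = grad f x \<bullet> h"
      by (simp add: grad_def inner_vec_def mult.commute)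
    finally show ?thesis .
  qed
  then have "frechet_derivative f (at x) = (\<lambda>h. grad f x \<bullet> h)" by auto
  with d show ?thesis by simp
qed

lemma partial_deriv_eqI:
  assumes "(f has_derivative f') (at x)"
  shows "partial_deriv k f x = f' (axis k 1)"
  using frechet_derivative_at[OF assms] by (simp add: partial_deriv_def)

lemma C_k_const: "C_k r (\<lambda>x. c)"
proof (induction r arbitrary: c)
  case 0 then show ?case by simp
next
  case (Suc r)
  have "partial_deriv k (\<lambda>x. c) = (\<lambda>x. 0)" for k :: 'a
    by (rule ext, subst partial_deriv_eqI[of _ "\<lambda>_. 0"]) auto
  then show ?case using Suc[of 0] differentiable_on_const by auto
qed

lemma partial_deriv_add:
  assumes "f differentiable (at x)" "g differentiable (at x)"
  shows "partial_deriv k (\<lambda>x. f x + g x) x = partial_deriv k f x + partial_deriv k g x"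
  by (subst partial_deriv_eqI[OF has_derivative_add[OF has_derivative_grad[OF assms(1)] has_derivative_grad[OF assms(2)]]])
     (simp add: grad_def inner_axis)

lemma partial_deriv_mult:
  assumes "f differentiable (at x)" "g differentiable (at x)"
  shows "partial_deriv k (\<lambda>x. f x * g x) x = f x * partial_deriv k g x + partial_deriv k f x * g x"
  by (subst partial_deriv_eqI[OF has_derivative_mult[OF has_derivative_grad[OF assms(1)] has_derivative_grad[OF assms(2)]]])
     (simp add: grad_def inner_axis)

lemma C_k_add: "C_k r f \<Longrightarrow> C_k r g \<Longrightarrow> C_k r (\<lambda>x. f x + g x)"
proof (induction r arbitrary: f g)
  case 0 then show ?case by (auto intro: continuous_intros)
next
  case (Suc r)
  have "partial_deriv k (\<lambda>x. f x + g x) = (\<lambda>x. partial_deriv k f x + partial_deriv k g x)" for k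
    using Suc.prems by (intro ext partial_deriv_add) (auto intro: C_k_differentiable)
  then show ?case using Suc by (auto intro: differentiable_on_add)
qed

lemma C_k_mult: "C_k r f \<Longrightarrow> C_k r g \<Longrightarrow> C_k r (\<lambda>x. f x * g x)"
proof (induction r arbitrary: f g)
  case 0 then show ?case by (auto intro: continuous_intros)
next
  case (Suc r)
  have "partial_deriv k (\<lambda>x. f x * g x) = (\<lambda>x. f x * partial_deriv k g x + partial_deriv k f x * g x)" for k
    using Suc.prems by (intro ext partial_deriv_mult) (auto intro: C_k_differentiable)
  moreover have "C_k r f" "C_k r g" using Suc.prems by (blast intro: C_k_Suc_D)+
  ultimately show ?case using Suc
    by (auto intro!: differentiable_on_mult C_k_add)
qed

lemma C_k_sum: "(\<And>a. a \<in> A \<Longrightarrow> C_k r (f a)) \<Longrightarrow> C_k r (\<lambda>x. \<Sum>a\<in>A. f a x)"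
  by (induction A rule: infinite_finite_induct) (auto intro: C_k_add C_k_const)

lemma C_k_prod: "(\<And>a. a \<in> A \<Longrightarrow> C_k r (f a)) \<Longrightarrow> C_k r (\<lambda>x. \<Prod>a\<in>A. f a x)"
  by (induction A rule: infinite_finite_induct) (auto intro: C_k_mult C_k_const)

lemma has_derivative_affine:
  fixes A :: "real ^ 'n \<Rightarrow> real ^ 'n"
  assumes "linear A"
  shows "((\<lambda>x. A x + b) has_derivative A) (at x)"
  using has_derivative_add[OF linear_imp_has_derivative[OF assms] has_derivative_const[of b]] by simp

lemma partial_deriv_affine:
  fixes A :: "real ^ 'n \<Rightarrow> real ^ 'n"
  assumes A: "linear A" and f: "f differentiable (at (A x + b))"
  shows "partial_deriv k (\<lambda>x. f (A x + b)) x = (\<Sum>l\<in>UNIV. A (axis k 1) $ l * partial_deriv l f (A x + b))"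
  by (subst partial_deriv_eqI[OF has_derivative_compose[OF has_derivative_affine[OF A] has_derivative_grad[OF f]]])
     (simp add: grad_def inner_vec_def mult.commute)

lemma C_k_affine:
  fixes A :: "real ^ 'n \<Rightarrow> real ^ 'n"
  assumes A: "linear A"
  shows "C_k r f \<Longrightarrow> C_k r (\<lambda>x. f (A x + b))"
proof (induction r arbitrary: f)
  case 0
  then show ?case
    using linear_continuous_on[OF linear_conv_bounded_linear[THEN iffD1, OF A], of UNIV]
    by (auto intro!: continuous_on_compose2[of UNIV f] continuous_intros)
next
  case (Suc r)
  have "partial_deriv k (\<lambda>x. f (A x + b)) = (\<lambda>x. \<Sum>l\<in>UNIV. A (axis k 1) $ l * partial_deriv l f (A x + b))" for k
    using Suc.prems by (intro ext partial_deriv_affine A) (auto intro: C_k_differentiable)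
  moreover have "C_k r (\<lambda>x. \<Sum>l\<in>UNIV. A (axis k 1) $ l * partial_deriv l f (A x + b))" for k
    using Suc by (intro C_k_sum C_k_mult C_k_const) auto
  moreover have "(\<lambda>x. f (A x + b)) differentiable (at x)" for x
    using has_derivative_compose[OF has_derivative_affine[OF A] has_derivative_grad] Suc.prems C_k_differentiable
    unfolding differentiable_def by blast
  ultimately show ?case
    by (auto simp: differentiable_on_def)
qed

lemma C_k_coordinate:
  fixes l :: "'n::finite"
  shows "C_k r (\<lambda>x. x $ l)"
proof -
  have d: "((\<lambda>x. x $ l) has_derivative (\<lambda>h. h $ l)) (at x)" for x :: "real ^ 'n"
    by (rule bounded_linear_imp_has_derivative) (rule bounded_linear_vec_nth)
  show ?thesis
  proof (cases r)
    case 0 then show ?thesis by (auto intro: continuous_intros)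
  next
    case (Suc r')
    have "partial_deriv k (\<lambda>x. x $ l) = (\<lambda>x. axis k 1 $ l)" for k :: 'n
      by (intro ext partial_deriv_eqI d)
    then show ?thesis using Suc C_k_const d
      by (auto simp: differentiable_on_def intro!: differentiableI)
  qed
qed

section \<open>Smooth bumps on boxes\<close>

text \<open>The functions \<open>t\<^bsup>-k\<^esup> e\<^bsup>-1/t\<^esup>\<close>, extended by zero to the left half line. The derivative of each
  member is a combination of two others, so the family as a whole is closed under differentiation and
  every member is smooth.\<close>

definition flat :: "nat \<Rightarrow> real \<Rightarrow> real"
  where "flat k t = (if t > 0 then exp (- (1 / t)) / t ^ k else 0)"

lemma flat_tendsto_0: "(flat k \<longlongrightarrow> 0) (at 0)"
proof -
  have "((\<lambda>s::real. s ^ k / exp s) \<longlongrightarrow> 0) at_top" by (rule tendsto_power_div_exp_0)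
  moreover have "filterlim (\<lambda>t::real. inverse t) at_top (at_right 0)"
    by (rule filterlim_inverse_at_top_right)
  ultimately have "((\<lambda>t::real. inverse t ^ k / exp (inverse t)) \<longlongrightarrow> 0) (at_right 0)"
    by (rule filterlim_compose)
  then have "(flat k \<longlongrightarrow> 0) (at_right 0)"
    by (rule Lim_transform_eventually)
       (auto simp: eventually_at_right_field flat_def exp_minus field_simps intro: exI[of _ 1])
  moreover have "(flat k \<longlongrightarrow> 0) (at_left 0)"
    by (rule Lim_transform_eventually[OF tendsto_const])
       (auto simp: eventually_at_left_field flat_def intro: exI[of _ "-1"])
  ultimately show ?thesis using filterlim_split_at by blast
qed

lemma flat_has_derivative:
  "(flat k has_real_derivative flat (k + 2) t - real k * flat (k + 1) t) (at t)"
proof (cases t "0::real" rule: linorder_cases)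
  case less
  have "((\<lambda>_. 0) has_real_derivative 0) (at t)" by simp
  then have "(flat k has_real_derivative 0) (at t)"
    by (rule DERIV_cong_ev[THEN iffD1, rotated 3])
       (use less in \<open>auto simp: flat_def eventually_at_filter eventually_nhds intro!: exI[of _ "{..<0::real}"]\<close>)
  then show ?thesis using less by (simp add: flat_def)
next
  case equal
  have "((\<lambda>h. (flat k (0 + h) - flat k 0) / h) \<longlongrightarrow> 0) (at 0)"
    by (rule Lim_transform_eventually[OF flat_tendsto_0[of "Suc k"]])
       (auto simp: flat_def eventually_at_filter field_simps)
  then show ?thesis using equal by (simp add: DERIV_def flat_def)
next
  case greater
  have "((\<lambda>t. exp (- (1 / t)) / t ^ k) has_real_derivative flat (k + 2) t - real k * flat (k + 1) t) (at t)"
  proof -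
    have "((\<lambda>s. exp (- s) * s ^ k) has_real_derivative
        real k * s ^ (k - 1) * exp (- s) - exp (- s) * s ^ k) (at s)" for s
      by (auto intro!: derivative_eq_intros)
    moreover have "((\<lambda>t. 1 / t) has_real_derivative - (1 / t ^ 2)) (at t)"
      using greater by (auto intro!: derivative_eq_intros simp: power2_eq_square)
    ultimately have "((\<lambda>t. exp (- (1 / t)) * (1 / t) ^ k) has_real_derivative
        (real k * (1 / t) ^ (k - 1) * exp (- (1 / t)) - exp (- (1 / t)) * (1 / t) ^ k) * (- (1 / t ^ 2))) (at t)"
      by (rule DERIV_chain2)
    moreover have "(real k * (1 / t) ^ (k - 1) * exp (- (1 / t)) - exp (- (1 / t)) * (1 / t) ^ k) * (- (1 / t ^ 2))
        = flat (k + 2) t - real k * flat (k + 1) t"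
      using greater by (cases k) (simp_all add: flat_def field_simps power2_eq_square power_add)
    ultimately show ?thesis by (simp add: power_one_over)
  qed
  then show ?thesis
    by (rule DERIV_cong_ev[THEN iffD1, rotated 3])
       (use greater in \<open>auto simp: flat_def eventually_nhds intro!: exI[of _ "{0::real<..}"]\<close>)
qed

lemma C_k_flat: "C_k r (\<lambda>x. flat k (a * x $ l + b))"
proof (induction r arbitrary: k)
  case 0
  have "continuous_on UNIV (flat k)"
    by (rule DERIV_continuous_on) (rule has_field_derivative_at_within[OF flat_has_derivative])
  then show ?case
    by (auto intro!: continuous_on_compose2[of UNIV "flat k"] continuous_intros)
next
  case (Suc r)
  let ?F = "\<lambda>x. flat (k + 2) (a * x $ l + b) - real k * flat (k + 1) (a * x $ l + b)"
  have d: "((\<lambda>x. flat k (a * x $ l + b)) has_derivative (\<lambda>h. ?F x * (a * h $ l))) (at x)" for x :: "real ^ 'a"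
  proof -
    have "((\<lambda>x::real ^ 'a. a * x $ l + b) has_derivative (\<lambda>h. a * h $ l)) (at x)"
      by (auto intro!: derivative_eq_intros bounded_linear.has_derivative[OF bounded_linear_vec_nth])
    from has_derivative_compose[OF this flat_has_derivative[unfolded has_field_derivative_def]]
    show ?thesis .
  qed
  have "partial_deriv i (\<lambda>x. flat k (a * x $ l + b)) = (\<lambda>x. ?F x * (a * axis i 1 $ l))" for i
    by (intro ext partial_deriv_eqI d)
  moreover have "C_k r (\<lambda>x. (flat (k + 2) (a * x $ l + b) + (- real k) * flat (k + 1) (a * x $ l + b)) * (a * axis i 1 $ l))" for i
    by (intro C_k_mult C_k_add C_k_const Suc.IH)
  ultimately show ?case using d
    by (auto simp: differentiable_on_def intro: differentiableI)
qed

text \<open>The powers \<open>\<Phi>\<^bsup>1/n\<^esup>\<close> of one bump \<open>\<Phi>\<close> converge to the indicator of the box. For the flat function the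
  \<open>n\<close>-th root amounts to scaling the argument by \<open>n\<close>, which keeps every member smooth. The arguments are
  written as affine functions of one coordinate, the form in which \<open>C_k_flat\<close> gives smoothness.\<close>

definition box_bump :: "nat \<Rightarrow> real ^ 'n \<Rightarrow> real ^ 'n \<Rightarrow> real ^ 'n \<Rightarrow> real"
  where "box_bump n a b x =
    (\<Prod>k\<in>UNIV. flat 0 (real (Suc n) * x $ k + - (real (Suc n) * a $ k)) *
               flat 0 ((- real (Suc n)) * x $ k + real (Suc n) * b $ k))"

lemma C_k_box_bump: "C_k r (box_bump n a b)"
  unfolding box_bump_def[abs_def] by (intro C_k_prod C_k_mult C_k_flat)

lemma flat_0_bounds: "0 \<le> flat 0 t" "flat 0 t \<le> 1"
  by (auto simp: flat_def)

lemma box_bump_bounds: "0 \<le> box_bump n a b x" "box_bump n a b x \<le> 1"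
  unfolding box_bump_def
  by (auto intro!: prod_nonneg prod_le_1 mult_nonneg_nonneg mult_le_one flat_0_bounds)

lemma flat_0_pos_iff: "flat 0 t \<noteq> 0 \<longleftrightarrow> t > 0"
  by (auto simp: flat_def)

lemma box_bump_nonzero_iff: "box_bump n a b x \<noteq> 0 \<longleftrightarrow> x \<in> box a b"
proof -
  have "real (Suc n) * x $ k + - (real (Suc n) * a $ k) = real (Suc n) * (x $ k - a $ k)"
    and "(- real (Suc n)) * x $ k + real (Suc n) * b $ k = real (Suc n) * (b $ k - x $ k)" for k
    by (simp_all add: right_diff_distrib del: of_nat_Suc)
  then have "box_bump n a b x = (\<Prod>k\<in>UNIV. flat 0 (real (Suc n) * (x $ k - a $ k)) * flat 0 (real (Suc n) * (b $ k - x $ k)))"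
    by (simp only: box_bump_def)
  then show ?thesis
    by (simp add: mem_box_cart flat_0_pos_iff zero_less_mult_iff del: of_nat_Suc)
qed

lemma box_bump_tendsto: "(\<lambda>n. box_bump n a b x) \<longlonglongrightarrow> indicator (box a b) x"
proof (cases "x \<in> box a b")
  case True
  have *: "(\<lambda>n. flat 0 (real (Suc n) * d)) \<longlonglongrightarrow> 1" if "d > 0" for d
  proof -
    have "(\<lambda>n. exp (- (inverse (real (Suc n)) / d))) \<longlonglongrightarrow> exp (- (0 / d))"
      by (intro tendsto_intros LIMSEQ_inverse_real_of_nat) (use that in auto)
    then show ?thesis using that by (simp add: flat_def inverse_eq_divide mult.commute)
  qed
  have "(\<lambda>n. \<Prod>k\<in>UNIV. flat 0 (real (Suc n) * (x $ k - a $ k)) * flat 0 (real (Suc n) * (b $ k - x $ k)))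
      \<longlonglongrightarrow> (\<Prod>k\<in>(UNIV::'a set). 1 * 1)"
    by (intro tendsto_intros *) (use True in \<open>auto simp: mem_box_cart\<close>)
  then show ?thesis using True by (simp add: box_bump_def algebra_simps)
next
  case False
  then have "box_bump n a b x = 0" for n using box_bump_nonzero_iff by blast
  then show ?thesis using False by simp
qed

section \<open>Smooth functions of compact support\<close>

text \<open>Test functions without the restriction of the support to the unit ball, as needed for dilations.\<close>

definition Cc_smooth :: "(real ^ 'n \<Rightarrow> real) \<Rightarrow> bool"
  where "Cc_smooth f \<longleftrightarrow> (\<forall>r. C_k r f) \<and> (\<exists>\<rho>. \<forall>x. f x \<noteq> 0 \<longrightarrow> norm x \<le> \<rho>)"

lemma Cc_smooth_C_k: "Cc_smooth f \<Longrightarrow> C_k r f"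
  by (simp add: Cc_smooth_def)

lemma Cc_smooth_continuous: "Cc_smooth f \<Longrightarrow> continuous_on UNIV f"
  using Cc_smooth_C_k[of f 0] by simp

lemma Cc_smooth_differentiable: "Cc_smooth f \<Longrightarrow> f differentiable (at x)"
  using Cc_smooth_C_k[of f "Suc 0"] C_k_differentiable by blast

lemma Cc_smooth_has_derivative: "Cc_smooth f \<Longrightarrow> (f has_derivative (\<lambda>h. grad f x \<bullet> h)) (at x)"
  by (intro has_derivative_grad Cc_smooth_differentiable)

lemma Cc_smooth_support:
  assumes "Cc_smooth f"
  obtains \<rho> where "\<rho> > 0" "\<And>x. f x \<noteq> 0 \<Longrightarrow> norm x \<le> \<rho>"
proof -
  obtain \<rho> where "\<And>x. f x \<noteq> 0 \<Longrightarrow> norm x \<le> \<rho>" using assms by (auto simp: Cc_smooth_def)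
  then have "\<And>x. f x \<noteq> 0 \<Longrightarrow> norm x \<le> max \<rho> 1" by fastforce
  then show ?thesis using that[of "max \<rho> 1"] by auto
qed

lemma partial_deriv_support:
  assumes "\<And>x. f x \<noteq> 0 \<Longrightarrow> x \<in> K" "closed K" "partial_deriv k f x \<noteq> 0"
  shows "x \<in> K"
proof (rule ccontr)
  assume x: "x \<notin> K"
  have "((\<lambda>_. 0) has_derivative (\<lambda>_. 0)) (at x)" by simp
  then have "(f has_derivative (\<lambda>_. 0)) (at x)"
    by (rule has_derivative_transform_within_open[of _ _ _ _ "- K"]) (use assms x in auto)
  then show False using assms(3) partial_deriv_eqI by fastforce
qed

lemma grad_support:
  assumes "\<And>x. f x \<noteq> 0 \<Longrightarrow> x \<in> K" "closed K" "grad f x \<noteq> 0"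
  shows "x \<in> K"
proof -
  obtain k where "partial_deriv k f x \<noteq> 0"
    using assms(3) by (auto simp: grad_def vec_eq_iff)
  with assms(1,2) show ?thesis by (rule partial_deriv_support)
qed

lemma Cc_smooth_partial_deriv: "Cc_smooth f \<Longrightarrow> Cc_smooth (partial_deriv k f)"
proof -
  assume f: "Cc_smooth f"
  obtain \<rho> where "\<And>x. f x \<noteq> 0 \<Longrightarrow> norm x \<le> \<rho>" using Cc_smooth_support[OF f] by metis
  then have "partial_deriv k f x \<noteq> 0 \<longrightarrow> norm x \<le> \<rho>" for x
    using partial_deriv_support[of f "cball 0 \<rho>" k x] by auto
  moreover have "C_k r (partial_deriv k f)" for r
    using Cc_smooth_C_k[OF f, of "Suc r"] by simp
  ultimately show ?thesis unfolding Cc_smooth_def by blast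
qed

lemma Cc_smooth_mult: "\<forall>r. C_k r f \<Longrightarrow> Cc_smooth g \<Longrightarrow> Cc_smooth (\<lambda>x. f x * g x)"
  by (auto simp: Cc_smooth_def intro: C_k_mult)

lemma continuous_compact_support_integrable:
  fixes g :: "real ^ 'n \<Rightarrow> real"
  assumes "continuous_on UNIV g" "\<And>x. g x \<noteq> 0 \<Longrightarrow> norm x \<le> \<rho>"
  shows "integrable lborel g"
proof -
  have "integrable lborel (\<lambda>x. indicator (cball 0 \<rho>) x *\<^sub>R g x)"
    by (rule borel_integrable_compact) (auto intro: continuous_on_subset[OF assms(1)])
  moreover have "(\<lambda>x. indicator (cball 0 \<rho>) x *\<^sub>R g x) = g"
    using assms(2) by (fastforce simp: indicator_def)
  ultimately show ?thesis by simp
qed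

lemma Cc_smooth_integrable: "Cc_smooth f \<Longrightarrow> integrable lborel f"
  by (metis Cc_smooth_def Cc_smooth_continuous continuous_compact_support_integrable)

lemma Cc_smooth_borel: "Cc_smooth f \<Longrightarrow> f \<in> borel_measurable borel"
  by (intro borel_measurable_continuous_onI Cc_smooth_continuous)

lemma Cc_smooth_bounded:
  assumes "Cc_smooth f"
  obtains B where "B > 0" "\<And>x. \<bar>f x\<bar> \<le> B"
proof -
  obtain \<rho> where \<rho>: "\<And>x. f x \<noteq> 0 \<Longrightarrow> norm x \<le> \<rho>" using Cc_smooth_support[OF assms] by metis
  have "compact (f ` cball 0 \<rho>)"
    by (intro compact_continuous_image continuous_on_subset[OF Cc_smooth_continuous[OF assms]]) auto
  then obtain B where B: "B > 0" "\<And>y. y \<in> f ` cball 0 \<rho> \<Longrightarrow> norm y \<le> B"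
    using compact_imp_bounded bounded_pos by metis
  have "\<bar>f x\<bar> \<le> B" for x
    using B(1) B(2)[of "f x"] \<rho>[of x] by (cases "f x = 0") auto
  with B that show ?thesis by blast
qed

lemma Cc_smooth_lipschitz:
  assumes f: "Cc_smooth f"
  obtains L where "L > 0" "\<And>x y. \<bar>f x - f y\<bar> \<le> L * norm (x - y)"
proof -
  have "\<forall>k. \<exists>B>0. \<forall>x. \<bar>partial_deriv k f x\<bar> \<le> B"
    by (meson Cc_smooth_bounded Cc_smooth_partial_deriv f)
  then obtain B where B: "\<And>k. B k > 0" "\<And>k x. \<bar>partial_deriv k f x\<bar> \<le> B k" by metis
  have "norm (grad f x) \<le> (\<Sum>k\<in>UNIV. B k)" for x
    using norm_le_l1_cart[of "grad f x"] sum_mono[of UNIV "\<lambda>k. \<bar>partial_deriv k f x\<bar>" B] B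
    by (simp add: grad_def)
  moreover have "\<bar>grad f x \<bullet> h\<bar> \<le> norm (grad f x) * norm h" for x h
    by (rule Cauchy_Schwarz_ineq2)
  ultimately have "norm (grad f x \<bullet> h) \<le> (\<Sum>k\<in>UNIV. B k) * norm h" for x h
    by (metis mult_right_mono norm_ge_zero order_trans real_norm_def)
  then have "onorm (\<lambda>h. grad f x \<bullet> h) \<le> (\<Sum>k\<in>UNIV. B k)" for x
    by (intro onorm_le)
  then have "norm (f x - f y) \<le> (\<Sum>k\<in>UNIV. B k) * norm (x - y)" for x y
    by (intro differentiable_bound[of UNIV f "\<lambda>x h. grad f x \<bullet> h"])
       (auto intro: Cc_smooth_has_derivative[OF f])
  moreover have "(\<Sum>k\<in>UNIV. B k) > 0" using B by (intro sum_pos) auto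
  ultimately show ?thesis using that by auto
qed

lemma Cc_smooth_box_bump: "Cc_smooth (box_bump n a b)"
proof -
  have "box a b \<subseteq> cbox a b" by (rule box_subset_cbox)
  then obtain \<rho> where "\<And>x. x \<in> box a b \<Longrightarrow> norm x \<le> \<rho>"
    by (metis bounded_box bounded_iff)
  then show ?thesis
    unfolding Cc_smooth_def using C_k_box_bump box_bump_nonzero_iff by blast
qed

lemma test_function_Cc_smooth: "test_function \<phi> \<Longrightarrow> Cc_smooth \<phi>"
  unfolding test_function_def Cc_smooth_def by (metis bounded_iff compact_imp_bounded)

lemma test_function_support: "test_function \<phi> \<Longrightarrow> \<phi> x \<noteq> 0 \<Longrightarrow> x \<in> ball 0 1"
  unfolding test_function_def by blast

lemma test_functionI:
  assumes "\<And>r. C_k r f" "compact K" "K \<subseteq> ball 0 1" "\<And>x. f x \<noteq> 0 \<Longrightarrow> x \<in> K"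
  shows "test_function f"
  unfolding test_function_def using assms by blast

lemma test_function_mult: "\<forall>r. C_k r f \<Longrightarrow> test_function g \<Longrightarrow> test_function (\<lambda>x. f x * g x)"
  by (auto simp: test_function_def intro: C_k_mult)

lemma test_function_partial_deriv: 
  assumes "test_function \<phi>" shows "test_function (partial_deriv k \<phi>)"
proof -
  obtain K where K: "compact K" "K \<subseteq> ball 0 1" "\<And>x. \<phi> x \<noteq> 0 \<Longrightarrow> x \<in> K"
    using assms unfolding test_function_def by blast
  show ?thesis
  proof (rule test_functionI[OF _ K(1,2)])
    show "C_k r (partial_deriv k \<phi>)" for r
      using assms by (simp add: test_function_def) (metis C_k.simps(2))
    show "x \<in> K" if "partial_deriv k \<phi> x \<noteq> 0" for x
      using partial_deriv_support[OF K(3) compact_imp_closed[OF K(1)] that] .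
  qed
qed

section \<open>Integration by parts\<close>

text \<open>Dominated convergence for the difference quotients at \<open>h = 0\<close>, all of which are at most \<open>L |u|\<close> in size.\<close>

lemma differentiation_under_integral:
  fixes g :: "real \<Rightarrow> 'a \<Rightarrow> real"
  assumes u: "integrable M u"
    and meas: "\<And>h. g h \<in> borel_measurable M" "D \<in> borel_measurable M"
    and bdd: "\<And>x. \<bar>g 0 x\<bar> \<le> B"
    and lip: "\<And>h x. x \<in> space M \<Longrightarrow> \<bar>g h x - g 0 x\<bar> \<le> L * \<bar>h\<bar>"
    and der: "\<And>x. x \<in> space M \<Longrightarrow> ((\<lambda>h. g h x) has_real_derivative D x) (at 0)"
  shows "((\<lambda>h. LINT x|M. u x * g h x) has_real_derivative (LINT x|M. u x * D x)) (at 0)"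
proof -
  have um: "u \<in> borel_measurable M" using u by (rule borel_measurable_integrable)
  have i0: "integrable M (\<lambda>x. u x * g 0 x)"
    by (rule Bochner_Integration.integrable_bound[OF integrable_mult_left[of B, OF integrable_norm[OF u]]])
       (use um meas bdd order_trans[OF bdd abs_ge_self] in \<open>auto intro!: AE_I2 simp: abs_mult mult_left_mono\<close>)
  have id: "integrable M (\<lambda>x. u x * (g h x - g 0 x))" for h
  proof (rule Bochner_Integration.integrable_bound[OF integrable_mult_left[of "L * \<bar>h\<bar>", OF integrable_norm[OF u]]])
    show "AE x in M. norm (u x * (g h x - g 0 x)) \<le> norm (norm (u x) * (L * \<bar>h\<bar>))"
    proof (rule AE_I2)
      fix x assume "x \<in> space M"
      from lip[OF this, of h] show "norm (u x * (g h x - g 0 x)) \<le> norm (norm (u x) * (L * \<bar>h\<bar>))"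
        using order_trans[OF lip[OF \<open>x \<in> space M\<close>] abs_ge_self, of h] by (simp add: abs_mult mult_left_mono)
    qed
  qed (use um meas in auto)
  have ih: "(LINT x|M. u x * g h x) = (LINT x|M. u x * g 0 x) + (LINT x|M. u x * (g h x - g 0 x))" for h
    using Bochner_Integration.integral_add[OF i0 id[of h]] by (simp add: algebra_simps)
  have "((\<lambda>h. (LINT x|M. u x * (g h x - g 0 x)) / h) \<longlongrightarrow> (LINT x|M. u x * D x)) (at 0)"
    unfolding tendsto_at_iff_sequentially
  proof (intro allI impI)
    fix X :: "nat \<Rightarrow> real" assume X: "\<forall>i. X i \<in> UNIV - {0}" "X \<longlonglongrightarrow> 0"
    have "(\<lambda>i. LINT x|M. u x * ((g (X i) x - g 0 x) / X i)) \<longlonglongrightarrow> (LINT x|M. u x * D x)"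
    proof (rule integral_dominated_convergence[where w = "\<lambda>x. norm (u x) * L"])
      show "AE x in M. (\<lambda>i. u x * ((g (X i) x - g 0 x) / X i)) \<longlonglongrightarrow> u x * D x"
      proof (rule AE_I2)
        fix x assume "x \<in> space M"
        from der[OF this] have "((\<lambda>h. (g h x - g 0 x) / h) \<longlongrightarrow> D x) (at 0)"
          by (simp add: DERIV_def)
        then have "(\<lambda>i. (g (X i) x - g 0 x) / X i) \<longlonglongrightarrow> D x"
          unfolding tendsto_at_iff_sequentially using X by (auto simp: o_def)
        then show "(\<lambda>i. u x * ((g (X i) x - g 0 x) / X i)) \<longlonglongrightarrow> u x * D x"
          by (intro tendsto_intros)
      qed
      show "AE x in M. norm (u x * ((g (X i) x - g 0 x) / X i)) \<le> norm (u x) * L" for i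
      proof (rule AE_I2)
        fix x assume x: "x \<in> space M"
        have "\<bar>(g (X i) x - g 0 x) / X i\<bar> \<le> L"
          using lip[OF x, of "X i"] X(1)[rule_format, of i] by (simp add: divide_simps)
        then show "norm (u x * ((g (X i) x - g 0 x) / X i)) \<le> norm (u x) * L"
          unfolding real_norm_def abs_mult by (rule mult_left_mono) simp
      qed
    qed (use um meas u in auto)
    then show "((\<lambda>h. (LINT x|M. u x * (g h x - g 0 x)) / h) \<circ> X) \<longlonglongrightarrow> (LINT x|M. u x * D x)"
      by (simp only: o_def times_divide_eq_right integral_divide_zero)
  qed
  then show ?thesis unfolding DERIV_def by (subst ih) simp
qed

lemma Cc_smooth_derivative_along_curve:
  assumes "Cc_smooth f" "(\<gamma> has_vector_derivative v) (at t)"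
  shows "((\<lambda>t. f (\<gamma> t)) has_real_derivative (grad f (\<gamma> t) \<bullet> v)) (at t)"
  using has_derivative_compose[OF assms(2)[unfolded has_vector_derivative_def] Cc_smooth_has_derivative[OF assms(1)]]
  by (simp add: has_field_derivative_def mult_commute_abs)

lemma lborel_integral_translation:
  fixes f :: "real ^ 'n \<Rightarrow> real"
  assumes "f \<in> borel_measurable borel"
  shows "(LINT x|lborel. f (c + x)) = (LINT x|lborel. f x)"
proof -
  have "(LINT x|lborel. f x) = (LINT x|distr lborel borel ((+) c). f x)"
    by (simp add: lborel_distr_plus)
  also have "\<dots> = (LINT x|lborel. f (c + x))"
    by (rule integral_distr) (use assms in auto)
  finally show ?thesis by simp
qed

text \<open>The integral of a translate of \<open>f\<close> does not depend on the translation; differentiate at zero.\<close>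

lemma integral_partial_deriv_eq_0:
  assumes f: "Cc_smooth f"
  shows "(LINT x|lborel. partial_deriv k f x) = 0"
proof -
  obtain \<rho> where \<rho>: "\<rho> > 0" "\<And>x. f x \<noteq> 0 \<Longrightarrow> norm x \<le> \<rho>" using Cc_smooth_support[OF f] by metis
  obtain L where L: "\<And>x y. \<bar>f x - f y\<bar> \<le> L * norm (x - y)" using Cc_smooth_lipschitz[OF f] by metis
  obtain B where B: "\<And>x. \<bar>f x\<bar> \<le> B" using Cc_smooth_bounded[OF f] by metis
  define u :: "real ^ 'a \<Rightarrow> real" where "u = indicator (cball 0 (\<rho> + 1))"
  define e :: "real ^ 'a" where "e = axis k 1"
  have fm[measurable]: "f \<in> borel_measurable borel" "partial_deriv k f \<in> borel_measurable borel"
    using f by (auto intro: Cc_smooth_borel Cc_smooth_partial_deriv)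
  have "((\<lambda>h. LINT x|lborel. u x * f (h *\<^sub>R e + x)) has_real_derivative (LINT x|lborel. u x * partial_deriv k f x)) (at 0)"
  proof (rule differentiation_under_integral)
    show "integrable lborel u" unfolding u_def
      by (intro integrable_real_indicator) (use emeasure_bounded_finite[OF bounded_cball[of 0 "\<rho> + 1"]] in \<open>auto simp: less_top\<close>)
    show "\<bar>f (h *\<^sub>R e + x) - f (0 *\<^sub>R e + x)\<bar> \<le> L * \<bar>h\<bar>" for h x
      using L[of "h *\<^sub>R e + x" x] by (simp add: e_def norm_axis_1)
    show "((\<lambda>h. f (h *\<^sub>R e + x)) has_real_derivative partial_deriv k f x) (at 0)" for x
    proof -
      have "((\<lambda>h. h *\<^sub>R e + x) has_vector_derivative e) (at 0)"
        by (auto intro!: derivative_eq_intros)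
      from Cc_smooth_derivative_along_curve[OF f this] show ?thesis
        by (simp add: e_def inner_axis grad_def)
    qed
  qed (use B in auto)
  moreover have "(LINT x|lborel. u x * f (h *\<^sub>R e + x)) = (LINT x|lborel. f x)" if "\<bar>h\<bar> < 1" for h
  proof -
    have "u x * f (h *\<^sub>R e + x) = f (h *\<^sub>R e + x)" for x
    proof (cases "f (h *\<^sub>R e + x) = 0")
      case False
      have "norm x \<le> norm (h *\<^sub>R e + x) + norm (h *\<^sub>R e)"
        by (metis add.commute add_diff_cancel_left' norm_triangle_sub norm_minus_commute norm_triangle_ineq4 add_diff_cancel_right')
      also have "\<dots> \<le> \<rho> + 1" using \<rho>(2)[OF False] that by (simp add: e_def norm_axis_1)
      finally show ?thesis by (simp add: u_def)
    qed simp
    then show ?thesis by (simp only: lborel_integral_translation[OF fm(1)])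
  qed
  then have "((\<lambda>h. LINT x|lborel. u x * f (h *\<^sub>R e + x)) has_real_derivative 0) (at 0)"
    using has_field_derivative_transform_within_open[OF DERIV_const, of "{-1<..<1}" 0 "LINT x|lborel. f x"]
    by (simp add: abs_less_iff)
  ultimately have "(LINT x|lborel. u x * partial_deriv k f x) = 0"
    by (rule DERIV_unique)
  moreover have "u x * partial_deriv k f x = partial_deriv k f x" for x
  proof (cases "partial_deriv k f x = 0")
    case False
    then have "x \<in> cball 0 \<rho>" by (rule partial_deriv_support[rotated 2]) (use \<rho> in auto)
    then show ?thesis by (simp add: u_def)
  qed simp
  ultimately show ?thesis by simp
qed

section \<open>Integration on the unit ball\<close>

lemma ball_measure_borel:
  "f \<in> borel_measurable borel \<Longrightarrow> f \<in> borel_measurable ball_measure"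
  by (intro measurable_restrict_space1 measurable_completion) simp

lemma
  fixes f :: "real ^ 'n \<Rightarrow> real"
  assumes f: "f \<in> borel_measurable borel" and 0: "\<And>x. f x \<noteq> 0 \<Longrightarrow> x \<in> ball 0 1"
  shows LINT_ball_eq_lborel: "(LINT x|ball_measure. f x) = (LINT x|lborel. f x)"
    and integrable_ball_iff_lborel: "integrable ball_measure f \<longleftrightarrow> integrable lborel f"
proof -
  have e: "(\<lambda>x. indicator (ball 0 1) x *\<^sub>R f x) = f"
    using 0 by (fastforce simp: indicator_def)
  have b: "ball 0 1 \<inter> space lebesgue \<in> sets (lebesgue :: (real ^ 'n) measure)" by simp
  have "(LINT x|ball_measure. f x) = (LINT x|lebesgue. f x)"
    by (simp only: integral_restrict_space[OF b] e)
  also have "\<dots> = (LINT x|lborel. f x)"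
    by (rule integral_completion) (use f in simp)
  finally show "(LINT x|ball_measure. f x) = (LINT x|lborel. f x)" .
  have "integrable ball_measure f \<longleftrightarrow> integrable lebesgue f"
    by (simp only: integrable_restrict_space[OF b] e)
  also have "\<dots> \<longleftrightarrow> integrable lborel f"
    by (rule integrable_completion) (use f in simp)
  finally show "integrable ball_measure f \<longleftrightarrow> integrable lborel f" .
qed

lemma finite_ball_measure: "finite_measure ball_measure"
  using emeasure_bounded_finite[of "ball 0 1 :: (real ^ 'a) set"]
  by (intro finite_measureI) (auto simp: emeasure_restrict_space)

lemma integrable_mult_L2:
  fixes f g :: "'a \<Rightarrow> real"
  assumes "f \<in> borel_measurable M" "g \<in> borel_measurable M"
    and "integrable M (\<lambda>x. (f x)\<^sup>2)" "integrable M (\<lambda>x. (g x)\<^sup>2)"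
  shows "integrable M (\<lambda>x. f x * g x)"
proof (rule Bochner_Integration.integrable_bound)
  show "integrable M (\<lambda>x. (f x)\<^sup>2 + (g x)\<^sup>2)" using assms by simp
  have "\<bar>a * b\<bar> \<le> a\<^sup>2 + b\<^sup>2" for a b :: real
  proof -
    have "2 * (\<bar>a\<bar> * \<bar>b\<bar>) \<le> a\<^sup>2 + b\<^sup>2"
      using zero_le_power2[of "\<bar>a\<bar> - \<bar>b\<bar>"] by (simp add: power2_diff)
    moreover have "0 \<le> \<bar>a\<bar> * \<bar>b\<bar>" by simp
    ultimately show ?thesis by (simp only: abs_mult)
  qed
  then show "AE x in M. norm (f x * g x) \<le> norm ((f x)\<^sup>2 + (g x)\<^sup>2)" by simp
qed (use assms in measurable)

lemma L2_ball_mult: "L2_ball f \<Longrightarrow> L2_ball g \<Longrightarrow> integrable ball_measure (\<lambda>x. f x * g x)"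
  unfolding L2_ball_def by (intro integrable_mult_L2) auto

lemma L2_ball_const: "L2_ball (\<lambda>x. c)"
  using finite_ball_measure unfolding L2_ball_def by (auto intro: finite_measure.integrable_const)

lemma L2_ball_integrable: "L2_ball f \<Longrightarrow> integrable ball_measure f"
  using L2_ball_mult[OF _ L2_ball_const[of 1]] by simp

lemma L2_ball_cmult: "L2_ball f \<Longrightarrow> L2_ball (\<lambda>x. c * f x)"
  unfolding L2_ball_def by (auto simp: power_mult_distrib)

lemma L2_ball_add: "L2_ball f \<Longrightarrow> L2_ball g \<Longrightarrow> L2_ball (\<lambda>x. f x + g x)"
  using L2_ball_mult[of f g] unfolding L2_ball_def by (auto simp: power2_sum mult.assoc)

lemma L2_ball_diff: "L2_ball f \<Longrightarrow> L2_ball g \<Longrightarrow> L2_ball (\<lambda>x. f x - g x)"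
  using L2_ball_add[of f "\<lambda>x. -1 * g x"] L2_ball_cmult[of g "-1"] by simp

lemma L2_ball_mult_bounded:
  assumes f: "L2_ball f" and g: "g \<in> borel_measurable ball_measure" "\<And>x. x \<in> ball 0 1 \<Longrightarrow> \<bar>g x\<bar> \<le> B"
  shows "L2_ball (\<lambda>x. g x * f x)"
  unfolding L2_ball_def
proof
  show m: "(\<lambda>x. g x * f x) \<in> borel_measurable ball_measure"
    using f g by (intro borel_measurable_times) (auto simp: L2_ball_def)
  have fm: "f \<in> borel_measurable ball_measure" using f by (simp add: L2_ball_def)
  show "integrable ball_measure (\<lambda>x. (g x * f x)\<^sup>2)"
  proof (rule Bochner_Integration.integrable_bound)
    show "integrable ball_measure (\<lambda>x. B\<^sup>2 * (f x)\<^sup>2)" using f by (simp add: L2_ball_def)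
    have "(g x)\<^sup>2 \<le> B\<^sup>2" if "x \<in> ball 0 1" for x
      using g(2)[OF that] abs_le_square_iff[of "g x" B] by linarith
    then show "AE x in ball_measure. norm ((g x * f x)\<^sup>2) \<le> norm (B\<^sup>2 * (f x)\<^sup>2)"
      by (auto intro!: AE_I2 mult_right_mono simp: power_mult_distrib space_restrict_space simp del: mem_ball_0)
  qed (use m in measurable)
qed

lemma test_function_L2: "test_function \<phi> \<Longrightarrow> L2_ball \<phi>"
proof -
  assume \<phi>: "test_function \<phi>"
  have c: "Cc_smooth (\<lambda>x. \<phi> x * \<phi> x)"
    using \<phi> by (intro Cc_smooth_mult test_function_Cc_smooth) (auto simp: test_function_def)
  then have "integrable ball_measure (\<lambda>x. \<phi> x * \<phi> x)"
    by (subst integrable_ball_iff_lborel) (use \<phi> in \<open>auto intro: Cc_smooth_borel Cc_smooth_integrable dest: test_function_support\<close>)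
  then show ?thesis
    using \<phi> by (simp add: L2_ball_def power2_eq_square ball_measure_borel Cc_smooth_borel test_function_Cc_smooth)
qed

section \<open>The fundamental lemma of the calculus of variations\<close>

text \<open>Smooth bumps converge to the indicator of a box, so the integrals over all small boxes vanish;
  the Lebesgue differentiation theorem then recovers the point values.\<close>

lemma fundamental_lemma:
  fixes g :: "real ^ 'n \<Rightarrow> real"
  assumes g: "integrable ball_measure g"
    and 0: "\<And>\<phi>. test_function \<phi> \<Longrightarrow> (LINT x|ball_measure. g x * \<phi> x) = 0"
  shows "AE x in ball_measure. g x = 0"
proof -
  define f where "f x = indicator (ball 0 1) x *\<^sub>R g x" for x
  have f: "integrable lebesgue f"
    using g by (subst (asm) integrable_restrict_space) (auto simp: f_def[abs_def])
  have fi: "f integrable_on cbox a b" for a b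
    using f integrable_on_lebesgue integrable_on_subcbox by (metis integrable_on_subcbox subset_UNIV)
  have box0: "integral (cbox a b) f = 0" if ab: "cbox a b \<subseteq> ball 0 1" for a b
  proof -
    have t: "test_function (box_bump n a b)" for n
      using box_subset_cbox[of a b] ab box_bump_nonzero_iff[of n a b]
      by (intro test_functionI[of _ "cbox a b"] C_k_box_bump) auto
    have gm: "g \<in> borel_measurable ball_measure" using g by (rule borel_measurable_integrable)
    have bm: "box_bump n a b \<in> borel_measurable ball_measure" for n
      by (intro ball_measure_borel Cc_smooth_borel Cc_smooth_box_bump)
    have "(\<lambda>n. LINT x|ball_measure. g x * box_bump n a b x) \<longlonglongrightarrow> (LINT x|ball_measure. g x * indicator (box a b) x)"
    proof (rule integral_dominated_convergence[where w = "\<lambda>x. norm (g x)"])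
      show "AE x in ball_measure. (\<lambda>n. g x * box_bump n a b x) \<longlonglongrightarrow> g x * indicator (box a b) x"
        by (intro AE_I2 tendsto_intros box_bump_tendsto)
      show "AE x in ball_measure. norm (g x * box_bump n a b x) \<le> norm (g x)" for n
        using box_bump_bounds[of n a b] by (auto intro!: AE_I2 mult_left_le simp: abs_mult)
      show "(\<lambda>x. g x * indicator (box a b) x) \<in> borel_measurable ball_measure"
        by (intro borel_measurable_times[OF gm] ball_measure_borel) auto
    qed (use gm bm g in auto)
    then have "(LINT x|ball_measure. g x * indicator (box a b) x) = 0"
      by (simp add: 0[OF t] LIMSEQ_const_iff)
    also have "(LINT x|ball_measure. g x * indicator (box a b) x) = (LINT x|lebesgue. indicator (box a b) x *\<^sub>R f x)"
      by (subst integral_restrict_space) (auto simp: f_def mult_ac)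
    also have "\<dots> = integral (box a b) f"
    proof -
      have "set_integrable lebesgue (box a b) f"
        unfolding set_integrable_def using f by (intro integrable_mult_indicator) auto
      from set_lebesgue_integral_eq_integral(2)[OF this] show ?thesis
        by (simp add: set_lebesgue_integral_def)
    qed
    also have "\<dots> = integral (cbox a b) f" by (simp add: integral_open_interval)
    finally show ?thesis .
  qed
  obtain N where N: "negligible N"
    "\<And>x e. \<lbrakk>x \<notin> N; 0 < e\<rbrakk> \<Longrightarrow> \<exists>d>0. \<forall>h. 0 < h \<and> h < d \<longrightarrow>
        norm (integral (cbox x (x + h *\<^sub>R One)) f /\<^sub>R h ^ DIM(real ^ 'n) - f x) < e"
    using integrable_ccontinuous_explicit[OF fi] by metis
  have "g x = 0" if x: "x \<in> ball 0 1" "x \<notin> N" for x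
  proof (rule ccontr)
    assume "g x \<noteq> 0"
    then have "f x \<noteq> 0" using x by (simp add: f_def)
    then obtain d where d: "d > 0" "\<And>h. 0 < h \<Longrightarrow> h < d \<Longrightarrow>
        norm (integral (cbox x (x + h *\<^sub>R One)) f /\<^sub>R h ^ DIM(real ^ 'n) - f x) < norm (f x)"
      using N(2)[OF x(2), of "norm (f x)"] by auto
    obtain r where r: "r > 0" "ball x r \<subseteq> ball 0 1"
      using openE[OF open_ball x(1)] by metis
    define c where "c = norm (One :: real ^ 'n)"
    define h where "h = min (d / 2) (r / (2 * (c + 1)))"
    have c: "c \<ge> 0" by (simp add: c_def)
    have h: "0 < h" "h < d" using d r c by (auto simp: h_def)
    have "cbox x (x + h *\<^sub>R One) \<subseteq> ball x r"
    proof
      fix y assume y: "y \<in> cbox x (x + h *\<^sub>R One)"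
      have "norm (y - x) \<le> norm (h *\<^sub>R (One :: real ^ 'n))"
        by (rule norm_le_componentwise)
           (use y h in \<open>auto simp: mem_box inner_diff_left inner_add_left algebra_simps\<close>)
      also have "\<dots> = h * c" using h by (simp add: c_def)
      also have "\<dots> \<le> r / (2 * (c + 1)) * c" using c by (intro mult_right_mono) (auto simp: h_def)
      also have "\<dots> < r" using c r by (simp add: field_simps) (smt (verit) mult_nonneg_nonneg)
      finally show "y \<in> ball x r" by (simp add: dist_norm norm_minus_commute)
    qed
    then have "integral (cbox x (x + h *\<^sub>R One)) f = 0" using r by (intro box0) auto
    then show False using d(2)[OF h] by simp
  qed
  moreover have "AE x in lebesgue. x \<notin> N"
    using N(1) by (simp add: AE_not_in negligible_iff_null_sets)
  ultimately have "AE x in lebesgue. x \<in> ball 0 1 \<longrightarrow> g x = 0"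
    by (auto elim: eventually_mono)
  then show ?thesis by (subst AE_restrict_space_iff) auto
qed

section \<open>Weak gradients\<close>

lemma has_weak_gradient_L2: "has_weak_gradient u G \<Longrightarrow> L2_ball (\<lambda>x. G x $ k)"
  by (simp add: has_weak_gradient_def)

lemma weak_gradient_unique:
  fixes u :: "real ^ 'n \<Rightarrow> real"
  assumes "has_weak_gradient u G" "has_weak_gradient u H"
  shows "AE x in ball_measure. G x = H x"
proof -
  have "AE x in ball_measure. G x $ k - H x $ k = 0" for k
  proof (rule fundamental_lemma)
    have L2: "L2_ball (\<lambda>x. G x $ k)" "L2_ball (\<lambda>x. H x $ k)"
      using assms by (auto dest: has_weak_gradient_L2)
    then show "integrable ball_measure (\<lambda>x. G x $ k - H x $ k)"
      by (intro L2_ball_integrable L2_ball_diff)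
    fix \<phi> :: "real ^ 'n \<Rightarrow> real" assume \<phi>: "test_function \<phi>"
    have "integrable ball_measure (\<lambda>x. G x $ k * \<phi> x)" "integrable ball_measure (\<lambda>x. H x $ k * \<phi> x)"
      using L2 \<phi> by (auto intro: L2_ball_mult test_function_L2)
    then show "(LINT x|ball_measure. (G x $ k - H x $ k) * \<phi> x) = 0"
      using assms \<phi> by (simp add: left_diff_distrib has_weak_gradient_def)
  qed
  then have "AE x in ball_measure. \<forall>k\<in>UNIV. G x $ k - H x $ k = 0"
    by (intro AE_finite_allI) auto
  then show ?thesis by (rule AE_mp) (auto simp: vec_eq_iff)
qed

text \<open>Integration by parts: the product of two test functions has partial derivatives of integral zero.\<close>

lemma has_weak_gradient_grad:
  assumes \<phi>: "test_function \<phi>"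
  shows "has_weak_gradient \<phi> (grad \<phi>)"
  unfolding has_weak_gradient_def
proof (intro conjI allI impI)
  show "L2_ball (\<lambda>x. grad \<phi> x $ k)" for k
    using \<phi> by (simp add: grad_def test_function_L2 test_function_partial_deriv)
  fix \<psi> :: "real ^ 'a \<Rightarrow> real" and k assume \<psi>: "test_function \<psi>"
  have 1: "integrable ball_measure (\<lambda>x. \<phi> x * partial_deriv k \<psi> x)"
    and 2: "integrable ball_measure (\<lambda>x. partial_deriv k \<phi> x * \<psi> x)"
    using \<phi> \<psi> by (auto intro!: L2_ball_mult test_function_L2 test_function_partial_deriv)
  have t: "test_function (\<lambda>x. \<phi> x * \<psi> x)"
    using \<phi> \<psi> by (intro test_function_mult) (auto simp: test_function_def)
  have "0 = (LINT x|lborel. partial_deriv k (\<lambda>x. \<phi> x * \<psi> x) x)"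
    using integral_partial_deriv_eq_0 test_function_Cc_smooth[OF t] by metis
  also have "\<dots> = (LINT x|ball_measure. partial_deriv k (\<lambda>x. \<phi> x * \<psi> x) x)"
    by (intro LINT_ball_eq_lborel[symmetric] Cc_smooth_borel test_function_Cc_smooth test_function_partial_deriv t)
       (rule test_function_support[OF test_function_partial_deriv[OF t]])
  also have "\<dots> = (LINT x|ball_measure. \<phi> x * partial_deriv k \<psi> x + partial_deriv k \<phi> x * \<psi> x)"
    using \<phi> \<psi> by (simp add: partial_deriv_mult Cc_smooth_differentiable test_function_Cc_smooth)
  finally show "(LINT x|ball_measure. \<phi> x * partial_deriv k \<psi> x) = - (LINT x|ball_measure. grad \<phi> x $ k * \<psi> x)"
    using 1 2 by (simp add: grad_def)
qed

lemma has_weak_gradient_diff: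
  assumes "L2_ball u" "L2_ball v" "has_weak_gradient u G" "has_weak_gradient v H"
  shows "has_weak_gradient (\<lambda>x. u x - v x) (\<lambda>x. G x - H x)"
  unfolding has_weak_gradient_def
proof (intro conjI allI impI)
  have L2: "L2_ball (\<lambda>x. G x $ k)" "L2_ball (\<lambda>x. H x $ k)" for k
    using assms by (auto dest: has_weak_gradient_L2)
  then show "L2_ball (\<lambda>x. (G x - H x) $ k)" for k by (simp add: L2_ball_diff)
  fix \<psi> :: "real ^ 'a \<Rightarrow> real" and k assume \<psi>: "test_function \<psi>"
  have "integrable ball_measure (\<lambda>x. u x * partial_deriv k \<psi> x)" "integrable ball_measure (\<lambda>x. v x * partial_deriv k \<psi> x)"
    "integrable ball_measure (\<lambda>x. G x $ k * \<psi> x)" "integrable ball_measure (\<lambda>x. H x $ k * \<psi> x)"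
    using assms L2 \<psi> by (auto intro!: L2_ball_mult intro: test_function_L2 test_function_partial_deriv)
  then show "(LINT x|ball_measure. (u x - v x) * partial_deriv k \<psi> x) = - (LINT x|ball_measure. (G x - H x) $ k * \<psi> x)"
    using assms(3,4) \<psi> by (simp add: left_diff_distrib has_weak_gradient_def)
qed

lemma weak_grad_works: "H1_ball u \<Longrightarrow> has_weak_gradient u (weak_grad u)"
  unfolding weak_grad_def H1_ball_def by (metis someI)

lemma weak_grad_eq: "has_weak_gradient u G \<Longrightarrow> AE x in ball_measure. weak_grad u x = G x"
  using weak_gradient_unique someI[of "has_weak_gradient u" G] unfolding weak_grad_def by blast

lemma test_function_H1: "test_function \<phi> \<Longrightarrow> H1_ball \<phi>"
  using has_weak_gradient_grad test_function_L2 unfolding H1_ball_def by blast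

lemma test_function_H10: "test_function \<phi> \<Longrightarrow> H10_ball \<phi>"
proof -
  assume \<phi>: "test_function \<phi>"
  have "has_weak_gradient (\<lambda>x. \<phi> x - \<phi> x) (\<lambda>x. grad \<phi> x - grad \<phi> x)"
    using \<phi> by (intro has_weak_gradient_diff test_function_L2 has_weak_gradient_grad)
  then have "AE x in ball_measure. weak_grad (\<lambda>x. \<phi> x - \<phi> x) x = 0"
    by (auto dest: weak_grad_eq)
  then have "AE x in ball_measure. (norm (weak_grad (\<lambda>x. \<phi> x - \<phi> x) x))\<^sup>2 + (\<phi> x - \<phi> x)\<^sup>2 = 0"
    by (rule AE_mp) auto
  then have "(LINT x|ball_measure. (norm (weak_grad (\<lambda>x. \<phi> x - \<phi> x) x))\<^sup>2 + (\<phi> x - \<phi> x)\<^sup>2) = 0"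
    by (rule integral_eq_zero_AE)
  then have "H1_norm (\<lambda>x. \<phi> x - \<phi> x) = 0" unfolding H1_norm_def by simp
  then show ?thesis
    unfolding H10_ball_def using \<phi> test_function_H1 by metis
qed

section \<open>The subcritical Sobolev inequality\<close>

abbreviation unit_interval :: "real measure"
  where "unit_interval \<equiv> restrict_space lborel {0<..<1}"

abbreviation unit_cube :: "(real ^ 'n) measure"
  where "unit_cube \<equiv> restrict_space lborel (cbox 0 1)"

lemma nn_integral_unit_interval:
  assumes "\<And>t. t \<in> {0..1} \<Longrightarrow> 0 \<le> f t" "(f has_integral I) {0..1}"
  shows "(\<integral>\<^sup>+t. ennreal (f t) \<partial>unit_interval) = ennreal I"
proof -
  have "(f has_integral I) {0<..<1}"
    using assms(2) by (simp add: has_integral_Icc_iff_Ioo)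
  then show ?thesis
    using nn_integral_has_integral_lebesgue'[of "{0<..<1}" f I] assms(1)
    by (simp add: nn_integral_restrict_space)
qed

lemma nn_integral_powr_unit_interval:
  assumes "s > -1"
  shows "(\<integral>\<^sup>+t. ennreal (t powr s) \<partial>unit_interval) = ennreal (1 / (s + 1))"
  using has_integral_powr_from_0[OF assms, of 1] by (intro nn_integral_unit_interval) auto

text \<open>Hoelder's inequality for the measure \<open>t\<^bsup>-\<beta>/(p-1)\<^esup> dt\<close>, which is finite exactly for \<open>\<beta> < p - 1\<close>. Young's
  inequality is applied to \<open>q\<^bsup>p-1\<^esup> b(t)\<close> with a weight chosen so that the term that contains \<open>q\<^sup>p\<close>
  integrates to \<open>(1 - 1/p) q\<^sup>p\<close> and is absorbed on the left.\<close>

lemma weighted_Hoelder_unit_interval: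
  fixes b :: "real \<Rightarrow> real"
  assumes b: "b \<in> borel_measurable unit_interval" "\<And>t. 0 \<le> b t"
    and q: "0 \<le> q" "ennreal q \<le> (\<integral>\<^sup>+t. ennreal (b t) \<partial>unit_interval)"
    and p: "1 < p" "\<beta> < p - 1"
  shows "ennreal (q powr p) \<le> ennreal ((1 - \<beta> / (p - 1)) powr (1 - p)) * (\<integral>\<^sup>+t. ennreal (t powr \<beta> * b t powr p) \<partial>unit_interval)"
proof (cases "q = 0")
  case False
  with q have q0: "q > 0" by simp
  define k where "k = 1 - \<beta> / (p - 1)"
  define I where "I = (\<integral>\<^sup>+t. ennreal (t powr \<beta> * b t powr p) \<partial>unit_interval)"
  have k: "k > 0" using p by (simp add: k_def)
  have young: "q powr (p - 1) * b t \<le> k powr (1 - p) / p * (t powr \<beta> * b t powr p) + (1 - 1 / p) * q powr p * k * t powr (- \<beta> / (p - 1))"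
    if t: "t \<in> {0<..<1}" for t
  proof (cases "b t = 0")
    case True
    then show ?thesis using p k t by simp
  next
    case False
    with b(2)[of t] have b0: "b t > 0" by simp
    have "(k powr (1 - p) * (t powr \<beta> * b t powr p)) powr (1 / p) * (q powr p * k * t powr (- \<beta> / (p - 1))) powr (1 - 1 / p)
       \<le> 1 / p * (k powr (1 - p) * (t powr \<beta> * b t powr p)) + (1 - 1 / p) * (q powr p * k * t powr (- \<beta> / (p - 1)))"
      by (rule Youngs_inequality_0) (use p k t b0 q0 in auto)
    moreover have "(k powr (1 - p) * (t powr \<beta> * b t powr p)) powr (1 / p) * (q powr p * k * t powr (- \<beta> / (p - 1))) powr (1 - 1 / p)
      = q powr (p - 1) * b t"
    proof -
      have e1: "(1 - p) * (1 / p) + (1 - 1 / p) = 0" and e2: "\<beta> * (1 / p) + (- \<beta> / (p - 1)) * (1 - 1 / p) = 0"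
        and e3: "p * (1 - 1 / p) = p - 1" and e4: "p * (1 / p) = 1"
        using p by (auto simp: divide_simps) (simp add: algebra_simps)?
      have "(k powr (1 - p) * (t powr \<beta> * b t powr p)) powr (1 / p) * (q powr p * k * t powr (- \<beta> / (p - 1))) powr (1 - 1 / p)
        = (k powr ((1 - p) * (1 / p)) * k powr (1 - 1 / p)) * (t powr (\<beta> * (1 / p)) * t powr ((- \<beta> / (p - 1)) * (1 - 1 / p)))
          * (q powr (p * (1 - 1 / p)) * b t powr (p * (1 / p)))"
        using k t b0 q0 by (simp only: powr_mult powr_powr) (simp add: mult_ac)
      also have "\<dots> = q powr (p - 1) * b t"
        using k t b0 q0 by (simp only: powr_add[symmetric] e1 e2 e3 e4) simp
      finally show ?thesis .
    qed
    ultimately show ?thesis by (simp add: mult_ac)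
  qed
  have "ennreal (q powr p) = ennreal (q powr (p - 1)) * ennreal q"
  proof -
    have "q powr (p - 1) * q = q powr p" using q0 by (simp add: powr_diff)
    then show ?thesis using q0 by (metis ennreal_mult less_imp_le powr_ge_zero)
  qed
  also have "\<dots> \<le> ennreal (q powr (p - 1)) * (\<integral>\<^sup>+t. ennreal (b t) \<partial>unit_interval)"
    by (intro mult_left_mono q) simp
  also have "\<dots> = (\<integral>\<^sup>+t. ennreal (q powr (p - 1) * b t) \<partial>unit_interval)"
    using b by (simp add: ennreal_mult nn_integral_cmult)
  also have "\<dots> \<le> (\<integral>\<^sup>+t. ennreal (k powr (1 - p) / p) * ennreal (t powr \<beta> * b t powr p) + ennreal ((1 - 1 / p) * q powr p * k) * ennreal (t powr (- \<beta> / (p - 1))) \<partial>unit_interval)"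
  proof (rule nn_integral_mono)
    fix t assume "t \<in> space unit_interval"
    then have t: "t \<in> {0<..<1}" by (simp add: space_restrict_space)
    show "ennreal (q powr (p - 1) * b t) \<le> ennreal (k powr (1 - p) / p) * ennreal (t powr \<beta> * b t powr p) + ennreal ((1 - 1 / p) * q powr p * k) * ennreal (t powr (- \<beta> / (p - 1)))"
    proof -
      have split: "ennreal (A * Y + Z * W) = ennreal A * ennreal Y + ennreal Z * ennreal W"
        if "0 \<le> A" "0 \<le> Y" "0 \<le> Z" "0 \<le> W" for A Y Z W
        using that by (simp add: ennreal_mult ennreal_plus)
      show ?thesis
        using ennreal_leI[OF young[OF t]] p k
        by (subst (asm) split) auto
    qed
  qed
  also have "\<dots> = ennreal (k powr (1 - p) / p) * I + ennreal ((1 - 1 / p) * q powr p * k) * (\<integral>\<^sup>+t. ennreal (t powr (- \<beta> / (p - 1))) \<partial>unit_interval)"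
  proof -
    have [measurable]: "b \<in> borel_measurable unit_interval" by (rule b)
    have id[measurable]: "(\<lambda>t::real. t) \<in> borel_measurable unit_interval"
      by (intro measurable_restrict_space1) simp
    have m: "(\<lambda>t. ennreal (t powr \<beta> * b t powr p)) \<in> borel_measurable unit_interval"
      "(\<lambda>t. ennreal (t powr (- \<beta> / (p - 1)))) \<in> borel_measurable unit_interval"
      by measurable
    have "(\<lambda>t. ennreal (k powr (1 - p) / p) * ennreal (t powr \<beta> * b t powr p)) \<in> borel_measurable unit_interval"
      "(\<lambda>t. ennreal ((1 - 1 / p) * q powr p * k) * ennreal (t powr (- \<beta> / (p - 1)))) \<in> borel_measurable unit_interval"
      by measurable
    from nn_integral_add[OF this] show ?thesis
      by (simp only: nn_integral_cmult[OF m(1)] nn_integral_cmult[OF m(2)] I_def)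
  qed
  also have "(\<integral>\<^sup>+t. ennreal (t powr (- \<beta> / (p - 1))) \<partial>unit_interval) = ennreal (1 / k)"
    using p by (subst nn_integral_powr_unit_interval) (auto simp: k_def field_simps)
  also have "ennreal ((1 - 1 / p) * q powr p * k) * ennreal (1 / k) = ennreal ((1 - 1 / p) * q powr p)"
    using k p by (simp add: ennreal_mult[symmetric])
  finally have *: "ennreal (q powr p) \<le> ennreal (k powr (1 - p) / p) * I + ennreal ((1 - 1 / p) * q powr p)" .
  show ?thesis
  proof (cases I)
    case (real i)
    have "q powr p \<le> k powr (1 - p) / p * i + (1 - 1 / p) * q powr p"
      using * p k real by (simp add: ennreal_mult[symmetric] ennreal_plus[symmetric] del: ennreal_plus)
    then have "q powr p \<le> k powr (1 - p) * i" using p by (simp add: field_simps)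
    then show ?thesis
      using real k unfolding I_def[symmetric] k_def[symmetric] by (simp add: ennreal_mult[symmetric])
  next
    case top
    then show ?thesis using k unfolding I_def[symmetric] k_def[symmetric] by (simp add: ennreal_mult_top)
  qed
qed simp

lemma nn_integral_translation:
  fixes g :: "real ^ 'n \<Rightarrow> ennreal"
  assumes [measurable]: "g \<in> borel_measurable borel"
  shows "(\<integral>\<^sup>+x. g (x + c) \<partial>lborel) = (\<integral>\<^sup>+x. g x \<partial>lborel)"
proof -
  have "(\<integral>\<^sup>+x. g x \<partial>lborel) = (\<integral>\<^sup>+x. g x \<partial>distr lborel borel ((+) c))"
    by (simp add: lborel_distr_plus)
  also have "\<dots> = (\<integral>\<^sup>+x. g (x + c) \<partial>lborel)"
    by (subst nn_integral_distr) (auto simp: add.commute)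
  finally show ?thesis by simp
qed

lemma nn_integral_homothety:
  fixes g :: "real ^ 'n \<Rightarrow> ennreal"
  assumes [measurable]: "g \<in> borel_measurable borel" and t: "t > 0"
  shows "(\<integral>\<^sup>+z. g (x + t *\<^sub>R z) \<partial>lborel) = ennreal (t powr (- real CARD('n))) * (\<integral>\<^sup>+x. g x \<partial>lborel)"
proof -
  have "(\<integral>\<^sup>+x. g x \<partial>lborel) = (\<integral>\<^sup>+x. g x \<partial>density (distr lborel borel (\<lambda>z. x + t *\<^sub>R z)) (\<lambda>_. \<bar>t\<bar> ^ DIM(real ^ 'n)))"
    using t by (subst lborel_affine[of t x]) auto
  also have "\<dots> = ennreal (t ^ CARD('n)) * (\<integral>\<^sup>+z. g (x + t *\<^sub>R z) \<partial>lborel)"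
    using t by (simp add: nn_integral_density nn_integral_distr nn_integral_cmult)
  finally have "ennreal (t powr (- real CARD('n))) * (\<integral>\<^sup>+x. g x \<partial>lborel)
      = ennreal (t powr (- real CARD('n)) * t ^ CARD('n)) * (\<integral>\<^sup>+z. g (x + t *\<^sub>R z) \<partial>lborel)"
    using t by (simp add: ennreal_mult mult.assoc)
  also have "t powr (- real CARD('n)) * t ^ CARD('n) = 1"
    using t by (simp add: powr_realpow[symmetric] flip: powr_add)
  finally show ?thesis by simp
qed

lemma emeasure_unit_cube: "emeasure unit_cube (space (unit_cube :: (real ^ 'n) measure)) = 1"
  proof -
  have "(1 :: real ^ 'n) \<bullet> b = 1" if "b \<in> Basis" for b
    using that by (auto simp: Basis_vec_def inner_axis)
  then show ?thesis
    by (simp add: space_restrict_space emeasure_restrict_space emeasure_lborel_cbox_eq)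
qed

lemma unit_cube_norm: "z \<in> cbox 0 (1 :: real ^ 'n) \<Longrightarrow> norm z \<le> real CARD('n)"
proof -
  assume z: "z \<in> cbox 0 (1 :: real ^ 'n)"
  have "norm z \<le> (\<Sum>k\<in>(UNIV::'n set). 1)"
    using z by (intro order_trans[OF norm_le_l1_cart sum_mono]) (auto simp: mem_box_cart)
  then show ?thesis by simp
qed

lemma continuous_grad: "Cc_smooth v \<Longrightarrow> continuous_on UNIV (grad v)"
  unfolding grad_def[abs_def] using Cc_smooth_continuous[OF Cc_smooth_partial_deriv]
  by (intro continuous_on_vec_lambda) auto

text \<open>Integrate the derivative of \<open>(t - 1) v(x + t z)\<close>, which vanishes at \<open>t = 1\<close> and equals \<open>- v(x)\<close> at
  \<open>t = 0\<close>. The cutoff \<open>t - 1\<close> makes the estimate local.\<close>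

lemma abs_le_ray_integral:
  fixes v :: "real ^ 'n \<Rightarrow> real"
  assumes v: "Cc_smooth v" and z: "z \<in> cbox 0 1"
  shows "ennreal \<bar>v x\<bar> \<le> (\<integral>\<^sup>+t. ennreal (\<bar>v (x + t *\<^sub>R z)\<bar> + real CARD('n) * norm (grad v (x + t *\<^sub>R z))) \<partial>unit_interval)"
proof -
  let ?F = "\<lambda>y. \<bar>v y\<bar> + real CARD('n) * norm (grad v y)"
  have cont: "continuous_on {0..1} (\<lambda>t. ?F (x + t *\<^sub>R z))"
  proof -
    have l: "continuous_on {0..1} (\<lambda>t. x + t *\<^sub>R z)" by (intro continuous_intros)
    show ?thesis
      by (intro continuous_on_add continuous_on_rabs continuous_on_mult continuous_on_const continuous_on_norm
          continuous_on_compose2[OF Cc_smooth_continuous[OF v] l] continuous_on_compose2[OF continuous_grad[OF v] l]) auto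
  qed
  have der: "((\<lambda>t. (t - 1) * v (x + t *\<^sub>R z)) has_real_derivative v (x + t *\<^sub>R z) + (t - 1) * (grad v (x + t *\<^sub>R z) \<bullet> z)) (at t)" for t
  proof -
    have "((\<lambda>t. x + t *\<^sub>R z) has_vector_derivative z) (at t)"
      by (auto intro!: derivative_eq_intros)
    from Cc_smooth_derivative_along_curve[OF v this] show ?thesis
      by (auto intro!: derivative_eq_intros)
  qed
  have "((\<lambda>t. v (x + t *\<^sub>R z) + (t - 1) * (grad v (x + t *\<^sub>R z) \<bullet> z)) has_integral
      (1 - 1) * v (x + 1 *\<^sub>R z) - (0 - 1) * v (x + 0 *\<^sub>R z)) {0..1}"
    by (rule fundamental_theorem_of_calculus)
       (use der in \<open>auto simp: has_real_derivative_iff_has_vector_derivative[symmetric] intro: has_field_derivative_at_within\<close>)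
  then have h: "((\<lambda>t. v (x + t *\<^sub>R z) + (t - 1) * (grad v (x + t *\<^sub>R z) \<bullet> z)) has_integral v x) {0..1}" by simp
  have le: "norm (v (x + t *\<^sub>R z) + (t - 1) * (grad v (x + t *\<^sub>R z) \<bullet> z)) \<le> ?F (x + t *\<^sub>R z)" if "t \<in> {0..1}" for t
  proof -
    have "\<bar>(t - 1) * (grad v (x + t *\<^sub>R z) \<bullet> z)\<bar> \<le> 1 * (norm (grad v (x + t *\<^sub>R z)) * norm z)"
      unfolding abs_mult using that by (intro mult_mono Cauchy_Schwarz_ineq2) auto
    also have "\<dots> \<le> real CARD('n) * norm (grad v (x + t *\<^sub>R z))"
      using mult_left_mono[OF unit_cube_norm[OF z], of "norm (grad v (x + t *\<^sub>R z))"] by (simp add: mult.commute)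
    finally show ?thesis by simp
  qed
  have I: "(\<lambda>t. ?F (x + t *\<^sub>R z)) integrable_on {0..1}" by (rule integrable_continuous_interval[OF cont])
  have "\<bar>v x\<bar> \<le> integral {0..1} (\<lambda>t. ?F (x + t *\<^sub>R z))"
    using Henstock_Kurzweil_Integration.integral_norm_bound_integral[OF has_integral_integrable[OF h] I le] integral_unique[OF h] by simp
  then show ?thesis
    using nn_integral_unit_interval[OF _ integrable_integral[OF I]] by (simp add: ennreal_leI)
qed

lemma subcritical_less:
  assumes "2 < p" "ereal p < critical_exponent N"
  shows "real N * (p - 2) < 2 * p"
proof (cases "N \<le> 2")
  case True
  then have "real N * (p - 2) \<le> 2 * (p - 2)" using assms by (intro mult_right_mono) auto
  then show ?thesis by simp
next
  case False
  then have "p < 2 * real N / (real N - 2)" using assms by (simp add: critical_exponent_def)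
  then have "p * (real N - 2) < 2 * real N" using False by (simp add: field_simps)
  then show ?thesis by (simp add: algebra_simps)
qed

lemma nn_integral_const_unit_cube: "(\<integral>\<^sup>+z. c \<partial>(unit_cube :: (real ^ 'n) measure)) = c"
  by (subst nn_integral_const, subst emeasure_unit_cube) simp

lemma nn_integral_eq_LINT_compact_support:
  fixes v :: "real ^ 'n \<Rightarrow> real"
  assumes "continuous_on UNIV f" "\<And>x. f x \<noteq> 0 \<Longrightarrow> norm x \<le> \<rho>" "\<And>x. 0 \<le> (f x :: real)"
  shows "(\<integral>\<^sup>+x. ennreal (f x) \<partial>(lborel :: (real ^ 'n) measure)) = ennreal (LINT x|lborel. f x)"
  by (intro nn_integral_eq_integral continuous_compact_support_integrable[OF assms(1,2)]) (auto simp: assms)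

text \<open>In the notation of the proof, \<open>g t x\<close> and \<open>a t x\<close> are the means of \<open>F\<close> and \<open>F\<^sup>2\<close> over the cube
  of size \<open>t\<close> at \<open>x\<close>, so that \<open>g\<^sup>2 \<le> a \<le> t\<^bsup>-N\<^esup> K\<close>. The first bound is used for two of the \<open>p\<close> powers of
  \<open>g\<close>, the second one for the remaining \<open>p - 2\<close>, which keeps the estimate linear in \<open>a\<close> and allows
  the integration over \<open>x\<close>.\<close>

lemma Sobolev_subcritical:
  assumes p: "2 < p" "ereal p < critical_exponent CARD('n::finite)"
  obtains C where "C > 0" "\<And>v :: real ^ 'n \<Rightarrow> real. Cc_smooth v \<Longrightarrow>
    (LINT x|lborel. \<bar>v x\<bar> powr p) powr (2 / p) \<le> C * (LINT x|lborel. (norm (grad v x))\<^sup>2 + (v x)\<^sup>2)"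
proof -
  define N where "N = real CARD('n)"
  define e where "e = N * (p - 2) / 2"
  \<comment> \<open>The weighted Hoelder inequality needs \<open>\<beta> < p - 1\<close>, integrability of \<open>t\<^bsup>\<beta>-e\<^esup>\<close> needs \<open>\<beta> > e - 1\<close>; this is the midpoint.\<close>
  define \<beta> where "\<beta> = (e + p) / 2 - 1"
  define c where "c = (1 - \<beta> / (p - 1)) powr (1 - p)"
  define c' where "c' = c / (\<beta> - e + 1)"
  have N1: "N \<ge> 1" unfolding N_def by (simp add: Suc_le_eq)
  have ep: "e < p" using subcritical_less[OF p] by (simp add: e_def N_def)
  have \<beta>: "\<beta> < p - 1" "\<beta> - e > -1" using ep by (auto simp: \<beta>_def field_simps)
  have k: "1 - \<beta> / (p - 1) > 0" using \<beta> p by simp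
  have c: "c > 0" unfolding c_def powr_gt_zero using k by linarith
  have c': "c' > 0" unfolding c'_def using c \<beta> by simp
  show ?thesis
  proof
    show "c' powr (2 / p) * (2 * N\<^sup>2) > 0" using c' N1 by simp
    fix v :: "real ^ 'n \<Rightarrow> real" assume v: "Cc_smooth v"
    obtain \<rho> where \<rho>: "\<And>x. v x \<noteq> 0 \<Longrightarrow> norm x \<le> \<rho>" using Cc_smooth_support[OF v] by metis
    have g\<rho>: "norm x \<le> \<rho>" if "grad v x \<noteq> 0" for x
      using grad_support[of v "cball 0 \<rho>" x] \<rho> that by auto
    have cv: "continuous_on UNIV v" and cg: "continuous_on UNIV (grad v)"
      using v by (auto intro: Cc_smooth_continuous continuous_grad)
    define F where "F y = \<bar>v y\<bar> + N * norm (grad v y)" for y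
    define K where "K = (LINT x|lborel. (F x)\<^sup>2)"
    define Q where "Q = (LINT x|lborel. (norm (grad v x))\<^sup>2 + (v x)\<^sup>2)"
    have cF: "continuous_on UNIV F" unfolding F_def[abs_def] by (intro continuous_intros cv cg)
    have F0: "0 \<le> F y" for y using N1 by (simp add: F_def)
    have F\<rho>: "norm x \<le> \<rho>" if "F x \<noteq> 0" for x using that \<rho>[of x] g\<rho>[of x]
      by (cases "v x = 0"; cases "grad v x = 0") (simp_all add: F_def)
    have [measurable]: "F \<in> borel_measurable borel" by (intro borel_measurable_continuous_onI cF)
    have K: "(\<integral>\<^sup>+x. ennreal ((F x)\<^sup>2) \<partial>lborel) = ennreal K" unfolding K_def
      by (intro nn_integral_eq_LINT_compact_support continuous_intros cF) (use F\<rho> in auto)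
    have K0: "0 \<le> K" unfolding K_def by simp
    have KQ: "K \<le> 2 * N\<^sup>2 * Q"
    proof -
      have i: "integrable lborel (\<lambda>x. (F x)\<^sup>2)" "integrable lborel (\<lambda>x. (norm (grad v x))\<^sup>2 + (v x)\<^sup>2)"
        by (intro continuous_compact_support_integrable[where \<rho> = \<rho>] continuous_intros cF cv cg; use F\<rho> \<rho> g\<rho> in \<open>auto simp: add_nonneg_eq_0_iff\<close>)+
      have "(F x)\<^sup>2 \<le> 2 * N\<^sup>2 * ((norm (grad v x))\<^sup>2 + (v x)\<^sup>2)" for x
      proof -
        have "(F x)\<^sup>2 \<le> 2 * \<bar>v x\<bar>\<^sup>2 + 2 * (N * norm (grad v x))\<^sup>2"
          using zero_le_power2[of "\<bar>v x\<bar> - N * norm (grad v x)"]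
          by (simp add: F_def power2_sum power2_diff)
        moreover have "1 * (v x)\<^sup>2 \<le> N\<^sup>2 * (v x)\<^sup>2" using N1 by (intro mult_right_mono) auto
        ultimately show ?thesis by (simp add: algebra_simps power_mult_distrib)
      qed
      then have "K \<le> (LINT x|lborel. 2 * N\<^sup>2 * ((norm (grad v x))\<^sup>2 + (v x)\<^sup>2))"
        unfolding K_def by (intro integral_mono i integrable_mult_right)
      then show ?thesis by (simp add: Q_def)
    qed

    interpret U: finite_measure "unit_cube :: (real ^ 'n) measure"
      by (rule finite_measureI) (simp only: emeasure_unit_cube, simp)
    interpret T: finite_measure unit_interval
      by (rule finite_measureI) (simp add: space_restrict_space emeasure_restrict_space)
    interpret TU: pair_sigma_finite unit_interval "unit_cube :: (real ^ 'n) measure" ..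
    interpret LU: pair_sigma_finite "lborel :: (real ^ 'n) measure" "unit_cube :: (real ^ 'n) measure" ..
    interpret LT: pair_sigma_finite "lborel :: (real ^ 'n) measure" unit_interval ..
    have idT: "(\<lambda>t. t) \<in> unit_interval \<rightarrow>\<^sub>M borel" and idU: "(\<lambda>z. z) \<in> (unit_cube :: (real ^ 'n) measure) \<rightarrow>\<^sub>M borel"
      by (intro measurable_restrict_space1; simp)+

    define a where "a t x = (\<integral>\<^sup>+z. ennreal ((F (x + t *\<^sub>R z))\<^sup>2) \<partial>unit_cube)" for t x
    define g where "g t x = (\<integral>\<^sup>+z. ennreal (F (x + t *\<^sub>R z)) \<partial>unit_cube)" for t x

    have a_le: "a t x \<le> ennreal (t powr (- N) * K)" if "t \<in> {0<..<1}" for t x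
    proof -
      have "a t x \<le> (\<integral>\<^sup>+z. ennreal ((F (x + t *\<^sub>R z))\<^sup>2) \<partial>lborel)" unfolding a_def
        by (subst nn_integral_restrict_space) (auto intro!: nn_integral_mono simp: indicator_def)
      also have "\<dots> = ennreal (t powr (- N)) * (\<integral>\<^sup>+x. ennreal ((F x)\<^sup>2) \<partial>lborel)"
        unfolding N_def by (rule nn_integral_homothety) (use that in auto)
      also have "\<dots> = ennreal (t powr (- N) * K)" using K0 by (simp add: K ennreal_mult)
      finally show ?thesis .
    qed
    have Fm: "(\<lambda>z. ennreal (F (x + t *\<^sub>R z))) \<in> borel_measurable unit_cube" for x t
      by (rule measurable_compose[OF idU]) measurable
    have g_a: "(g t x)\<^sup>2 \<le> a t x" for t x
    proof -
      have "(\<integral>\<^sup>+z. ennreal (F (x + t *\<^sub>R z)) * 1 \<partial>unit_cube)\<^sup>2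
          \<le> (\<integral>\<^sup>+z. (ennreal (F (x + t *\<^sub>R z)))\<^sup>2 \<partial>unit_cube) * (\<integral>\<^sup>+z. 1\<^sup>2 \<partial>(unit_cube :: (real ^ 'n) measure))"
        by (rule Cauchy_Schwarz_nn_integral) (use Fm in auto)
      then show ?thesis
        using emeasure_unit_cube[where 'n = 'n] by (simp add: g_def a_def ennreal_power F0)
    qed
    have g_fin: "g t x = ennreal (enn2real (g t x))" if "t \<in> {0<..<1}" for t x
    proof -
      have "(g t x)\<^sup>2 < top" using order_trans[OF g_a a_le[OF that]] by (rule le_less_trans) simp
      then have "g t x \<noteq> top" by (auto simp: power2_eq_square)
      then show ?thesis by (metis ennreal_enn2real less_top)
    qed
    have mT[measurable]: "(\<lambda>w. fst w) \<in> borel_measurable (unit_interval \<Otimes>\<^sub>M (unit_cube :: (real ^ 'n) measure))"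
      and mU[measurable]: "(\<lambda>w. snd w) \<in> borel_measurable (unit_interval \<Otimes>\<^sub>M (unit_cube :: (real ^ 'n) measure))"
      by (rule measurable_compose[OF measurable_fst idT], rule measurable_compose[OF measurable_snd idU])
    have FTU: "(\<lambda>w. ennreal (F (x + fst w *\<^sub>R snd w))) \<in> borel_measurable (unit_interval \<Otimes>\<^sub>M unit_cube)" for x
      by measurable
    have gm: "(\<lambda>t. g t x) \<in> borel_measurable unit_interval" for x
      unfolding g_def by (rule U.borel_measurable_nn_integral) (use FTU[of x] in \<open>simp add: case_prod_beta'\<close>)
    have v_g: "ennreal \<bar>v x\<bar> \<le> (\<integral>\<^sup>+t. g t x \<partial>unit_interval)" for x
    proof -
      have "ennreal \<bar>v x\<bar> = (\<integral>\<^sup>+z. ennreal \<bar>v x\<bar> \<partial>(unit_cube :: (real ^ 'n) measure))"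
        by (simp only: nn_integral_const_unit_cube)
      also have "\<dots> \<le> (\<integral>\<^sup>+z. (\<integral>\<^sup>+t. ennreal (F (x + t *\<^sub>R z)) \<partial>unit_interval) \<partial>unit_cube)"
        unfolding F_def N_def
        by (intro nn_integral_mono abs_le_ray_integral v) (simp add: space_restrict_space)
      also have "\<dots> = (\<integral>\<^sup>+t. g t x \<partial>unit_interval)"
        unfolding g_def by (rule TU.Fubini') (use FTU[of x] in \<open>simp add: case_prod_beta'\<close>)
      finally show ?thesis .
    qed

    have v_a: "ennreal (\<bar>v x\<bar> powr p) \<le> ennreal c * (\<integral>\<^sup>+t. a t x * ennreal (K powr ((p - 2) / 2) * t powr (\<beta> - e)) \<partial>unit_interval)" for x
    proof -
      have "ennreal (\<bar>v x\<bar> powr p) \<le> ennreal c * (\<integral>\<^sup>+t. ennreal (t powr \<beta> * enn2real (g t x) powr p) \<partial>unit_interval)"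
        unfolding c_def
      proof (rule weighted_Hoelder_unit_interval)
        have "(\<integral>\<^sup>+t. g t x \<partial>unit_interval) = (\<integral>\<^sup>+t. ennreal (enn2real (g t x)) \<partial>unit_interval)"
          by (intro nn_integral_cong g_fin) (simp add: space_restrict_space)
        then show "ennreal \<bar>v x\<bar> \<le> (\<integral>\<^sup>+t. ennreal (enn2real (g t x)) \<partial>unit_interval)"
          using v_g[of x] by (simp only:)
        show "(\<lambda>t. enn2real (g t x)) \<in> borel_measurable unit_interval" using gm by measurable
      qed (use p \<beta> in auto)
      also have "\<dots> \<le> ennreal c * (\<integral>\<^sup>+t. a t x * ennreal (K powr ((p - 2) / 2) * t powr (\<beta> - e)) \<partial>unit_interval)"
      proof (intro mult_left_mono nn_integral_mono)
        fix t assume "t \<in> space unit_interval"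
        then have t: "t \<in> {0<..<1}" by (simp add: space_restrict_space)
        define b where "b = enn2real (g t x)"
        have b0: "b \<ge> 0" by (simp add: b_def)
        have aK: "a t x \<le> ennreal (t powr (- N) * K)" by (rule a_le[OF t])
        then obtain A where A: "a t x = ennreal A" "A \<ge> 0"
          by (metis ennreal_cases ennreal_less_top leD)
        have bA: "b\<^sup>2 \<le> A"
          using g_a[of t x] A b0 g_fin[OF t, of x] unfolding b_def[symmetric] by (simp add: ennreal_power)
        have AK: "A \<le> t powr (- N) * K" using aK A K0 by (simp add: ennreal_le_iff)
        have "b powr p \<le> A * (K powr ((p - 2) / 2) * t powr (- e))"
        proof (cases "b = 0")
          case False
          with b0 have b: "b > 0" by simp
          have "b powr p = b\<^sup>2 * (b\<^sup>2) powr ((p - 2) / 2)"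
          proof -
            have "b\<^sup>2 = b powr 2" using b by simp
            then have "b\<^sup>2 * (b\<^sup>2) powr ((p - 2) / 2) = b powr (2 + 2 * ((p - 2) / 2))"
              by (simp only: powr_powr powr_add)
            also have "2 + 2 * ((p - 2) / 2) = p" by (simp add: field_simps)
            finally show ?thesis by simp
          qed
          also have "\<dots> \<le> A * (t powr (- N) * K) powr ((p - 2) / 2)"
            using p by (intro mult_mono bA powr_mono2 order_trans[OF bA AK] A) auto
          also have "\<dots> = A * (K powr ((p - 2) / 2) * t powr (- e))"
            using t K0 by (simp add: powr_mult powr_powr e_def mult.commute)
          finally show ?thesis .
        qed (use A in simp)
        then have "t powr \<beta> * b powr p \<le> t powr \<beta> * (A * (K powr ((p - 2) / 2) * t powr (- e)))"
          by (intro mult_left_mono) auto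
        also have "\<dots> = A * (K powr ((p - 2) / 2) * t powr (\<beta> - e))"
        proof -
          have "t powr (\<beta> - e) = t powr \<beta> * t powr (- e)" by (simp flip: powr_add)
          then show ?thesis by (simp only: mult.left_commute)
        qed
        finally show "ennreal (t powr \<beta> * enn2real (g t x) powr p) \<le> a t x * ennreal (K powr ((p - 2) / 2) * t powr (\<beta> - e))"
          using A by (simp add: b_def ennreal_mult[symmetric] ennreal_leI)
      qed simp
      finally show ?thesis .
    qed

    have am: "(\<lambda>w. a (snd w) (fst w)) \<in> borel_measurable (lborel \<Otimes>\<^sub>M unit_interval)"
    proof -
      have idL: "(\<lambda>x. x) \<in> (lborel :: (real ^ 'n) measure) \<rightarrow>\<^sub>M borel" by simp
      have [measurable]: "(\<lambda>w. fst (fst w)) \<in> borel_measurable ((((lborel :: (real ^ 'n) measure) \<Otimes>\<^sub>M unit_interval) \<Otimes>\<^sub>M (unit_cube :: (real ^ 'n) measure)))"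
        by (rule measurable_compose[OF measurable_compose[OF measurable_fst measurable_fst] idL])
      have [measurable]: "(\<lambda>w. snd (fst w)) \<in> borel_measurable ((((lborel :: (real ^ 'n) measure) \<Otimes>\<^sub>M unit_interval) \<Otimes>\<^sub>M (unit_cube :: (real ^ 'n) measure)))"
        by (rule measurable_compose[OF measurable_compose[OF measurable_fst measurable_snd] idT])
      have [measurable]: "(\<lambda>w. snd w) \<in> borel_measurable ((((lborel :: (real ^ 'n) measure) \<Otimes>\<^sub>M unit_interval) \<Otimes>\<^sub>M (unit_cube :: (real ^ 'n) measure)))"
        by (rule measurable_compose[OF measurable_snd idU])
      have "(\<lambda>w. ennreal ((F (fst (fst w) + snd (fst w) *\<^sub>R snd w))\<^sup>2)) \<in> borel_measurable ((lborel \<Otimes>\<^sub>M unit_interval) \<Otimes>\<^sub>M unit_cube)"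
        by measurable
      then show ?thesis
        unfolding a_def by (intro U.borel_measurable_nn_integral) (simp add: case_prod_beta')
    qed
    have ax: "(\<integral>\<^sup>+x. a t x \<partial>lborel) = ennreal K" for t
    proof -
      have [measurable]: "(\<lambda>w. snd w) \<in> borel_measurable ((lborel :: (real ^ 'n) measure) \<Otimes>\<^sub>M (unit_cube :: (real ^ 'n) measure))"
        by (rule measurable_compose[OF measurable_snd idU])
      have "(\<lambda>w. ennreal ((F (fst w + t *\<^sub>R snd w))\<^sup>2)) \<in> borel_measurable (lborel \<Otimes>\<^sub>M unit_cube)"
        by measurable
      then have "(\<integral>\<^sup>+x. a t x \<partial>lborel) = (\<integral>\<^sup>+z. (\<integral>\<^sup>+x. ennreal ((F (x + t *\<^sub>R z))\<^sup>2) \<partial>lborel) \<partial>unit_cube)"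
        unfolding a_def by (intro LU.Fubini'[symmetric]) (simp add: case_prod_beta')
      also have "\<dots> = (\<integral>\<^sup>+z. ennreal K \<partial>(unit_cube :: (real ^ 'n) measure))"
      proof (rule nn_integral_cong)
        fix z show "(\<integral>\<^sup>+x. ennreal ((F (x + t *\<^sub>R z))\<^sup>2) \<partial>lborel) = ennreal K"
          by (subst nn_integral_translation[of "\<lambda>x. ennreal ((F x)\<^sup>2)"]) (auto simp: K)
      qed
      also have "\<dots> = ennreal K" by (rule nn_integral_const_unit_cube)
      finally show ?thesis .
    qed
    define P where "P = (LINT x|lborel. \<bar>v x\<bar> powr p)"
    have P0: "0 \<le> P" unfolding P_def by simp
    have wm: "(\<lambda>t. ennreal (K powr ((p - 2) / 2) * t powr (\<beta> - e))) \<in> borel_measurable unit_interval"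
      by (rule measurable_compose[OF idT]) measurable
    have wm2: "(\<lambda>w. a (snd w) (fst w) * ennreal (K powr ((p - 2) / 2) * snd w powr (\<beta> - e))) \<in> borel_measurable (lborel \<Otimes>\<^sub>M unit_interval)"
      by (intro borel_measurable_times_ennreal am measurable_compose[OF measurable_snd wm])
    have "ennreal P = (\<integral>\<^sup>+x. ennreal (\<bar>v x\<bar> powr p) \<partial>lborel)" unfolding P_def
      by (intro nn_integral_eq_LINT_compact_support[symmetric, where \<rho> = \<rho>] continuous_on_powr' continuous_intros cv) (use p \<rho> in auto)
    also have "\<dots> \<le> (\<integral>\<^sup>+x. ennreal c * (\<integral>\<^sup>+t. a t x * ennreal (K powr ((p - 2) / 2) * t powr (\<beta> - e)) \<partial>unit_interval) \<partial>lborel)"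
      by (intro nn_integral_mono v_a)
    also have "\<dots> = ennreal c * (\<integral>\<^sup>+x. (\<integral>\<^sup>+t. a t x * ennreal (K powr ((p - 2) / 2) * t powr (\<beta> - e)) \<partial>unit_interval) \<partial>lborel)"
      by (intro nn_integral_cmult T.borel_measurable_nn_integral) (use wm2 in \<open>simp add: case_prod_beta'\<close>)
    also have "(\<integral>\<^sup>+x. (\<integral>\<^sup>+t. a t x * ennreal (K powr ((p - 2) / 2) * t powr (\<beta> - e)) \<partial>unit_interval) \<partial>lborel)
        = (\<integral>\<^sup>+t. (\<integral>\<^sup>+x. a t x * ennreal (K powr ((p - 2) / 2) * t powr (\<beta> - e)) \<partial>lborel) \<partial>unit_interval)"
      by (intro LT.Fubini'[symmetric]) (use wm2 in \<open>simp add: case_prod_beta'\<close>)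
    also have "\<dots> = (\<integral>\<^sup>+t. ennreal (K * K powr ((p - 2) / 2)) * ennreal (t powr (\<beta> - e)) \<partial>unit_interval)"
    proof (rule nn_integral_cong)
      fix t assume t: "t \<in> space unit_interval"
      have "(\<lambda>x. a t x) \<in> borel_measurable lborel"
        using measurable_compose[OF measurable_Pair2'[OF t] am] by simp
      then have "(\<integral>\<^sup>+x. a t x * ennreal (K powr ((p - 2) / 2) * t powr (\<beta> - e)) \<partial>lborel)
          = ennreal K * ennreal (K powr ((p - 2) / 2) * t powr (\<beta> - e))"
        by (simp add: nn_integral_multc ax)
      then show "(\<integral>\<^sup>+x. a t x * ennreal (K powr ((p - 2) / 2) * t powr (\<beta> - e)) \<partial>lborel)
          = ennreal (K * K powr ((p - 2) / 2)) * ennreal (t powr (\<beta> - e))"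
        using K0 by (simp add: ennreal_mult mult.assoc)
    qed
    also have "\<dots> = ennreal (K * K powr ((p - 2) / 2)) * ennreal (1 / (\<beta> - e + 1))"
      by (subst nn_integral_cmult)
         (use \<beta> in \<open>auto simp: nn_integral_powr_unit_interval intro: measurable_compose[OF idT]\<close>)
    also have "ennreal c * (ennreal (K * K powr ((p - 2) / 2)) * ennreal (1 / (\<beta> - e + 1))) = ennreal (c' * K powr (p / 2))"
    proof -
      have "K * K powr ((p - 2) / 2) = K powr (p / 2)"
        using K0 p by (cases "K = 0") (auto simp: diff_divide_distrib powr_diff)
      then show ?thesis using c \<beta> K0 by (simp add: ennreal_mult[symmetric] c'_def)
    qed
    finally have PK: "P \<le> c' * K powr (p / 2)" using c' by (simp add: ennreal_le_iff)
    have "P powr (2 / p) \<le> (c' * K powr (p / 2)) powr (2 / p)"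
      using p P0 PK by (intro powr_mono2) auto
    also have "\<dots> = c' powr (2 / p) * K" using c' K0 p by (simp add: powr_mult powr_powr)
    also have "\<dots> \<le> c' powr (2 / p) * (2 * N\<^sup>2 * Q)" using KQ by (intro mult_left_mono) auto
    finally show "(LINT x|lborel. \<bar>v x\<bar> powr p) powr (2 / p)
        \<le> c' powr (2 / p) * (2 * N\<^sup>2) * (LINT x|lborel. (norm (grad v x))\<^sup>2 + (v x)\<^sup>2)"
      by (simp add: P_def Q_def mult.assoc)
  qed
qed

section \<open>The optimal Sobolev constant and scaling\<close>

definition energy :: "(real ^ 'n \<Rightarrow> real) \<Rightarrow> real"
  where "energy v = (LINT x|lborel. (norm (grad v x))\<^sup>2 + (v x)\<^sup>2)"

lemma Cc_smooth_integrable_power: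
  assumes v: "Cc_smooth v"
  shows "integrable lborel (\<lambda>x. (norm (grad v x))\<^sup>2)" "integrable lborel (\<lambda>x. (v x)\<^sup>2)"
    "p > 0 \<Longrightarrow> integrable lborel (\<lambda>x. \<bar>v x\<bar> powr p)"
proof -
  obtain \<rho> where \<rho>: "\<And>x. v x \<noteq> 0 \<Longrightarrow> norm x \<le> \<rho>" using Cc_smooth_support[OF v] by metis
  have g\<rho>: "norm x \<le> \<rho>" if "grad v x \<noteq> 0" for x
    using grad_support[of v "cball 0 \<rho>" x] \<rho> that by auto
  have cv: "continuous_on UNIV v" and cg: "continuous_on UNIV (grad v)"
    using v by (auto intro: Cc_smooth_continuous continuous_grad)
  show "integrable lborel (\<lambda>x. (norm (grad v x))\<^sup>2)" "integrable lborel (\<lambda>x. (v x)\<^sup>2)"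
    by (intro continuous_compact_support_integrable[where \<rho> = \<rho>] continuous_intros cv cg; use \<rho> g\<rho> in auto)+
  show "integrable lborel (\<lambda>x. \<bar>v x\<bar> powr p)" if "p > 0"
    by (intro continuous_compact_support_integrable[where \<rho> = \<rho>] continuous_on_powr' continuous_intros cv)
       (use \<rho> that in auto)
qed

lemma Cc_smooth_Lp_pos:
  fixes v :: "real ^ 'n \<Rightarrow> real"
  assumes v: "Cc_smooth v" "v a \<noteq> 0" and p: "p > 0"
  shows "(LINT x|lborel. \<bar>v x\<bar> powr p) > 0"
proof (rule ccontr)
  assume "\<not> ?thesis"
  then have "(LINT x|lborel. \<bar>v x\<bar> powr p) = 0"
    using integral_nonneg_AE[of "\<lambda>x. \<bar>v x\<bar> powr p" lborel] by fastforce
  then have ae: "AE x in lborel. v x = 0"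
    using integral_nonneg_eq_0_iff_AE[OF Cc_smooth_integrable_power(3)[OF v(1) p]] by simp
  have "open {x. v x \<noteq> 0}"
    using open_Collect_neq[OF Cc_smooth_continuous[OF v(1)] continuous_on_const[of UNIV 0]] by simp
  moreover have "{x. v x \<noteq> 0} \<in> null_sets lborel"
    using ae \<open>open {x. v x \<noteq> 0}\<close> by (auto simp: AE_iff_null_sets)
  ultimately have "{x. v x \<noteq> 0} = {}"
    using open_not_negligible negligible_iff_null_sets null_sets_completionI by blast
  then show False using v by auto
qed

text \<open>The proof compares infima only, so near minimizers take the place of extremal functions.\<close>

lemma optimal_Sobolev_constant:
  assumes p: "2 < p" "ereal p < critical_exponent CARD('n::finite)"
  obtains S where "S > 0"
    "\<And>v :: real ^ 'n \<Rightarrow> real. Cc_smooth v \<Longrightarrow> S * (LINT x|lborel. \<bar>v x\<bar> powr p) powr (2 / p) \<le> energy v"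
    "\<And>\<kappa>. \<kappa> > 1 \<Longrightarrow> \<exists>v :: real ^ 'n \<Rightarrow> real. Cc_smooth v \<and> (\<exists>x. v x \<noteq> 0) \<and>
        energy v < \<kappa> * S * (LINT x|lborel. \<bar>v x\<bar> powr p) powr (2 / p)"
proof -
  define L where "L v = (LINT x|lborel. \<bar>v x\<bar> powr p) powr (2 / p)" for v :: "real ^ 'n \<Rightarrow> real"
  define V where "V = {v :: real ^ 'n \<Rightarrow> real. Cc_smooth v \<and> (\<exists>x. v x \<noteq> 0)}"
  define S where "S = (INF v\<in>V. energy v / L v)"
  obtain C where C: "C > 0" "\<And>v. Cc_smooth v \<Longrightarrow> L v \<le> C * energy v"
    unfolding L_def energy_def by (rule Sobolev_subcritical[OF p]) blast
  have L: "L v > 0" if v: "v \<in> V" for v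
  proof -
    obtain x where "Cc_smooth v" "v x \<noteq> 0" using v by (auto simp: V_def)
    then have "(LINT x|lborel. \<bar>v x\<bar> powr p) > 0" using Cc_smooth_Lp_pos[of v x p] p by simp
    then show ?thesis by (simp add: L_def)
  qed
  have lb: "1 / C \<le> energy v / L v" if "v \<in> V" for v
    using C(1) C(2)[of v] L[OF that] that by (simp add: V_def field_simps)
  have "box_bump 0 0 1 \<in> V"
  proof -
    have "((1/2) *\<^sub>R (1 :: real ^ 'n)) \<in> box 0 1" by (simp add: mem_box_cart)
    then have "box_bump 0 0 1 ((1/2) *\<^sub>R (1 :: real ^ 'n)) \<noteq> 0" using box_bump_nonzero_iff by blast
    then show ?thesis unfolding V_def using Cc_smooth_box_bump by blast
  qed
  then have ne: "V \<noteq> {}" by blast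
  have bdd: "bdd_below ((\<lambda>v. energy v / L v) ` V)" using lb by (intro bdd_belowI2)
  have "1 / C \<le> S" unfolding S_def by (rule cINF_greatest[OF ne lb])
  then have S: "S > 0" using C(1) by (smt (verit) divide_pos_pos)
  show ?thesis
  proof
    show "S > 0" by (rule S)
    fix v :: "real ^ 'n \<Rightarrow> real" assume v: "Cc_smooth v"
    show "S * (LINT x|lborel. \<bar>v x\<bar> powr p) powr (2 / p) \<le> energy v"
    proof (cases "v \<in> V")
      case True
      have "S \<le> energy v / L v" unfolding S_def by (rule cINF_lower[OF bdd True])
      then show ?thesis using L[OF True] by (simp add: L_def field_simps)
    next
      case False
      then have "v x = 0" for x using v by (auto simp: V_def)
      then have "L v = 0" by (simp add: L_def)
      then show ?thesis by (simp add: L_def energy_def)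
    qed
  next
    fix \<kappa> :: real assume "\<kappa> > 1"
    then have "S < \<kappa> * S" using S by simp
    then obtain v where v: "v \<in> V" "energy v / L v < \<kappa> * S"
      unfolding S_def using cINF_less_iff[OF ne bdd] by auto
    then have "energy v < \<kappa> * S * L v" using L[OF v(1)] by (simp add: field_simps)
    then show "\<exists>v :: real ^ 'n \<Rightarrow> real. Cc_smooth v \<and> (\<exists>x. v x \<noteq> 0) \<and>
        energy v < \<kappa> * S * (LINT x|lborel. \<bar>v x\<bar> powr p) powr (2 / p)"
      using v(1) by (auto simp: V_def L_def)
  qed
qed

definition diagonal_map :: "('n \<Rightarrow> real) \<Rightarrow> real ^ 'n \<Rightarrow> real ^ 'n \<Rightarrow> real ^ 'n"
  where "diagonal_map d a x = (\<chi> k. d k * (x $ k - a $ k))"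

lemma linear_diagonal: "linear (\<lambda>x. (\<chi> k. d k * x $ k) :: real ^ 'n)"
  by (rule linearI) (auto simp: vec_eq_iff algebra_simps)

lemma diagonal_map_affine: "diagonal_map d a x = (\<chi> k. d k * x $ k) + (\<chi> k. - d k * a $ k)"
  by (simp add: diagonal_map_def vec_eq_iff algebra_simps)

lemma lborel_diagonal_map:
  fixes d :: "'n::finite \<Rightarrow> real"
  assumes d: "\<And>k. d k > 0" and [measurable]: "g \<in> borel_measurable borel"
  shows "(LINT x|lborel. g (diagonal_map d a x)) = (LINT x|lborel. g x :: real) / (\<Prod>k\<in>UNIV. d k)"
proof -
  define c where "c b = (\<Sum>k\<in>UNIV. d k * b $ k)" for b :: "real ^ 'n"
  have cax: "c (axis k 1) = d k" for k
    by (simp add: c_def axis_def if_distrib cong: if_cong)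
  have B: "Basis = range (\<lambda>k. axis k (1::real) :: real ^ 'n)"
    by (auto simp: Basis_vec_def)
  have inj: "inj (\<lambda>k. axis k (1::real) :: real ^ 'n)"
    by (auto simp: inj_def axis_eq_axis)
  define t where "t = (\<chi> k. - d k * a $ k)"
  have T: "t + (\<Sum>j\<in>Basis. (c j * (x \<bullet> j)) *\<^sub>R j) = diagonal_map d a x" for x
  proof -
    have "(\<Sum>j\<in>Basis. (c j * (x \<bullet> j)) *\<^sub>R j) = (\<Sum>k\<in>UNIV. (d k * x $ k) *\<^sub>R axis k 1)"
      unfolding B by (subst sum.reindex[OF inj]) (simp add: cax inner_axis)
    also have "\<dots> = (\<chi> k. d k * x $ k)"
      using basis_expansion[of "\<chi> k. d k * x $ k"] by (simp add: scalar_mult_eq_scaleR)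
    finally show ?thesis by (simp add: diagonal_map_affine t_def)
  qed
  have pr: "(\<Prod>j\<in>Basis. \<bar>c j\<bar>) = (\<Prod>k\<in>UNIV. d k)"
    unfolding B by (subst prod.reindex[OF inj]) (simp add: cax d less_imp_le)
  have cn: "c j \<noteq> 0" if "j \<in> Basis" for j
    using that d unfolding B by (auto simp: cax less_imp_neq[THEN not_sym])
  have Tm[measurable]: "diagonal_map d a \<in> borel_measurable borel"
    unfolding T[symmetric, abs_def] by measurable
  have P: "(\<Prod>k\<in>UNIV. d k) > 0" by (intro prod_pos) (simp add: d)
  have "(LINT x|lborel. g x) = (LINT x|density (distr lborel borel (diagonal_map d a)) (\<lambda>_. ennreal (\<Prod>k\<in>UNIV. d k)). g x)"
    using lborel_affine_euclidean[of c t] cn unfolding T pr by simp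
  also have "\<dots> = (LINT x|distr lborel borel (diagonal_map d a). (\<Prod>k\<in>UNIV. d k) * g x)"
    using P by (subst integral_density) auto
  also have "\<dots> = (\<Prod>k\<in>UNIV. d k) * (LINT x|lborel. g (diagonal_map d a x))"
    by (subst integral_distr) auto
  finally show ?thesis using P by (metis nonzero_mult_div_cancel_left less_irrefl)
qed

lemma partial_deriv_diagonal_map:
  assumes "Cc_smooth v"
  shows "partial_deriv k (\<lambda>x. v (diagonal_map d a x)) x = d k * partial_deriv k v (diagonal_map d a x)"
proof -
  have "partial_deriv k (\<lambda>x. v (diagonal_map d a x)) x
      = (\<Sum>l\<in>UNIV. (\<chi> i. d i * axis k 1 $ i) $ l * partial_deriv l v (diagonal_map d a x))"
    unfolding diagonal_map_affine
    by (rule partial_deriv_affine[OF linear_diagonal Cc_smooth_differentiable[OF assms]])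
  also have "\<dots> = (\<Sum>l\<in>UNIV. if l = k then d l * partial_deriv l v (diagonal_map d a x) else 0)"
    by (intro sum.cong) (auto simp: axis_def)
  finally show ?thesis by simp
qed

lemma C_k_diagonal_map: "C_k r v \<Longrightarrow> C_k r (\<lambda>x. v (diagonal_map d a x))"
  unfolding diagonal_map_affine by (rule C_k_affine[OF linear_diagonal])

lemma diagonal_map_norm_ge:
  assumes "\<And>k. c \<le> d k" "0 \<le> c"
  shows "c * norm (x - a) \<le> norm (diagonal_map d a x)"
proof -
  have "norm (c *\<^sub>R (x - a)) \<le> norm (diagonal_map d a x)"
    by (rule norm_le_componentwise_cart)
       (use assms order_trans[OF assms(2,1)] in \<open>auto simp: diagonal_map_def abs_mult intro!: mult_right_mono\<close>)
  then show ?thesis using assms(2) by simp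
qed

lemma norm_vec_power2: "(norm (y :: real ^ 'n))\<^sup>2 = (\<Sum>k\<in>UNIV. (y $ k)\<^sup>2)"
  by (simp only: power2_norm_eq_inner inner_vec_def) (simp add: power2_eq_square)

lemma two_components_le_norm:
  fixes y :: "real ^ 'n"
  assumes "i \<noteq> j"
  shows "(y $ i)\<^sup>2 + (y $ j)\<^sup>2 \<le> (norm y)\<^sup>2"
proof -
  have "(y $ i)\<^sup>2 + (y $ j)\<^sup>2 = (\<Sum>k\<in>{i, j}. (y $ k)\<^sup>2)" using assms by simp
  also have "\<dots> \<le> (norm y)\<^sup>2" unfolding norm_vec_power2 by (intro sum_mono2) auto
  finally show ?thesis .
qed

lemma norm_grad_power2: "(norm (grad v x))\<^sup>2 = (\<Sum>k\<in>UNIV. (partial_deriv k v x)\<^sup>2)"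
  by (simp add: norm_vec_power2 grad_def)

text \<open>The Sobolev inequality for \<open>x \<mapsto> v (x / \<surd>m)\<close>.\<close>

lemma Sobolev_scaled:
  fixes v :: "real ^ 'n \<Rightarrow> real"
  assumes S: "\<And>v :: real ^ 'n \<Rightarrow> real. Cc_smooth v \<Longrightarrow> S * (LINT x|lborel. \<bar>v x\<bar> powr p) powr (2 / p) \<le> energy v"
    and m: "m > 0" and v: "Cc_smooth v"
  shows "S * (m * (sqrt m ^ CARD('n)) powr (2 / p - 1)) * (LINT x|lborel. \<bar>v x\<bar> powr p) powr (2 / p)
    \<le> (LINT x|lborel. (norm (grad v x))\<^sup>2 + m * (v x)\<^sup>2)"
proof -
  define M where "M = sqrt m ^ CARD('n)"
  define T where "T = diagonal_map (\<lambda>_. 1 / sqrt m) (0 :: real ^ 'n)"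
  have M: "M > 0" using m by (simp add: M_def)
  have vm[measurable]: "v \<in> borel_measurable borel" using v by (rule Cc_smooth_borel)
  have gm[measurable]: "(\<lambda>x. (norm (grad v x))\<^sup>2) \<in> borel_measurable borel"
    using Cc_smooth_integrable_power(1)[OF v] by auto
  have change: "(LINT x|lborel. g (T x)) = M * (LINT x|lborel. g x)" if "g \<in> borel_measurable borel" for g :: "real ^ 'n \<Rightarrow> real"
    unfolding T_def using m that by (subst lborel_diagonal_map) (auto simp: M_def power_one_over)
  have w: "Cc_smooth (\<lambda>x. v (T x))"
  proof -
    obtain \<rho> where \<rho>: "\<And>x. v x \<noteq> 0 \<Longrightarrow> norm x \<le> \<rho>" using Cc_smooth_support[OF v] by metis
    have "norm x \<le> \<rho> * sqrt m" if "v (T x) \<noteq> 0" for x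
    proof -
      have "1 / sqrt m * norm x \<le> norm (T x)"
        using diagonal_map_norm_ge[of "1 / sqrt m" "\<lambda>_. 1 / sqrt m" x 0] m by (simp add: T_def)
      also have "\<dots> \<le> \<rho>" by (rule \<rho>[OF that])
      finally show ?thesis using m by (simp add: pos_divide_le_eq)
    qed
    moreover have "C_k r (\<lambda>x. v (T x))" for r
      unfolding T_def using Cc_smooth_C_k[OF v] by (rule C_k_diagonal_map)
    ultimately show ?thesis unfolding Cc_smooth_def by blast
  qed
  have "energy (\<lambda>x. v (T x)) = (LINT x|lborel. (norm (grad v (T x)))\<^sup>2 / m + (v (T x))\<^sup>2)"
    unfolding energy_def norm_grad_power2 T_def partial_deriv_diagonal_map[OF v]
    using m by (simp add: power_mult_distrib power_divide flip: sum_divide_distrib)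
  also have "\<dots> = M * (LINT x|lborel. (norm (grad v x))\<^sup>2 / m + (v x)\<^sup>2)"
    by (rule change) measurable
  also have "\<dots> = M / m * (LINT x|lborel. (norm (grad v x))\<^sup>2 + m * (v x)\<^sup>2)"
  proof -
    have "(LINT x|lborel. (norm (grad v x))\<^sup>2 / m + (v x)\<^sup>2) = (LINT x|lborel. ((norm (grad v x))\<^sup>2 + m * (v x)\<^sup>2) / m)"
      using m by (simp add: add_divide_distrib)
    then show ?thesis by simp
  qed
  finally have E: "energy (\<lambda>x. v (T x)) = M / m * (LINT x|lborel. (norm (grad v x))\<^sup>2 + m * (v x)\<^sup>2)" .
  have Lp: "(LINT x|lborel. \<bar>v (T x)\<bar> powr p) = M * (LINT x|lborel. \<bar>v x\<bar> powr p)"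
    by (rule change) measurable
  have P0: "0 \<le> (LINT x|lborel. \<bar>v x\<bar> powr p)" by simp
  have "S * (M powr (2 / p) * (LINT x|lborel. \<bar>v x\<bar> powr p) powr (2 / p)) \<le> M / m * (LINT x|lborel. (norm (grad v x))\<^sup>2 + m * (v x)\<^sup>2)"
    using S[OF w] M P0 unfolding E Lp by (simp add: powr_mult)
  then have "(m / M) * (S * (M powr (2 / p) * (LINT x|lborel. \<bar>v x\<bar> powr p) powr (2 / p)))
      \<le> (m / M) * (M / m * (LINT x|lborel. (norm (grad v x))\<^sup>2 + m * (v x)\<^sup>2))"
    using m M by (intro mult_left_mono) auto
  also have "(m / M) * (M / m * (LINT x|lborel. (norm (grad v x))\<^sup>2 + m * (v x)\<^sup>2)) = (LINT x|lborel. (norm (grad v x))\<^sup>2 + m * (v x)\<^sup>2)"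
    using m M by simp
  also have "(m / M) * (S * (M powr (2 / p) * (LINT x|lborel. \<bar>v x\<bar> powr p) powr (2 / p)))
      = S * (m * M powr (2 / p - 1)) * (LINT x|lborel. \<bar>v x\<bar> powr p) powr (2 / p)"
    using M by (simp add: powr_diff)
  finally show ?thesis unfolding M_def .
qed

section \<open>Passage from test functions to Sobolev functions\<close>

lemma integrable_norm_weak_gradient:
  assumes "\<And>k. L2_ball (\<lambda>x. G x $ k)"
  shows "integrable ball_measure (\<lambda>x. (norm (G x))\<^sup>2)"
  unfolding norm_vec_power2 using assms by (intro Bochner_Integration.integrable_sum) (simp add: L2_ball_def)

lemma L2_ball_power2: "L2_ball u \<Longrightarrow> integrable ball_measure (\<lambda>x. (u x)\<^sup>2)"
  by (simp add: L2_ball_def)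

lemma L2_ball_ang:
  fixes i j :: "'n::finite"
  assumes "\<And>k. L2_ball (\<lambda>x. G x $ k)"
  shows "L2_ball (\<lambda>x. x $ i * G x $ j - x $ j * G x $ i)"
proof -
  have "\<bar>x $ k\<bar> \<le> 1" if "x \<in> ball 0 1" for x :: "real ^ 'n" and k
    using component_le_norm_cart[of x k] that by simp
  moreover have "(\<lambda>x. x $ k) \<in> borel_measurable ball_measure" for k :: 'n
    by (intro ball_measure_borel) simp
  ultimately show ?thesis
    by (intro L2_ball_diff L2_ball_mult_bounded[OF assms])
qed

lemma integrable_rayleigh_integrand:
  fixes u :: "real ^ 'n \<Rightarrow> real"
  assumes "L2_ball u" "has_weak_gradient u G"
  shows "integrable ball_measure
    (\<lambda>x. (norm (G x))\<^sup>2 - \<alpha>\<^sup>2 * (x $ i * G x $ j - x $ j * G x $ i)\<^sup>2 + m * (u x)\<^sup>2)"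
  using assms by (intro Bochner_Integration.integrable_add Bochner_Integration.integrable_diff integrable_mult_right
      integrable_norm_weak_gradient L2_ball_power2 L2_ball_ang) (auto dest: has_weak_gradient_L2)

lemma rayleigh_eq:
  fixes u :: "real ^ 'n \<Rightarrow> real"
  assumes u: "L2_ball u" and G: "has_weak_gradient u G"
  shows "rayleigh i j \<alpha> m p u =
    (LINT x|ball_measure. (norm (G x))\<^sup>2 - \<alpha>\<^sup>2 * (x $ i * G x $ j - x $ j * G x $ i)\<^sup>2 + m * (u x)\<^sup>2) /
    (LINT x|ball_measure. \<bar>u x\<bar> powr p) powr (2 / p)"
proof -
  note i = integrable_rayleigh_integrand[OF u]
  have w: "has_weak_gradient u (weak_grad u)" using weak_grad_works u G unfolding H1_ball_def by blast
  have "(LINT x|ball_measure. (norm (weak_grad u x))\<^sup>2 - \<alpha>\<^sup>2 * (x $ i * weak_grad u x $ j - x $ j * weak_grad u x $ i)\<^sup>2 + m * (u x)\<^sup>2)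
      = (LINT x|ball_measure. (norm (G x))\<^sup>2 - \<alpha>\<^sup>2 * (x $ i * G x $ j - x $ j * G x $ i)\<^sup>2 + m * (u x)\<^sup>2)"
    by (rule integral_cong_AE[OF borel_measurable_integrable[OF i[OF w]] borel_measurable_integrable[OF i[OF G]]])
       (use weak_grad_eq[OF G] in \<open>eventually_elim, simp\<close>)
  then show ?thesis by (simp add: rayleigh_def ang_deriv_def)
qed

lemma test_function_grad_support: "test_function \<phi> \<Longrightarrow> grad \<phi> x \<noteq> 0 \<Longrightarrow> x \<in> ball 0 1"
proof -
  assume \<phi>: "test_function \<phi>" and g: "grad \<phi> x \<noteq> 0"
  obtain K where K: "compact K" "K \<subseteq> ball 0 1" "\<And>x. \<phi> x \<noteq> 0 \<Longrightarrow> x \<in> K"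
    using \<phi> unfolding test_function_def by blast
  show ?thesis using grad_support[OF K(3) compact_imp_closed[OF K(1)] g] K(2) by auto
qed

lemma test_function_Lp_ball:
  assumes \<phi>: "test_function \<phi>" and p: "p > 0"
  shows "(LINT x|ball_measure. \<bar>\<phi> x\<bar> powr p) = (LINT x|lborel. \<bar>\<phi> x\<bar> powr p)"
    and "integrable ball_measure (\<lambda>x. \<bar>\<phi> x\<bar> powr p)"
proof -
  have [measurable]: "\<phi> \<in> borel_measurable borel" using \<phi> by (intro Cc_smooth_borel test_function_Cc_smooth)
  have s: "x \<in> ball 0 1" if "\<bar>\<phi> x\<bar> powr p \<noteq> 0" for x
    using that test_function_support[OF \<phi>, of x] by auto
  show "(LINT x|ball_measure. \<bar>\<phi> x\<bar> powr p) = (LINT x|lborel. \<bar>\<phi> x\<bar> powr p)"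
    by (rule LINT_ball_eq_lborel[OF _ s]) measurable
  have "integrable lborel (\<lambda>x. \<bar>\<phi> x\<bar> powr p)"
    by (rule Cc_smooth_integrable_power(3)[OF test_function_Cc_smooth[OF \<phi>] p])
  then show "integrable ball_measure (\<lambda>x. \<bar>\<phi> x\<bar> powr p)"
    by (subst integrable_ball_iff_lborel[OF _ s]) auto
qed

text \<open>A triangle inequality for squares whose leading constant is as close to \<open>1\<close> as desired.\<close>

lemma norm_diff_power2_weighted:
  fixes x y :: "'a :: real_inner"
  assumes \<delta>: "\<delta> > 0"
  shows "(norm y)\<^sup>2 \<le> (1 + \<delta>) * (norm x)\<^sup>2 + (1 + 1 / \<delta>) * (norm (x - y))\<^sup>2"
proof -
  define a b where "a = norm x" and "b = norm (x - y)"
  have "norm y \<le> a + b" unfolding a_def b_def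
    using norm_triangle_ineq4[of x "x - y"] by simp
  then have "(norm y)\<^sup>2 \<le> (a + b)\<^sup>2" by (intro power_mono) auto
  also have "\<dots> \<le> (1 + \<delta>) * a\<^sup>2 + (1 + 1 / \<delta>) * b\<^sup>2"
  proof -
    have "0 \<le> (\<delta> * a - b)\<^sup>2 / \<delta>" using \<delta> by simp
    also have "(\<delta> * a - b)\<^sup>2 / \<delta> = \<delta> * a\<^sup>2 - 2 * a * b + b\<^sup>2 / \<delta>"
      using \<delta> by (simp add: power2_eq_square field_simps)
    finally show ?thesis by (simp add: power2_sum algebra_simps)
  qed
  finally show ?thesis by (simp add: a_def b_def)
qed

text \<open>For test functions this is the scaled Sobolev inequality. A function \<open>u\<close> of \<open>H\<^sub>0\<^sup>1\<close> is the limit of test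
  functions whose energies converge to that of \<open>u\<close>; along a subsequence they converge almost everywhere,
  and Fatou's lemma carries the bound on the \<open>L\<^sup>p\<close> norms over to \<open>u\<close>. In particular the denominator of the
  Rayleigh quotient is finite and positive, so the quotient has its intended meaning.\<close>

lemma rayleigh_lower_bound:
  fixes u :: "real ^ 'n \<Rightarrow> real"
  assumes S0: "S > 0"
    and S: "\<And>v :: real ^ 'n \<Rightarrow> real. Cc_smooth v \<Longrightarrow> S * (LINT x|lborel. \<bar>v x\<bar> powr p) powr (2 / p) \<le> energy v"
    and p: "p > 2" and m: "m \<ge> 1" and u: "u \<in> H10_nonzero"
  shows "S * (m * (sqrt m ^ CARD('n)) powr (2 / p - 1)) \<le> rayleigh i j 0 m p u"
proof -
  define \<Lambda> where "\<Lambda> = S * (m * (sqrt m ^ CARD('n)) powr (2 / p - 1))"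
  have \<Lambda>: "\<Lambda> > 0" using S0 m by (simp add: \<Lambda>_def)
  have uH: "H10_ball u" and un: "\<not> (AE x in ball_measure. u x = 0)"
    using u by (auto simp: H10_nonzero_def)
  have uH1: "H1_ball u" using uH by (simp add: H10_ball_def)
  have uL2: "L2_ball u" using uH1 by (simp add: H1_ball_def)
  define W where "W = weak_grad u"
  have uW: "has_weak_gradient u W" unfolding W_def by (rule weak_grad_works[OF uH1])
  define Q where "Q = (LINT x|ball_measure. (norm (W x))\<^sup>2 + m * (u x)\<^sup>2)"
  have Q0: "0 \<le> Q" unfolding Q_def using m by simp
  have "\<forall>n. \<exists>\<phi>. test_function \<phi> \<and> H1_norm (\<lambda>x. u x - \<phi> x) < 1 / real (Suc n)"
    using uH unfolding H10_ball_def by simp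
  then obtain \<phi> where \<phi>: "\<And>n. test_function (\<phi> n)" "\<And>n. H1_norm (\<lambda>x. u x - \<phi> n x) < 1 / real (Suc n)"
    by metis
  define E where "E n = (LINT x|ball_measure. (norm (W x - grad (\<phi> n) x))\<^sup>2 + (u x - \<phi> n x)\<^sup>2)" for n
  have \<phi>L2: "L2_ball (\<phi> n)" and hL2: "L2_ball (\<lambda>x. u x - \<phi> n x)" for n
    using \<phi>(1) uL2 by (auto intro: test_function_L2 L2_ball_diff)
  have hg: "has_weak_gradient (\<lambda>x. u x - \<phi> n x) (\<lambda>x. W x - grad (\<phi> n) x)" for n
    by (intro has_weak_gradient_diff uL2 \<phi>L2 uW has_weak_gradient_grad \<phi>)
  have iW: "integrable ball_measure (\<lambda>x. (norm (W x))\<^sup>2)"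
    and ih: "integrable ball_measure (\<lambda>x. (norm (W x - grad (\<phi> n) x))\<^sup>2)"
    and ig: "integrable ball_measure (\<lambda>x. (norm (grad (\<phi> n) x))\<^sup>2)" for n
    using has_weak_gradient_L2[OF uW] has_weak_gradient_L2[OF hg] has_weak_gradient_L2[OF has_weak_gradient_grad[OF \<phi>(1)]]
    by (intro integrable_norm_weak_gradient; simp)+
  have E: "E n < (1 / real (Suc n))\<^sup>2" "0 \<le> E n" for n
  proof -
    have H: "has_weak_gradient (\<lambda>x. u x - \<phi> n x) (weak_grad (\<lambda>x. u x - \<phi> n x))"
      using hL2 hg by (intro weak_grad_works) (auto simp: H1_ball_def)
    have "(LINT x|ball_measure. (norm (weak_grad (\<lambda>x. u x - \<phi> n x) x))\<^sup>2 + (u x - \<phi> n x)\<^sup>2) = E n"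
      unfolding E_def
    proof (rule integral_cong_AE)
      show "(\<lambda>x. (norm (weak_grad (\<lambda>x. u x - \<phi> n x) x))\<^sup>2 + (u x - \<phi> n x)\<^sup>2) \<in> borel_measurable ball_measure"
        by (intro borel_measurable_integrable Bochner_Integration.integrable_add integrable_norm_weak_gradient
            has_weak_gradient_L2[OF H] L2_ball_power2 hL2)
      show "(\<lambda>x. (norm (W x - grad (\<phi> n) x))\<^sup>2 + (u x - \<phi> n x)\<^sup>2) \<in> borel_measurable ball_measure"
        by (intro borel_measurable_integrable Bochner_Integration.integrable_add ih L2_ball_power2 hL2)
      show "AE x in ball_measure. (norm (weak_grad (\<lambda>x. u x - \<phi> n x) x))\<^sup>2 + (u x - \<phi> n x)\<^sup>2
          = (norm (W x - grad (\<phi> n) x))\<^sup>2 + (u x - \<phi> n x)\<^sup>2"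
        using weak_grad_eq[OF hg[of n]] by eventually_elim simp
    qed
    then have "sqrt (E n) < 1 / real (Suc n)" using \<phi>(2)[of n] by (simp add: H1_norm_def)
    moreover show "0 \<le> E n" unfolding E_def by simp
    ultimately show "E n < (1 / real (Suc n))\<^sup>2"
      by (metis of_nat_0_le_iff real_less_lsqrt real_sqrt_less_iff real_sqrt_abs abs_of_nonneg divide_nonneg_nonneg zero_le_one)
  qed
  \<comment> \<open>The weight \<open>1/(n+1)\<close> tends to zero, while the error \<open>E n < 1/(n+1)\<^sup>2\<close> still beats its reciprocal.\<close>
  define B where "B n = ((1 + 1 / real (Suc n)) * Q + (1 + real (Suc n)) * m * (1 / real (Suc n))\<^sup>2) / \<Lambda>" for n
  have B0: "0 \<le> B n" for n using Q0 \<Lambda> m unfolding B_def by (intro divide_nonneg_pos add_nonneg_nonneg mult_nonneg_nonneg) auto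
  have Lp: "(LINT x|lborel. \<bar>\<phi> n x\<bar> powr p) \<le> B n powr (p / 2)" for n
  proof -
    let ?d = "1 / real (Suc n)"
    define P where "P = (LINT x|lborel. \<bar>\<phi> n x\<bar> powr p)"
    have P0: "0 \<le> P" unfolding P_def by simp
    have cs: "Cc_smooth (\<phi> n)" by (rule test_function_Cc_smooth[OF \<phi>(1)])
    have [measurable]: "\<phi> n \<in> borel_measurable borel" "(\<lambda>x. (norm (grad (\<phi> n) x))\<^sup>2) \<in> borel_measurable borel"
      using Cc_smooth_borel[OF cs] Cc_smooth_integrable_power(1)[OF cs] by auto
    have "\<Lambda> * P powr (2 / p) \<le> (LINT x|lborel. (norm (grad (\<phi> n) x))\<^sup>2 + m * (\<phi> n x)\<^sup>2)"
      unfolding P_def \<Lambda>_def using m by (intro Sobolev_scaled S cs) auto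
    also have "\<dots> = (LINT x|ball_measure. (norm (grad (\<phi> n) x))\<^sup>2 + m * (\<phi> n x)\<^sup>2)"
    proof (rule LINT_ball_eq_lborel[symmetric])
      show "x \<in> ball 0 1" if "(norm (grad (\<phi> n) x))\<^sup>2 + m * (\<phi> n x)\<^sup>2 \<noteq> 0" for x
      proof (cases "\<phi> n x = 0")
        case True
        then show ?thesis using that test_function_grad_support[OF \<phi>(1)[of n], of x] by auto
      qed (rule test_function_support[OF \<phi>(1)])
    qed measurable
    also have "\<dots> \<le> (LINT x|ball_measure. (1 + ?d) * ((norm (W x))\<^sup>2 + m * (u x)\<^sup>2)
        + (1 + 1 / ?d) * m * ((norm (W x - grad (\<phi> n) x))\<^sup>2 + (u x - \<phi> n x)\<^sup>2))"
    proof (rule integral_mono)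
      fix x
      have "(norm (grad (\<phi> n) x))\<^sup>2 \<le> (1 + ?d) * (norm (W x))\<^sup>2 + (1 + 1 / ?d) * (norm (W x - grad (\<phi> n) x))\<^sup>2"
        by (rule norm_diff_power2_weighted) simp
      moreover have "1 * ((1 + 1 / ?d) * (norm (W x - grad (\<phi> n) x))\<^sup>2) \<le> m * ((1 + 1 / ?d) * (norm (W x - grad (\<phi> n) x))\<^sup>2)"
        by (intro mult_right_mono m mult_nonneg_nonneg) auto
      moreover have "m * (\<phi> n x)\<^sup>2 \<le> m * ((1 + ?d) * (u x)\<^sup>2 + (1 + 1 / ?d) * (u x - \<phi> n x)\<^sup>2)"
        using norm_diff_power2_weighted[of ?d "\<phi> n x" "u x"] m by (intro mult_left_mono) auto
      ultimately show "(norm (grad (\<phi> n) x))\<^sup>2 + m * (\<phi> n x)\<^sup>2 \<le> (1 + ?d) * ((norm (W x))\<^sup>2 + m * (u x)\<^sup>2)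
        + (1 + 1 / ?d) * m * ((norm (W x - grad (\<phi> n) x))\<^sup>2 + (u x - \<phi> n x)\<^sup>2)"
        by (simp only: distrib_left mult.assoc mult.left_commute[of m])
    qed (intro Bochner_Integration.integrable_add integrable_mult_right iW ih ig L2_ball_power2 uL2 \<phi>L2 hL2)+
    also have "\<dots> = (1 + ?d) * Q + (1 + 1 / ?d) * m * E n"
      unfolding Q_def E_def
      by (subst Bochner_Integration.integral_add)
         (intro Bochner_Integration.integrable_add integrable_mult_right iW ih L2_ball_power2 uL2 hL2 | simp)+
    also have "\<dots> \<le> (1 + ?d) * Q + (1 + real (Suc n)) * m * ?d\<^sup>2"
      using m E(1)[of n] by (intro add_left_mono) (simp del: of_nat_Suc)
    finally have PB: "P powr (2 / p) \<le> B n" using \<Lambda> by (simp add: B_def pos_le_divide_eq mult.commute)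
    have "P = (P powr (2 / p)) powr (p / 2)" using p P0 by (simp add: powr_powr)
    also have "\<dots> \<le> B n powr (p / 2)" using p PB by (intro powr_mono2) auto
    finally show ?thesis by (simp add: P_def)
  qed
  have B_lim: "B \<longlonglongrightarrow> Q / \<Lambda>"
  proof -
    have "(\<lambda>n. (1 + 1 / real (Suc n)) * Q + (1 / real (Suc n) * (1 / real (Suc n)) + 1 / real (Suc n)) * m) \<longlonglongrightarrow> (1 + 0) * Q + (0 * 0 + 0) * m"
      by (intro tendsto_intros LIMSEQ_Suc[OF lim_1_over_n])
    moreover have "(1 + real (Suc n)) * m * (1 / real (Suc n))\<^sup>2 = (1 / real (Suc n) * (1 / real (Suc n)) + 1 / real (Suc n)) * m" for n
      by (simp add: power2_eq_square field_simps del: of_nat_Suc)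
    ultimately have "(\<lambda>n. (1 + 1 / real (Suc n)) * Q + (1 + real (Suc n)) * m * (1 / real (Suc n))\<^sup>2) \<longlonglongrightarrow> Q"
      by (simp only: add_0_right mult_zero_left mult_1_left add_0_left)
    then show ?thesis unfolding B_def[abs_def] using \<Lambda> by (intro tendsto_divide) auto
  qed
  have "(\<lambda>n. LINT x|ball_measure. norm ((u x - \<phi> n x)\<^sup>2)) \<longlonglongrightarrow> 0"
  proof (rule tendsto_sandwich[OF _ _ tendsto_const])
    show "\<forall>\<^sub>F n in sequentially. 0 \<le> (LINT x|ball_measure. norm ((u x - \<phi> n x)\<^sup>2))" by simp
    show "\<forall>\<^sub>F n in sequentially. (LINT x|ball_measure. norm ((u x - \<phi> n x)\<^sup>2)) \<le> 1 / real (Suc n) * (1 / real (Suc n))"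
    proof (intro always_eventually allI)
      fix n
      have "(LINT x|ball_measure. norm ((u x - \<phi> n x)\<^sup>2)) \<le> E n" unfolding E_def
        by (intro integral_mono Bochner_Integration.integrable_add ih L2_ball_power2 hL2 integrable_norm) simp
      then show "(LINT x|ball_measure. norm ((u x - \<phi> n x)\<^sup>2)) \<le> 1 / real (Suc n) * (1 / real (Suc n))"
        using E(1)[of n] unfolding power2_eq_square by linarith
    qed
    have "(\<lambda>n. 1 / real (Suc n) * (1 / real (Suc n))) \<longlonglongrightarrow> 0 * 0"
      by (intro tendsto_intros LIMSEQ_Suc[OF lim_1_over_n])
    then show "(\<lambda>n. 1 / real (Suc n) * (1 / real (Suc n))) \<longlonglongrightarrow> 0" by simp
  qed
  from tendsto_L1_AE_subseq[OF L2_ball_power2[OF hL2] this]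
  obtain r where r: "strict_mono r" "AE x in ball_measure. (\<lambda>n. (u x - \<phi> (r n) x)\<^sup>2) \<longlonglongrightarrow> 0"
    by blast
  have conv: "AE x in ball_measure. liminf (\<lambda>n. ennreal (\<bar>\<phi> (r n) x\<bar> powr p)) = ennreal (\<bar>u x\<bar> powr p)"
    using r(2)
  proof eventually_elim
    case (elim x)
    then have "(\<lambda>n. sqrt ((u x - \<phi> (r n) x)\<^sup>2)) \<longlonglongrightarrow> sqrt 0" by (rule tendsto_real_sqrt)
    then have "(\<lambda>n. u x - \<phi> (r n) x) \<longlonglongrightarrow> 0" by (simp add: tendsto_rabs_zero_iff)
    then have "(\<lambda>n. u x - (u x - \<phi> (r n) x)) \<longlonglongrightarrow> u x - 0" by (intro tendsto_intros)
    then have "(\<lambda>n. \<bar>\<phi> (r n) x\<bar>) \<longlonglongrightarrow> \<bar>u x\<bar>" by (intro tendsto_rabs) simp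
    then have "(\<lambda>n. \<bar>\<phi> (r n) x\<bar> powr p) \<longlonglongrightarrow> \<bar>u x\<bar> powr p"
      using p by (intro tendsto_powr2) auto
    then show ?case by (intro lim_imp_Liminf tendsto_ennrealI) auto
  qed
  have um: "u \<in> borel_measurable ball_measure" and \<phi>m: "\<phi> n \<in> borel_measurable ball_measure" for n
    using uL2 \<phi>L2 by (auto simp: L2_ball_def)
  have "(\<integral>\<^sup>+x. ennreal (\<bar>u x\<bar> powr p) \<partial>ball_measure) = (\<integral>\<^sup>+x. liminf (\<lambda>n. ennreal (\<bar>\<phi> (r n) x\<bar> powr p)) \<partial>ball_measure)"
    by (rule nn_integral_cong_AE) (use conv in auto)
  also have "\<dots> \<le> liminf (\<lambda>n. \<integral>\<^sup>+x. ennreal (\<bar>\<phi> (r n) x\<bar> powr p) \<partial>ball_measure)"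
    using \<phi>m by (intro nn_integral_liminf) measurable
  also have "\<dots> \<le> liminf (\<lambda>n. ennreal (B (r n) powr (p / 2)))"
  proof (intro Liminf_mono always_eventually allI)
    fix n
    have "(\<integral>\<^sup>+x. ennreal (\<bar>\<phi> (r n) x\<bar> powr p) \<partial>ball_measure) = ennreal (LINT x|ball_measure. \<bar>\<phi> (r n) x\<bar> powr p)"
      using p by (intro nn_integral_eq_integral test_function_Lp_ball(2) \<phi>) auto
    also have "\<dots> \<le> ennreal (B (r n) powr (p / 2))"
      using Lp[of "r n"] test_function_Lp_ball(1)[OF \<phi>(1)[of "r n"], of p] p by (intro ennreal_leI) simp
    finally show "(\<integral>\<^sup>+x. ennreal (\<bar>\<phi> (r n) x\<bar> powr p) \<partial>ball_measure) \<le> ennreal (B (r n) powr (p / 2))" .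
  qed
  also have "\<dots> = ennreal ((Q / \<Lambda>) powr (p / 2))"
  proof (intro lim_imp_Liminf tendsto_ennrealI tendsto_powr2)
    show "(\<lambda>n. B (r n)) \<longlonglongrightarrow> Q / \<Lambda>" using LIMSEQ_subseq_LIMSEQ[OF B_lim r(1)] by (simp add: o_def)
  qed (use p B0 in auto)
  finally have nn: "(\<integral>\<^sup>+x. ennreal (\<bar>u x\<bar> powr p) \<partial>ball_measure) \<le> ennreal ((Q / \<Lambda>) powr (p / 2))" .
  define P where "P = (LINT x|ball_measure. \<bar>u x\<bar> powr p)"
  have i: "integrable ball_measure (\<lambda>x. \<bar>u x\<bar> powr p)"
  proof (rule integrableI_nonneg)
    show "(\<lambda>x. \<bar>u x\<bar> powr p) \<in> borel_measurable ball_measure" using um by measurable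
    show "(\<integral>\<^sup>+x. ennreal (\<bar>u x\<bar> powr p) \<partial>ball_measure) < \<infinity>" using nn by (rule le_less_trans) simp
  qed simp
  have "ennreal P \<le> ennreal ((Q / \<Lambda>) powr (p / 2))"
    using nn unfolding P_def by (subst nn_integral_eq_integral[symmetric, OF i]) auto
  then have "P \<le> (Q / \<Lambda>) powr (p / 2)" by (simp add: ennreal_le_iff)
  moreover have P0: "P > 0"
  proof (rule ccontr)
    assume "\<not> P > 0"
    moreover have "0 \<le> P" unfolding P_def by simp
    ultimately have "P = 0" by simp
    then have "AE x in ball_measure. \<bar>u x\<bar> powr p = 0"
      unfolding P_def using integral_nonneg_eq_0_iff_AE[OF i] by simp
    then show False using un by simp
  qed
  ultimately have "P powr (2 / p) \<le> ((Q / \<Lambda>) powr (p / 2)) powr (2 / p)" using p by (intro powr_mono2) auto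
  also have "\<dots> = Q / \<Lambda>" using p Q0 \<Lambda> by (simp add: powr_powr)
  finally have "\<Lambda> * P powr (2 / p) \<le> Q" using \<Lambda> by (simp add: pos_le_divide_eq mult.commute)
  then have "\<Lambda> \<le> Q / P powr (2 / p)" using P0 by (simp add: pos_le_divide_eq)
  also have "\<dots> = rayleigh i j 0 m p u" by (simp add: rayleigh_def Q_def P_def W_def)
  finally show ?thesis by (simp add: \<Lambda>_def)
qed

section \<open>A concentrating competitor\<close>

lemma test_function_H10_nonzero:
  assumes w: "test_function w" "w a \<noteq> 0"
  shows "w \<in> H10_nonzero"
proof -
  have "\<not> (AE x in ball_measure. w x = 0)"
  proof
    assume "AE x in ball_measure. w x = 0"
    then have "AE x in ball_measure. \<bar>w x\<bar> powr 1 = 0" by eventually_elim simp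
    then have "(LINT x|ball_measure. \<bar>w x\<bar> powr 1) = 0" by (rule integral_eq_zero_AE)
    then show False
      using Cc_smooth_Lp_pos[OF test_function_Cc_smooth[OF w(1)] w(2), of 1] test_function_Lp_ball(1)[OF w(1), of 1] by simp
  qed
  then show ?thesis using test_function_H10[OF w(1)] by (simp add: H10_nonzero_def)
qed

text \<open>At a point with \<open>i\<close>-th coordinate \<open>y\<close> and \<open>j\<close>-th coordinate \<open>z\<close>, a gradient with components \<open>a\<close> and
  \<open>b\<close> there has angular derivative \<open>y b - z a\<close>. Near \<open>e\<^sub>i/2\<close> only the term \<open>y b\<close> counts.\<close>

lemma angular_part_lower_bound:
  fixes \<alpha> \<eta> a b y z :: real
  assumes "0 < \<alpha>" "\<alpha> < 1" "1 / 4 \<le> y" "y \<le> 1" "\<bar>z\<bar> \<le> \<eta>"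
  shows "\<alpha>\<^sup>2 / 16 * b\<^sup>2 - \<eta> * (a\<^sup>2 + b\<^sup>2) \<le> \<alpha>\<^sup>2 * (y * b - z * a)\<^sup>2"
proof -
  have \<alpha>2: "\<alpha>\<^sup>2 \<le> 1" using assms by (simp add: power_le_one)
  have \<eta>: "\<eta> \<ge> 0" using assms(5) by linarith
  have y2: "1 / 16 \<le> y\<^sup>2" using power_mono[OF assms(3), of 2] by (simp add: power2_eq_square)
  have "2 * (y * b) * (z * a) \<le> 2 * \<bar>y * z\<bar> * \<bar>a * b\<bar>"
    using abs_ge_self[of "(y * z) * (a * b)"] by (simp add: abs_mult mult_ac)
  also have "\<dots> \<le> 2 * \<eta> * \<bar>a * b\<bar>"
  proof -
    have "\<bar>y * z\<bar> \<le> 1 * \<eta>" unfolding abs_mult using assms by (intro mult_mono) auto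
    then show ?thesis by (intro mult_right_mono) auto
  qed
  also have "\<dots> \<le> \<eta> * (a\<^sup>2 + b\<^sup>2)"
  proof -
    have "2 * \<bar>a * b\<bar> \<le> a\<^sup>2 + b\<^sup>2"
      using zero_le_power2[of "\<bar>a\<bar> - \<bar>b\<bar>"] by (simp add: power2_diff abs_mult)
    then have "\<eta> * (2 * \<bar>a * b\<bar>) \<le> \<eta> * (a\<^sup>2 + b\<^sup>2)" by (rule mult_left_mono[OF _ \<eta>])
    then show ?thesis by simp
  qed
  finally have "2 * (y * b) * (z * a) \<le> \<eta> * (a\<^sup>2 + b\<^sup>2)" .
  moreover have "1 / 16 * b\<^sup>2 \<le> y\<^sup>2 * b\<^sup>2" using y2 by (rule mult_right_mono) simp
  moreover have "(y * b - z * a)\<^sup>2 = y\<^sup>2 * b\<^sup>2 - 2 * (y * b) * (z * a) + (z * a)\<^sup>2"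
    by (simp add: power2_diff power_mult_distrib)
  ultimately have "1 / 16 * b\<^sup>2 - \<eta> * (a\<^sup>2 + b\<^sup>2) \<le> (y * b - z * a)\<^sup>2"
    using zero_le_power2[of "z * a"] by linarith
  then have "\<alpha>\<^sup>2 * (1 / 16 * b\<^sup>2 - \<eta> * (a\<^sup>2 + b\<^sup>2)) \<le> \<alpha>\<^sup>2 * (y * b - z * a)\<^sup>2"
    by (rule mult_left_mono) simp
  moreover have "\<alpha>\<^sup>2 * (\<eta> * (a\<^sup>2 + b\<^sup>2)) \<le> 1 * (\<eta> * (a\<^sup>2 + b\<^sup>2))"
    using \<alpha>2 \<eta> by (intro mult_right_mono) auto
  ultimately show ?thesis by (simp add: right_diff_distrib)
qed

text \<open>The competitor is \<open>w = v \<circ> T\<close>, where \<open>T\<close> sends \<open>e\<^sub>i/2\<close> to the origin and stretches by \<open>\<surd>m\<close>, in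
  direction \<open>j\<close> by \<open>\<surd>m/s\<close>. The condition \<open>\<rho> \<le> \<surd>m \<eta>\<close> confines its support to the ball of radius
  \<open>\<eta>\<close> around \<open>e\<^sub>i/2\<close>, and \<open>\<eta> \<le> 1/4\<close> keeps that ball inside the unit ball with \<open>i\<close>-th coordinates at
  least \<open>1/4\<close>; this is where the constant \<open>1/16\<close> in \<open>s\<close> comes from.\<close>

lemma concentrated_competitor:
  fixes v :: "real ^ 'n \<Rightarrow> real" and i j :: "'n::finite"
  assumes ij: "i \<noteq> j" and \<alpha>: "0 < \<alpha>" "\<alpha> < 1" and p: "p > 2"
    and v: "Cc_smooth v" "v y\<^sub>0 \<noteq> 0" and \<rho>: "\<And>x. v x \<noteq> 0 \<Longrightarrow> norm x \<le> \<rho>"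
    and \<eta>: "0 < \<eta>" "\<eta> \<le> 1 / 4" and m: "m > 0" "\<rho> \<le> sqrt m * \<eta>"
  defines "s \<equiv> sqrt (1 - \<alpha>\<^sup>2 / 16)"
  shows "\<exists>w. w \<in> H10_nonzero \<and> rayleigh i j \<alpha> m p w \<le>
    (1 + 2 * \<eta>) * s powr (1 - 2 / p) * (m * (sqrt m ^ CARD('n)) powr (2 / p - 1))
      * (energy v / (LINT x|lborel. \<bar>v x\<bar> powr p) powr (2 / p))"
proof -
  define M where "M = sqrt m ^ CARD('n)"
  define d where "d k = (if k = j then sqrt m / s else sqrt m)" for k
  define x\<^sub>0 :: "real ^ 'n" where "x\<^sub>0 = axis i (1 / 2)"
  define T where "T = diagonal_map d x\<^sub>0"
  define w where "w x = v (T x)" for x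
  define P where "P = (LINT x|lborel. \<bar>v x\<bar> powr p)"
  have M: "M > 0" using m by (simp add: M_def)
  have P: "P > 0" unfolding P_def using Cc_smooth_Lp_pos[OF v] p by simp
  have "\<alpha>\<^sup>2 < 1" using \<alpha> by (simp add: power_less_one_iff)
  then have s2: "s\<^sup>2 = 1 - \<alpha>\<^sup>2 / 16" and s2': "s\<^sup>2 \<ge> 15 / 16" and s0: "s > 0"
    by (simp_all add: s_def)
  have s1: "s \<le> 1" by (simp add: s_def)
  have d_ge: "sqrt m \<le> d k" for k
    using s0 s1 m by (simp add: d_def pos_le_divide_eq mult_left_le)
  have d: "d k > 0" for k using d_ge[of k] m by (meson less_le_trans real_sqrt_gt_zero)
  have prod_d: "(\<Prod>k\<in>UNIV. d k) = M / s"
  proof -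
    have "(\<Prod>k\<in>UNIV. d k) = (\<Prod>k\<in>UNIV. sqrt m * (if k = j then 1 / s else 1))"
      by (intro prod.cong) (auto simp: d_def)
    then show ?thesis by (simp add: prod.distrib M_def)
  qed
  have change: "(LINT x|lborel. g (T x)) = s / M * (LINT x|lborel. g x)" if "g \<in> borel_measurable borel" for g :: "real ^ 'n \<Rightarrow> real"
    unfolding T_def by (subst lborel_diagonal_map[OF d that]) (simp add: prod_d)
  have near: "norm (x - x\<^sub>0) \<le> \<eta>" if "norm (T x) \<le> \<rho>" for x
  proof -
    have "sqrt m * norm (x - x\<^sub>0) \<le> norm (T x)"
      unfolding T_def by (rule diagonal_map_norm_ge) (use d_ge m in auto)
    also have "\<dots> \<le> sqrt m * \<eta>" using that m by simp
    finally show ?thesis using m by simp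
  qed
  have inball: "x \<in> ball 0 1" if "norm (x - x\<^sub>0) \<le> \<eta>" for x
  proof -
    have "norm x \<le> norm (x - x\<^sub>0) + norm x\<^sub>0" using norm_triangle_ineq[of "x - x\<^sub>0" x\<^sub>0] by simp
    also have "norm x\<^sub>0 = 1 / 2"
    proof -
      have "x\<^sub>0 = (1 / 2) *\<^sub>R axis i 1" by (simp add: x\<^sub>0_def vec_eq_iff axis_def)
      then show ?thesis by (simp add: norm_axis_1)
    qed
    also have "norm (x - x\<^sub>0) + 1 / 2 < 1" using that \<eta> by linarith
    finally show ?thesis by simp
  qed
  have tw: "test_function w"
  proof (rule test_functionI)
    show "C_k r w" for r unfolding w_def T_def by (rule C_k_diagonal_map[OF Cc_smooth_C_k[OF v(1)]])
    show "compact (cball x\<^sub>0 \<eta>)" by simp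
    show "cball x\<^sub>0 \<eta> \<subseteq> ball 0 1" using inball by (auto simp: dist_norm norm_minus_commute simp del: mem_ball_0)
    show "x \<in> cball x\<^sub>0 \<eta>" if "w x \<noteq> 0" for x
      using near[OF \<rho>[OF that[unfolded w_def]]] by (simp add: dist_norm norm_minus_commute)
  qed
  have "w (\<chi> k. y\<^sub>0 $ k / d k + x\<^sub>0 $ k) \<noteq> 0"
  proof -
    have "T (\<chi> k. y\<^sub>0 $ k / d k + x\<^sub>0 $ k) = y\<^sub>0"
      using d by (simp add: T_def diagonal_map_def vec_eq_iff less_imp_neq[THEN not_sym])
    then show ?thesis using v(2) by (simp add: w_def)
  qed
  then have wH: "w \<in> H10_nonzero" by (rule test_function_H10_nonzero[OF tw])
  have pw: "partial_deriv k w x = d k * partial_deriv k v (T x)" for k x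
    unfolding w_def[abs_def] T_def by (rule partial_deriv_diagonal_map[OF v(1)])
  let ?g = "\<lambda>y. (norm (grad v y))\<^sup>2 + (v y)\<^sup>2"
  let ?A = "\<lambda>x. x $ i * grad w x $ j - x $ j * grad w x $ i"
  have pointwise: "(norm (grad w x))\<^sup>2 - \<alpha>\<^sup>2 * (?A x)\<^sup>2 + m * (w x)\<^sup>2 \<le> (1 + 2 * \<eta>) * m * ?g (T x)" for x
  proof (cases "norm (T x) \<le> \<rho>")
    case False
    then have "v (T x) = 0" "grad v (T x) = 0"
      using \<rho>[of "T x"] grad_support[of v "cball 0 \<rho>" "T x"] \<rho> by auto
    moreover from this(2) have "partial_deriv k v (T x) = 0" for k
      by (simp add: grad_def vec_eq_iff)
    then have "grad w x = 0" by (simp add: grad_def pw vec_eq_iff)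
    ultimately show ?thesis by (simp add: w_def)
  next
    case True
    define D where "D k = partial_deriv k v (T x)" for k
    define a b where "a = partial_deriv i w x" and "b = partial_deriv j w x"
    have gv: "(norm (grad v (T x)))\<^sup>2 = (\<Sum>k\<in>UNIV. (D k)\<^sup>2)"
      by (simp add: norm_grad_power2 D_def)
    have xi: "\<bar>x $ i - 1 / 2\<bar> \<le> \<eta>" and xj: "\<bar>x $ j\<bar> \<le> \<eta>"
      using order_trans[OF component_le_norm_cart[of "x - x\<^sub>0" i] near[OF True]]
        order_trans[OF component_le_norm_cart[of "x - x\<^sub>0" j] near[OF True]] ij
      by (simp_all add: x\<^sub>0_def axis_def)
    have ang: "\<alpha>\<^sup>2 / 16 * b\<^sup>2 - \<eta> * (a\<^sup>2 + b\<^sup>2) \<le> \<alpha>\<^sup>2 * (x $ i * b - x $ j * a)\<^sup>2"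
      by (rule angular_part_lower_bound[OF \<alpha> _ _ xj]) (use xi \<eta> in linarith)+
    have "a\<^sup>2 + b\<^sup>2 \<le> (norm (grad w x))\<^sup>2"
      using two_components_le_norm[OF ij, of "grad w x"] by (simp add: a_def b_def grad_def)
    then have "\<eta> * (a\<^sup>2 + b\<^sup>2) \<le> \<eta> * (norm (grad w x))\<^sup>2" using \<eta> by (intro mult_left_mono) auto
    with ang have le: "(norm (grad w x))\<^sup>2 - \<alpha>\<^sup>2 * (x $ i * b - x $ j * a)\<^sup>2 \<le> (1 + \<eta>) * (norm (grad w x))\<^sup>2 - \<alpha>\<^sup>2 / 16 * b\<^sup>2"
      by (simp add: distrib_right)
    have d2: "(d k)\<^sup>2 = (if k = j then m / s\<^sup>2 else m)" for k
      using m by (simp add: d_def power_divide)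
    have b2: "b\<^sup>2 = m / s\<^sup>2 * (D j)\<^sup>2" by (simp add: b_def pw power_mult_distrib d2 D_def)
    \<comment> \<open>The stronger stretching in direction \<open>j\<close> costs exactly what the angular term gains.\<close>
    have gw: "(norm (grad w x))\<^sup>2 = m * (\<Sum>k\<in>UNIV. (D k)\<^sup>2) + \<alpha>\<^sup>2 / 16 * b\<^sup>2"
    proof -
      have "(norm (grad w x))\<^sup>2 = (\<Sum>k\<in>UNIV. m * (D k)\<^sup>2 + (if k = j then (m / s\<^sup>2 - m) * (D j)\<^sup>2 else 0))"
        unfolding norm_grad_power2 pw power_mult_distrib d2 D_def by (intro sum.cong) (auto simp: left_diff_distrib)
      also have "\<dots> = m * (\<Sum>k\<in>UNIV. (D k)\<^sup>2) + (m / s\<^sup>2 - m) * (D j)\<^sup>2"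
        by (simp add: sum.distrib sum_distrib_left)
      also have "m / s\<^sup>2 - m = \<alpha>\<^sup>2 / 16 * (m / s\<^sup>2)"
      proof -
        have "m / s\<^sup>2 - m = m / s\<^sup>2 * (1 - s\<^sup>2)" using s0 by (simp add: field_simps)
        then show ?thesis by (simp add: s2)
      qed
      finally show ?thesis by (simp add: b2 mult.assoc)
    qed
    have "\<alpha>\<^sup>2 / 16 * b\<^sup>2 \<le> m * (D j)\<^sup>2"
    proof -
      have "\<alpha>\<^sup>2 / 16 / s\<^sup>2 \<le> 1" using s2' \<open>\<alpha>\<^sup>2 < 1\<close> s0 by (simp add: pos_divide_le_eq)
      then have "\<alpha>\<^sup>2 / 16 / s\<^sup>2 * (m * (D j)\<^sup>2) \<le> 1 * (m * (D j)\<^sup>2)" using m by (intro mult_right_mono) auto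
      then show ?thesis by (simp add: b2 mult_ac)
    qed
    also have "m * (D j)\<^sup>2 \<le> m * (\<Sum>k\<in>UNIV. (D k)\<^sup>2)"
      using m by (intro mult_left_mono member_le_sum) auto
    finally have "\<eta> * (\<alpha>\<^sup>2 / 16 * b\<^sup>2) \<le> \<eta> * (m * (\<Sum>k\<in>UNIV. (D k)\<^sup>2))"
      using \<eta> by (intro mult_left_mono) auto
    moreover have "(1 + \<eta>) * (Z + B) - B = Z + \<eta> * Z + \<eta> * B" "(1 + 2 * \<eta>) * Z = Z + \<eta> * Z + \<eta> * Z" for Z B
      by (simp_all add: algebra_simps)
    ultimately have "(norm (grad w x))\<^sup>2 - \<alpha>\<^sup>2 * (x $ i * b - x $ j * a)\<^sup>2 \<le> (1 + 2 * \<eta>) * (m * (\<Sum>k\<in>UNIV. (D k)\<^sup>2))"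
      using le unfolding gw by (simp only:)
    moreover have "m * (w x)\<^sup>2 \<le> (1 + 2 * \<eta>) * (m * (w x)\<^sup>2)"
      using m \<eta> mult_right_mono[of 1 "1 + 2 * \<eta>" "m * (w x)\<^sup>2"] by simp
    moreover have "grad w x $ i = a" "grad w x $ j = b" by (simp_all add: grad_def a_def b_def)
    ultimately show ?thesis
      unfolding gv w_def by (simp only: distrib_left mult.assoc)
  qed
  have gm: "?g \<in> borel_measurable borel"
    using Cc_smooth_integrable_power(1)[OF v(1)] Cc_smooth_borel[OF v(1)] by measurable
  have Tm: "T \<in> borel_measurable borel"
    unfolding T_def diagonal_map_affine[abs_def]
    by (intro borel_measurable_continuous_onI continuous_intros continuous_on_vec_lambda)
  have gTm: "(\<lambda>x. (1 + 2 * \<eta>) * m * ?g (T x)) \<in> borel_measurable borel"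
    using measurable_compose[OF Tm gm] by simp
  have gTs: "x \<in> ball 0 1" if "(1 + 2 * \<eta>) * m * ?g (T x) \<noteq> 0" for x
  proof -
    have "v (T x) \<noteq> 0 \<or> grad v (T x) \<noteq> 0" using that by auto
    then have "norm (T x) \<le> \<rho>" using \<rho>[of "T x"] grad_support[of v "cball 0 \<rho>" "T x"] \<rho> by auto
    then show ?thesis by (intro inball near)
  qed
  have gTi: "integrable ball_measure (\<lambda>x. (1 + 2 * \<eta>) * m * ?g (T x))"
  proof (subst integrable_ball_iff_lborel[OF gTm gTs])
    have cg: "continuous_on UNIV (\<lambda>x. (1 + 2 * \<eta>) * m * ?g (T x))"
    proof -
      have cT: "continuous_on UNIV T" unfolding T_def diagonal_map_affine[abs_def]
        by (intro continuous_intros continuous_on_vec_lambda)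
      show ?thesis
        by (intro continuous_intros continuous_on_compose2[OF Cc_smooth_continuous[OF v(1)] cT]
            continuous_on_compose2[OF continuous_grad[OF v(1)] cT]) auto
    qed
    show "integrable lborel (\<lambda>x. (1 + 2 * \<eta>) * m * ?g (T x))"
      by (rule continuous_compact_support_integrable[OF cg, of 1]) (use gTs in force)
  qed auto
  have num: "(LINT x|ball_measure. (norm (grad w x))\<^sup>2 - \<alpha>\<^sup>2 * (?A x)\<^sup>2 + m * (w x)\<^sup>2) \<le> (1 + 2 * \<eta>) * m * (s / M) * energy v"
  proof -
    have "(LINT x|ball_measure. (norm (grad w x))\<^sup>2 - \<alpha>\<^sup>2 * (?A x)\<^sup>2 + m * (w x)\<^sup>2) \<le> (LINT x|ball_measure. (1 + 2 * \<eta>) * m * ?g (T x))"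
      by (rule integral_mono[OF integrable_rayleigh_integrand gTi pointwise])
         (intro test_function_L2[OF tw] has_weak_gradient_grad[OF tw])+
    also have "\<dots> = (LINT x|lborel. (1 + 2 * \<eta>) * m * ?g (T x))"
      by (rule LINT_ball_eq_lborel[OF gTm gTs])
    also have "\<dots> = (1 + 2 * \<eta>) * m * (LINT x|lborel. ?g (T x))" by (rule integral_mult_right_zero)
    also have "(LINT x|lborel. ?g (T x)) = s / M * energy v" unfolding energy_def by (rule change[OF gm])
    finally show ?thesis by (simp add: mult.assoc)
  qed
  have [measurable]: "v \<in> borel_measurable borel" by (rule Cc_smooth_borel[OF v(1)])
  have Lp: "(LINT x|ball_measure. \<bar>w x\<bar> powr p) = s / M * P"
  proof -
    have "(LINT x|lborel. \<bar>v (T x)\<bar> powr p) = s / M * (LINT x|lborel. \<bar>v x\<bar> powr p)"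
      by (rule change) measurable
    then show ?thesis
      unfolding P_def using p by (subst test_function_Lp_ball(1)[OF tw]) (simp_all only: w_def)
  qed
  have "rayleigh i j \<alpha> m p w =
      (LINT x|ball_measure. (norm (grad w x))\<^sup>2 - \<alpha>\<^sup>2 * (?A x)\<^sup>2 + m * (w x)\<^sup>2) / (s / M * P) powr (2 / p)"
    unfolding Lp[symmetric] by (rule rayleigh_eq[OF test_function_L2[OF tw] has_weak_gradient_grad[OF tw]])
  also have "\<dots> \<le> (1 + 2 * \<eta>) * m * (s / M) * energy v / (s / M * P) powr (2 / p)"
    by (intro divide_right_mono num) simp
  also have "\<dots> = (1 + 2 * \<eta>) * s powr (1 - 2 / p) * (m * M powr (2 / p - 1)) * (energy v / P powr (2 / p))"
    using s0 M P by (simp add: powr_mult powr_divide powr_diff field_simps)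
  finally show ?thesis using wH unfolding M_def P_def by blast
qed

section \<open>Rotations\<close>

lemma rotation_nth:
  assumes "i \<noteq> j"
  shows "rotation i j \<theta> x $ i = x $ i * cos \<theta> + x $ j * sin \<theta>"
    "rotation i j \<theta> x $ j = - x $ i * sin \<theta> + x $ j * cos \<theta>"
    "k \<noteq> i \<Longrightarrow> k \<noteq> j \<Longrightarrow> rotation i j \<theta> x $ k = x $ k"
  using assms by (auto simp: rotation_def)

lemma vec_eq_iff_pair:
  fixes x y :: "'a ^ 'n"
  shows "x = y \<longleftrightarrow> x $ i = y $ i \<and> x $ j = y $ j \<and> (\<forall>k. k \<noteq> i \<longrightarrow> k \<noteq> j \<longrightarrow> x $ k = y $ k)"
  unfolding vec_eq_iff by metis

lemma linear_rotation: "linear (rotation i j \<theta>)"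
  by (rule linearI) (auto simp: rotation_def vec_eq_iff algebra_simps)

lemma rotation_0: "rotation i j 0 x = x"
  by (simp add: rotation_def vec_eq_iff)

lemma rotation_add:
  assumes "i \<noteq> j"
  shows "rotation i j (\<theta> + h) x = rotation i j \<theta> (rotation i j h x)"
  unfolding vec_eq_iff_pair[of _ _ i j]
  using assms by (simp add: rotation_nth sin_add cos_add algebra_simps)

lemma norm_rotation:
  assumes "i \<noteq> j"
  shows "norm (rotation i j \<theta> x) = norm x"
proof -
  have split: "(norm y)\<^sup>2 = (y $ i)\<^sup>2 + ((y $ j)\<^sup>2 + (\<Sum>k\<in>UNIV - {i} - {j}. (y $ k)\<^sup>2))" for y :: "real ^ 'a"
    unfolding norm_vec_power2 using assms
    by (subst sum.remove[of _ i]; simp; subst sum.remove[of _ j]; simp)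
  have "(x $ i * cos \<theta> + x $ j * sin \<theta>)\<^sup>2 + (- x $ i * sin \<theta> + x $ j * cos \<theta>)\<^sup>2
      = ((x $ i)\<^sup>2 + (x $ j)\<^sup>2) * ((sin \<theta>)\<^sup>2 + (cos \<theta>)\<^sup>2)"
    by algebra
  then have "(norm (rotation i j \<theta> x))\<^sup>2 = (norm x)\<^sup>2"
    unfolding split by (simp add: rotation_nth assms)
  then show ?thesis by simp
qed

lemma rotation_displacement:
  assumes ij: "i \<noteq> j"
  shows "norm (rotation i j h x - x) \<le> 4 * norm x * \<bar>h\<bar>"
proof -
  have s: "\<bar>sin h\<bar> \<le> \<bar>h\<bar>" by (rule abs_sin_x_le_abs_x)
  have c: "\<bar>cos h - 1\<bar> \<le> \<bar>h\<bar>"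
  proof -
    have "\<bar>cos h - 1\<bar> = 2 * (\<bar>sin (h / 2)\<bar> * \<bar>sin (h / 2)\<bar>)"
      using cos_double_sin[of "h / 2"] by (simp add: power2_eq_square abs_mult)
    also have "\<dots> \<le> 2 * (\<bar>h / 2\<bar> * 1)"
      by (intro mult_left_mono mult_mono abs_sin_x_le_abs_x abs_sin_le_one) auto
    finally show ?thesis by simp
  qed
  have xi: "\<bar>x $ k\<bar> \<le> norm x" for k by (rule component_le_norm_cart)
  have b: "\<bar>y * (cos h - 1) + z * sin h\<bar> \<le> 2 * norm x * \<bar>h\<bar>" if "\<bar>y\<bar> \<le> norm x" "\<bar>z\<bar> \<le> norm x" for y z
  proof -
    have "\<bar>y * (cos h - 1)\<bar> \<le> norm x * \<bar>h\<bar>" "\<bar>z * sin h\<bar> \<le> norm x * \<bar>h\<bar>"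
      unfolding abs_mult using s c that by (auto intro!: mult_mono)
    then show ?thesis by linarith
  qed
  have "norm (rotation i j h x - x) \<le> (\<Sum>k\<in>UNIV. \<bar>(rotation i j h x - x) $ k\<bar>)"
    by (rule norm_le_l1_cart)
  also have "\<dots> \<le> (\<Sum>k\<in>UNIV. (if k = i then 2 * norm x * \<bar>h\<bar> else 0) + (if k = j then 2 * norm x * \<bar>h\<bar> else 0))"
  proof (rule sum_mono)
    fix k
    have "\<bar>(rotation i j h x - x) $ i\<bar> \<le> 2 * norm x * \<bar>h\<bar>"
      using b[OF xi[of i] xi[of j]] ij by (simp add: rotation_nth algebra_simps)
    moreover have "\<bar>(rotation i j h x - x) $ j\<bar> \<le> 2 * norm x * \<bar>h\<bar>"
      using b[of "x $ j" "- x $ i"] xi[of i] xi[of j] ij by (simp add: rotation_nth algebra_simps)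
    ultimately show "\<bar>(rotation i j h x - x) $ k\<bar> \<le> (if k = i then 2 * norm x * \<bar>h\<bar> else 0) + (if k = j then 2 * norm x * \<bar>h\<bar> else 0)"
      using ij by (auto simp: rotation_nth(3)[OF ij])
  qed
  also have "\<dots> = 4 * norm x * \<bar>h\<bar>" by (simp add: sum.distrib)
  finally show ?thesis .
qed

lemma Cc_smooth_rotation:
  assumes ij: "i \<noteq> j" and f: "Cc_smooth f"
  shows "Cc_smooth (\<lambda>x. f (rotation i j \<theta> x))"
proof -
  have "C_k r (\<lambda>x. f (rotation i j \<theta> x))" for r
    using C_k_affine[OF linear_rotation[of i j \<theta>] Cc_smooth_C_k[OF f, of r], of 0] by simp
  moreover obtain \<rho> where "\<And>x. f x \<noteq> 0 \<Longrightarrow> norm x \<le> \<rho>" using Cc_smooth_support[OF f] by metis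
  then have "f (rotation i j \<theta> x) \<noteq> 0 \<longrightarrow> norm x \<le> \<rho>" for x
    by (metis norm_rotation[OF ij])
  ultimately show ?thesis unfolding Cc_smooth_def by blast
qed

lemma rotation_borel: "rotation i j \<theta> \<in> borel_measurable borel"
  by (intro borel_measurable_continuous_onI linear_continuous_on linear_conv_bounded_linear[THEN iffD1] linear_rotation)

lemma has_derivative_integral_rotation:
  fixes f :: "real ^ 'n \<Rightarrow> real"
  assumes ij: "i \<noteq> j" and f: "Cc_smooth f" and u: "integrable lborel u"
  shows "((\<lambda>h. LINT x|lborel. u x * f (rotation i j h x)) has_real_derivative
    (LINT x|lborel. u x * (x $ j * partial_deriv i f x - x $ i * partial_deriv j f x))) (at 0)"
proof -
  obtain \<rho> where \<rho>: "\<rho> > 0" "\<And>x. f x \<noteq> 0 \<Longrightarrow> norm x \<le> \<rho>" using Cc_smooth_support[OF f] by metis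
  obtain L where L: "L > 0" "\<And>x y. \<bar>f x - f y\<bar> \<le> L * norm (x - y)" using Cc_smooth_lipschitz[OF f] by metis
  obtain B where B: "\<And>x. \<bar>f x\<bar> \<le> B" using Cc_smooth_bounded[OF f] by metis
  have [measurable]: "partial_deriv k f \<in> borel_measurable borel" for k
    by (intro Cc_smooth_borel Cc_smooth_partial_deriv f)
  show ?thesis
  proof (rule differentiation_under_integral[OF u])
    show "(\<lambda>x. f (rotation i j h x)) \<in> borel_measurable lborel" for h
      using Cc_smooth_borel[OF Cc_smooth_rotation[OF ij f]] by simp
    show "\<bar>f (rotation i j 0 x)\<bar> \<le> B" for x by (simp add: rotation_0 B)
    show "\<bar>f (rotation i j h x) - f (rotation i j 0 x)\<bar> \<le> L * (4 * \<rho>) * \<bar>h\<bar>" for h x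
    proof (cases "norm x \<le> \<rho>")
      case True
      have "\<bar>f (rotation i j h x) - f (rotation i j 0 x)\<bar> \<le> L * norm (rotation i j h x - x)"
        using L(2) by (simp add: rotation_0)
      also have "\<dots> \<le> L * (4 * norm x * \<bar>h\<bar>)"
        using L(1) rotation_displacement[OF ij] by (intro mult_left_mono) auto
      also have "\<dots> \<le> L * (4 * \<rho> * \<bar>h\<bar>)"
        using L(1) True by (intro mult_left_mono mult_right_mono) auto
      finally show ?thesis by (simp add: mult.assoc)
    next
      case False
      then have "f (rotation i j h x) = 0" "f (rotation i j 0 x) = 0"
        using \<rho>(2) norm_rotation[OF ij] by metis+
      then show ?thesis using L \<rho> by simp
    qed
    show "((\<lambda>h. f (rotation i j h x)) has_real_derivative
        (x $ j * partial_deriv i f x - x $ i * partial_deriv j f x)) (at 0)" for x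
    proof -
      define v :: "real ^ 'n" where "v = (\<chi> k. if k = i then x $ j else if k = j then - x $ i else 0)"
      have "((\<lambda>h. rotation i j h x) has_vector_derivative v) (at 0)"
        unfolding has_vector_derivative_def
      proof (subst has_derivative_componentwise_within, rule ballI)
        fix b :: "real ^ 'n" assume "b \<in> Basis"
        then obtain k where b: "b = axis k 1" by (auto simp: Basis_vec_def)
        have "((\<lambda>h. rotation i j h x $ k) has_real_derivative v $ k) (at 0)"
          using ij by (auto simp: rotation_def v_def intro!: derivative_eq_intros)
        then show "((\<lambda>h. rotation i j h x \<bullet> b) has_derivative (\<lambda>t. (t *\<^sub>R v) \<bullet> b)) (at 0)"
          by (simp add: b inner_axis has_field_derivative_def mult_commute_abs)
      qed
      from Cc_smooth_derivative_along_curve[OF f this]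
      have "((\<lambda>h. f (rotation i j h x)) has_real_derivative grad f x \<bullet> v) (at 0)" by (simp add: rotation_0)
      moreover have "grad f x \<bullet> v = x $ j * partial_deriv i f x - x $ i * partial_deriv j f x"
      proof -
        have "grad f x \<bullet> v = (\<Sum>k\<in>UNIV. (if k = i then x $ j * partial_deriv i f x else 0) + (if k = j then - x $ i * partial_deriv j f x else 0))"
          unfolding inner_vec_def v_def grad_def using ij by (intro sum.cong) auto
        then show ?thesis by (simp add: sum.distrib)
      qed
      ultimately show ?thesis by simp
    qed
  qed measurable
qed

lemma partial_deriv_coordinate_mult:
  assumes "k \<noteq> l" "Cc_smooth f"
  shows "partial_deriv k (\<lambda>x. x $ l * f x) x = x $ l * partial_deriv k f x"
proof -
  have d: "((\<lambda>x. x $ l) has_derivative (\<lambda>h. h $ l)) (at x)" for x :: "real ^ 'a"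
    by (rule bounded_linear_imp_has_derivative) (rule bounded_linear_vec_nth)
  have "(\<lambda>x. x $ l) differentiable (at x)" by (rule differentiableI[OF d])
  then have "partial_deriv k (\<lambda>x. x $ l * f x) x = x $ l * partial_deriv k f x + partial_deriv k (\<lambda>x. x $ l) x * f x"
    by (rule partial_deriv_mult) (rule Cc_smooth_differentiable[OF assms(2)])
  also have "partial_deriv k (\<lambda>x. x $ l) x = axis k 1 $ l" by (rule partial_deriv_eqI[OF d])
  also have "\<dots> = 0" using assms(1) by (simp add: axis_def)
  finally show ?thesis by simp
qed

lemma Cc_smooth_coordinate_mult: "Cc_smooth f \<Longrightarrow> Cc_smooth (\<lambda>x. x $ l * f x)"
  by (intro Cc_smooth_mult allI C_k_coordinate)

text \<open>The field \<open>x\<^sub>j e\<^sub>i - x\<^sub>i e\<^sub>j\<close> is divergence free.\<close>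

lemma integral_angular_derivative_eq_0:
  assumes ij: "i \<noteq> j" and f: "Cc_smooth f"
  shows "(LINT x|lborel. x $ j * partial_deriv i f x - x $ i * partial_deriv j f x) = 0"
proof -
  have "integrable lborel (\<lambda>x. x $ j * partial_deriv i f x)" "integrable lborel (\<lambda>x. x $ i * partial_deriv j f x)"
    by (intro Cc_smooth_integrable Cc_smooth_coordinate_mult Cc_smooth_partial_deriv f)+
  moreover have "(LINT x|lborel. x $ j * partial_deriv i f x) = 0"
    using integral_partial_deriv_eq_0[OF Cc_smooth_coordinate_mult[OF f, of j], of i]
      partial_deriv_coordinate_mult[OF ij f] by simp
  moreover have "(LINT x|lborel. x $ i * partial_deriv j f x) = 0"
    using integral_partial_deriv_eq_0[OF Cc_smooth_coordinate_mult[OF f, of i], of j]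
      partial_deriv_coordinate_mult[OF ij[symmetric] f] by simp
  ultimately show ?thesis by simp
qed

text \<open>The derivative in the angle is the integral of an angular derivative.\<close>

lemma integral_Cc_smooth_rotation:
  fixes f :: "real ^ 'n \<Rightarrow> real"
  assumes ij: "i \<noteq> j" and f: "Cc_smooth f"
  shows "(LINT x|lborel. f (rotation i j \<theta> x)) = (LINT x|lborel. f x)"
proof -
  obtain \<rho> where \<rho>: "\<rho> > 0" "\<And>x. f x \<noteq> 0 \<Longrightarrow> norm x \<le> \<rho>" using Cc_smooth_support[OF f] by metis
  define u :: "real ^ 'n \<Rightarrow> real" where "u = indicator (cball 0 \<rho>)"
  have u: "integrable lborel u"
    unfolding u_def using emeasure_bounded_finite[OF bounded_cball[of "0 :: real ^ 'n" \<rho>]]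
    by (intro integrable_real_indicator) (auto simp: less_top)
  have "((\<lambda>t. LINT x|lborel. f (rotation i j t x)) has_real_derivative 0) (at t)" for t
  proof -
    define g where "g x = f (rotation i j t x)" for x
    have g: "Cc_smooth g" unfolding g_def by (rule Cc_smooth_rotation[OF ij f])
    have g\<rho>: "norm x \<le> \<rho>" if "g x \<noteq> 0" for x
      using \<rho>(2)[of "rotation i j t x"] that by (simp add: g_def norm_rotation[OF ij])
    have "(LINT x|lborel. u x * (x $ j * partial_deriv i g x - x $ i * partial_deriv j g x))
        = (LINT x|lborel. x $ j * partial_deriv i g x - x $ i * partial_deriv j g x)"
    proof (rule Bochner_Integration.integral_cong[OF refl])
      fix x
      have "partial_deriv k g x = 0" if "norm x > \<rho>" for k
        using partial_deriv_support[of g "cball 0 \<rho>" k x] g\<rho> that by auto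
      then show "u x * (x $ j * partial_deriv i g x - x $ i * partial_deriv j g x) = x $ j * partial_deriv i g x - x $ i * partial_deriv j g x"
        by (cases "norm x \<le> \<rho>") (auto simp: u_def)
    qed
    also have "\<dots> = 0" by (rule integral_angular_derivative_eq_0[OF ij g])
    finally have "((\<lambda>h. LINT x|lborel. u x * g (rotation i j h x)) has_real_derivative 0) (at 0)"
      using has_derivative_integral_rotation[OF ij g u] by simp
    moreover have "u x * g (rotation i j h x) = f (rotation i j (t + h) x)" for h x
      using g\<rho>[of "rotation i j h x"]
      by (cases "norm x \<le> \<rho>") (auto simp: u_def g_def rotation_add[OF ij] norm_rotation[OF ij])
    ultimately have "((\<lambda>h. LINT x|lborel. f (rotation i j (t + h) x)) has_real_derivative 0) (at 0)"
      by simp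
    then show ?thesis by (simp add: DERIV_def)
  qed
  then have "(LINT x|lborel. f (rotation i j \<theta> x)) = (LINT x|lborel. f (rotation i j 0 x))"
    by (intro DERIV_isconst_all) auto
  then show ?thesis by (simp add: rotation_0)
qed

text \<open>Smooth bumps converge to the indicator of a box, so invariance passes from smooth functions to boxes, and
  boxes determine the measure.\<close>

lemma lborel_rotation:
  fixes i j :: "'n::finite"
  assumes ij: "i \<noteq> j"
  shows "distr lborel borel (rotation i j \<theta>) = lborel"
proof (rule lborel_eqI[symmetric])
  fix l u :: "real ^ 'n" assume lu: "\<And>b. b \<in> Basis \<Longrightarrow> l \<bullet> b \<le> u \<bullet> b"
  let ?R = "rotation i j \<theta>"
  have Rm[measurable]: "?R \<in> borel_measurable borel" by (rule rotation_borel)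
  obtain \<rho> where \<rho>: "\<And>x. x \<in> box l u \<Longrightarrow> norm x \<le> \<rho>"
    using bounded_box[of l u] unfolding bounded_iff by blast
  define w :: "real ^ 'n \<Rightarrow> real" where "w = indicator (cball 0 \<rho>)"
  have w: "integrable lborel w"
    unfolding w_def using emeasure_bounded_finite[OF bounded_cball[of "0 :: real ^ 'n" \<rho>]]
    by (intro integrable_real_indicator) (auto simp: less_top)
  have lim: "(\<lambda>n. LINT x|lborel. box_bump n l u (rotation i j t x)) \<longlonglongrightarrow> (LINT x|lborel. indicator (box l u) (rotation i j t x))" for t
  proof (rule integral_dominated_convergence[OF _ _ w])
    show "(\<lambda>x. indicat_real (box l u) (rotation i j t x)) \<in> borel_measurable lborel"
      using measurable_compose[OF rotation_borel[of i j t], of "indicat_real (box l u)" borel] by simp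
    show "(\<lambda>x. box_bump n l u (rotation i j t x)) \<in> borel_measurable lborel" for n
      using Cc_smooth_borel[OF Cc_smooth_rotation[OF ij Cc_smooth_box_bump]] by simp
    show "AE x in lborel. norm (box_bump n l u (rotation i j t x)) \<le> w x" for n
    proof (rule AE_I2)
      fix x
      show "norm (box_bump n l u (rotation i j t x)) \<le> w x"
        using box_bump_bounds[of n l u "rotation i j t x"] box_bump_nonzero_iff[of n l u "rotation i j t x"]
          \<rho>[of "rotation i j t x"]
        by (cases "norm x \<le> \<rho>") (auto simp: w_def norm_rotation[OF ij])
    qed
  qed (intro AE_I2 box_bump_tendsto)
  have "(LINT x|lborel. indicat_real (box l u) (?R x)) = (LINT x|lborel. indicat_real (box l u) x)"
    using lim[of \<theta>] lim[of 0]
    by (simp add: integral_Cc_smooth_rotation[OF ij Cc_smooth_box_bump] rotation_0 LIMSEQ_unique)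
  moreover have "(LINT x|lborel. indicat_real (box l u) (?R x)) = measure (distr lborel borel ?R) (box l u)"
  proof -
    have "indicat_real (box l u) (?R x) = indicat_real (?R -` box l u) x" for x by (simp add: indicator_def)
    then show ?thesis by (simp add: measure_distr)
  qed
  ultimately have meas: "measure (distr lborel borel ?R) (box l u) = measure lborel (box l u)"
    by simp
  have "emeasure (distr lborel borel ?R) (box l u) \<le> emeasure lborel (cball 0 \<rho> :: (real ^ 'n) set)"
    by (subst emeasure_distr) (auto intro!: emeasure_mono dest!: \<rho> simp: norm_rotation[OF ij])
  also have "\<dots> < \<infinity>" by (intro emeasure_bounded_finite) simp
  finally have "emeasure (distr lborel borel ?R) (box l u) = ennreal (measure (distr lborel borel ?R) (box l u))"
    by (intro emeasure_eq_ennreal_measure) auto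
  also have "\<dots> = (\<Prod>b\<in>Basis. (u - l) \<bullet> b)"
    unfolding meas using lu by (simp add: measure_lborel_box_eq)
  finally show "emeasure (distr lborel borel ?R) (box l u) = (\<Prod>b\<in>Basis. (u - l) \<bullet> b)" .
qed simp

text \<open>For a test function \<open>\<phi>\<close> the integral of \<open>u \<cdot> (\<phi> \<circ> R\<^sub>h)\<close> does not depend on \<open>h\<close>, because rotations preserve both
  \<open>u\<close> and the measure. Its derivative at zero is, up to integration by parts, the integral of \<open>\<phi>\<close> against
  the weak angular derivative of \<open>u\<close>; the fundamental lemma concludes.\<close>

lemma radial_imp_angular_derivative_0:
  fixes u :: "real ^ 'n \<Rightarrow> real"
  assumes ij: "i \<noteq> j" and u: "H1_ball u" and radial: "\<not> nonradial i j u"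
  shows "AE x in ball_measure. ang_deriv i j u x = 0"
proof -
  define W where "W = weak_grad u"
  have uL2: "L2_ball u" using u by (simp add: H1_ball_def)
  have uW: "has_weak_gradient u W" unfolding W_def by (rule weak_grad_works[OF u])
  have WL2: "L2_ball (\<lambda>x. W x $ k)" for k by (rule has_weak_gradient_L2[OF uW])
  have ball: "ball 0 1 \<inter> space lebesgue \<in> sets (lebesgue :: (real ^ 'n) measure)" by simp
  \<comment> \<open>A Borel representative, extended by zero, can be composed with rotations.\<close>
  have ui: "integrable lebesgue (\<lambda>x. indicator (ball 0 1) x *\<^sub>R u x)"
    using L2_ball_integrable[OF uL2] unfolding integrable_restrict_space[OF ball] .
  then obtain U where Um: "U \<in> borel_measurable lborel" and U: "AE x in lborel. indicator (ball 0 1) x *\<^sub>R u x = U x"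
    using completion_ex_borel_measurable_real[OF borel_measurable_integrable[OF ui]] by blast
  have Um'[measurable]: "U \<in> borel_measurable borel" using Um by simp
  have Ui: "integrable lborel U"
  proof -
    have "integrable lebesgue U"
      using ui by (rule integrable_cong_AE_imp) (use Um AE_completion[OF U] in \<open>auto simp: eq_commute measurable_completion\<close>)
    then show ?thesis using integrable_completion[OF Um] by simp
  qed
  have inv: "AE x in lborel. U (rotation i j \<theta> x) = U x" for \<theta>
  proof -
    have "AE x in ball_measure. u (rotation i j \<theta> x) = u x"
      using radial unfolding nonradial_def by blast
    then have "AE x in lebesgue. x \<in> ball 0 1 \<longrightarrow> u (rotation i j \<theta> x) = u x"
      by (subst (asm) AE_restrict_space_iff) auto
    then have 1: "AE x in lborel. x \<in> ball 0 1 \<longrightarrow> u (rotation i j \<theta> x) = u x"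
      by (simp only: AE_completion_iff)
    have "AE x in distr lborel borel (rotation i j \<theta>). indicator (ball 0 1) x *\<^sub>R u x = U x"
      using U by (simp only: lborel_rotation[OF ij])
    then have "AE x in lborel. indicator (ball 0 1) (rotation i j \<theta> x) *\<^sub>R u (rotation i j \<theta> x) = U (rotation i j \<theta> x)"
      by (rule AE_distrD[rotated]) (simp add: rotation_borel)
    then show ?thesis using U 1
      by eventually_elim (auto simp: indicator_def norm_rotation[OF ij] split: if_splits)
  qed
  have zero: "(LINT x|ball_measure. u x * (x $ j * partial_deriv i \<phi> x - x $ i * partial_deriv j \<phi> x)) = 0"
    if \<phi>: "test_function \<phi>" for \<phi>
  proof -
    have c: "Cc_smooth \<phi>" by (rule test_function_Cc_smooth[OF \<phi>])
    have "(LINT x|lborel. U x * \<phi> (rotation i j h x)) = (LINT x|lborel. U x * \<phi> x)" for h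
    proof -
      have m: "(\<lambda>x. U x * \<phi> x) \<in> borel_measurable borel" using Cc_smooth_borel[OF c] by measurable
      have "(LINT x|lborel. U x * \<phi> x) = (LINT x|distr lborel borel (rotation i j h). U x * \<phi> x)"
        by (simp only: lborel_rotation[OF ij])
      also have "\<dots> = (LINT x|lborel. U (rotation i j h x) * \<phi> (rotation i j h x))"
        by (rule integral_distr) (use m rotation_borel in auto)
      also have "\<dots> = (LINT x|lborel. U x * \<phi> (rotation i j h x))"
      proof (rule integral_cong_AE)
        show "(\<lambda>x. U (rotation i j h x) * \<phi> (rotation i j h x)) \<in> borel_measurable lborel"
          using measurable_compose[OF rotation_borel m] by simp
        show "(\<lambda>x. U x * \<phi> (rotation i j h x)) \<in> borel_measurable lborel"
          using Um Cc_smooth_borel[OF Cc_smooth_rotation[OF ij c]] by simp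
        show "AE x in lborel. U (rotation i j h x) * \<phi> (rotation i j h x) = U x * \<phi> (rotation i j h x)"
          using inv[of h] by eventually_elim simp
      qed
      finally show ?thesis by simp
    qed
    then have "((\<lambda>h. LINT x|lborel. U x * \<phi> (rotation i j h x)) has_real_derivative 0) (at 0)" by simp
    then have 0: "(LINT x|lborel. U x * (x $ j * partial_deriv i \<phi> x - x $ i * partial_deriv j \<phi> x)) = 0"
      using DERIV_unique[OF has_derivative_integral_rotation[OF ij c Ui]] by blast
    have "(\<lambda>x. x $ j * partial_deriv i \<phi> x - x $ i * partial_deriv j \<phi> x) \<in> borel_measurable borel"
      by (intro borel_measurable_diff Cc_smooth_borel Cc_smooth_coordinate_mult Cc_smooth_partial_deriv c)
    then have [measurable]: "(\<lambda>x. x $ j * partial_deriv i \<phi> x - x $ i * partial_deriv j \<phi> x) \<in> borel_measurable lborel" by simp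
    have "(LINT x|ball_measure. u x * (x $ j * partial_deriv i \<phi> x - x $ i * partial_deriv j \<phi> x))
        = (LINT x|lebesgue. indicator (ball 0 1) x *\<^sub>R (u x * (x $ j * partial_deriv i \<phi> x - x $ i * partial_deriv j \<phi> x)))"
      by (rule integral_restrict_space[OF ball])
    also have "\<dots> = (LINT x|lebesgue. U x * (x $ j * partial_deriv i \<phi> x - x $ i * partial_deriv j \<phi> x))"
    proof (rule integral_cong_AE)
      have "(\<lambda>x. x $ j * partial_deriv i \<phi> x - x $ i * partial_deriv j \<phi> x) \<in> borel_measurable lebesgue"
        by (rule measurable_completion) measurable
      then show "(\<lambda>x. indicator (ball 0 1) x *\<^sub>R (u x * (x $ j * partial_deriv i \<phi> x - x $ i * partial_deriv j \<phi> x))) \<in> borel_measurable lebesgue"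
        using borel_measurable_times[OF borel_measurable_integrable[OF ui]] by (simp add: mult.assoc)
      show "(\<lambda>x. U x * (x $ j * partial_deriv i \<phi> x - x $ i * partial_deriv j \<phi> x)) \<in> borel_measurable lebesgue"
        by (rule measurable_completion) measurable
      show "AE x in lebesgue. indicator (ball 0 1) x *\<^sub>R (u x * (x $ j * partial_deriv i \<phi> x - x $ i * partial_deriv j \<phi> x))
          = U x * (x $ j * partial_deriv i \<phi> x - x $ i * partial_deriv j \<phi> x)"
        using AE_completion[OF U] by eventually_elim (simp flip: mult.assoc)
    qed
    also have "\<dots> = 0"
      using 0 by (subst integral_completion) measurable
    finally show ?thesis .
  qed
  have "AE x in ball_measure. x $ i * W x $ j - x $ j * W x $ i = 0"
  proof (rule fundamental_lemma)
    show "integrable ball_measure (\<lambda>x. x $ i * W x $ j - x $ j * W x $ i)"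
      by (intro L2_ball_integrable L2_ball_ang WL2)
    fix \<phi> :: "real ^ 'n \<Rightarrow> real" assume \<phi>: "test_function \<phi>"
    have c: "Cc_smooth \<phi>" by (rule test_function_Cc_smooth[OF \<phi>])
    have t: "test_function (\<lambda>x. x $ k * \<phi> x)" for k
      by (intro test_function_mult allI C_k_coordinate \<phi>)
    have i1: "integrable ball_measure (\<lambda>x. W x $ l * (x $ k * \<phi> x))" for k l
      by (intro L2_ball_mult WL2 test_function_L2 t)
    have i2: "integrable ball_measure (\<lambda>x. u x * (x $ l * partial_deriv k \<phi> x))" for k l
      by (intro L2_ball_mult uL2 test_function_L2 test_function_mult allI C_k_coordinate test_function_partial_deriv \<phi>)
    have w: "(LINT x|ball_measure. W x $ k * (x $ l * \<phi> x)) = - (LINT x|ball_measure. u x * (x $ l * partial_deriv k \<phi> x))"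
      if "k \<noteq> l" for k l
    proof -
      have "(LINT x|ball_measure. u x * partial_deriv k (\<lambda>x. x $ l * \<phi> x) x) = - (LINT x|ball_measure. W x $ k * (x $ l * \<phi> x))"
        using uW t[of l] unfolding has_weak_gradient_def by blast
      then show ?thesis by (simp add: partial_deriv_coordinate_mult[OF that c])
    qed
    have "(LINT x|ball_measure. (x $ i * W x $ j - x $ j * W x $ i) * \<phi> x)
        = (LINT x|ball_measure. W x $ j * (x $ i * \<phi> x) - W x $ i * (x $ j * \<phi> x))"
      by (simp add: algebra_simps)
    also have "\<dots> = (LINT x|ball_measure. u x * (x $ j * partial_deriv i \<phi> x)) - (LINT x|ball_measure. u x * (x $ i * partial_deriv j \<phi> x))"
      using ij by (simp add: i1 w)
    also have "\<dots> = (LINT x|ball_measure. u x * (x $ j * partial_deriv i \<phi> x) - u x * (x $ i * partial_deriv j \<phi> x))"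
      by (rule Bochner_Integration.integral_diff[symmetric, OF i2 i2])
    also have "\<dots> = 0" using zero[OF \<phi>] by (simp add: right_diff_distrib)
    finally show "(LINT x|ball_measure. (x $ i * W x $ j - x $ j * W x $ i) * \<phi> x) = 0" .
  qed
  then show ?thesis by (simp add: ang_deriv_def W_def)
qed

section \<open>Comparison of the ground levels\<close>

text \<open>In the unit ball \<open>|\<partial>\<^sub>\<theta>u| \<le> |x| |\<nabla>u| \<le> |\<nabla>u|\<close>. The bound makes the infimum over real numbers in the definition
  of the ground level meaningful.\<close>

lemma rayleigh_nonneg:
  fixes i j :: "'n::finite"
  assumes ij: "i \<noteq> j" and \<alpha>: "0 \<le> \<alpha>" "\<alpha> \<le> 1" and m: "0 \<le> m"
  shows "0 \<le> rayleigh i j \<alpha> m p u"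
proof -
  have "\<alpha>\<^sup>2 * (ang_deriv i j u x)\<^sup>2 \<le> (norm (weak_grad u x))\<^sup>2" if x: "x \<in> ball 0 1" for x
  proof -
    define G where "G = weak_grad u x"
    have "(x $ i * G $ j - x $ j * G $ i)\<^sup>2 \<le> ((x $ i)\<^sup>2 + (x $ j)\<^sup>2) * ((G $ i)\<^sup>2 + (G $ j)\<^sup>2)"
      using zero_le_power2[of "x $ i * G $ i + x $ j * G $ j"]
      by (simp add: power2_eq_square algebra_simps)
    also have "\<dots> \<le> 1 * (norm G)\<^sup>2"
    proof (intro mult_mono two_components_le_norm[OF ij])
      have "(x $ i)\<^sup>2 + (x $ j)\<^sup>2 \<le> (norm x)\<^sup>2" by (rule two_components_le_norm[OF ij])
      also have "\<dots> \<le> 1" using x by (simp add: power_le_one)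
      finally show "(x $ i)\<^sup>2 + (x $ j)\<^sup>2 \<le> 1" .
    qed auto
    finally have "(x $ i * G $ j - x $ j * G $ i)\<^sup>2 \<le> (norm G)\<^sup>2" by simp
    moreover have "\<alpha>\<^sup>2 \<le> 1" using \<alpha> by (simp add: power_le_one)
    ultimately have "\<alpha>\<^sup>2 * (x $ i * G $ j - x $ j * G $ i)\<^sup>2 \<le> 1 * (norm G)\<^sup>2"
      by (intro mult_mono) auto
    then show ?thesis by (simp add: ang_deriv_def G_def)
  qed
  then have "0 \<le> (norm (weak_grad u x))\<^sup>2 - \<alpha>\<^sup>2 * (ang_deriv i j u x)\<^sup>2 + m * (u x)\<^sup>2"
    if "x \<in> space ball_measure" for x
    using that m by (simp add: space_restrict_space)
  then show ?thesis
    unfolding rayleigh_def by (intro divide_nonneg_nonneg Bochner_Integration.integral_nonneg) auto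
qed

lemma ground_level_le_rayleigh:
  assumes "i \<noteq> j" "0 \<le> \<alpha>" "\<alpha> \<le> 1" "0 \<le> m" "u \<in> H10_nonzero"
  shows "ground_level i j \<alpha> m p \<le> rayleigh i j \<alpha> m p u"
  unfolding ground_level_def
  by (intro cINF_lower bdd_belowI2[of _ 0] rayleigh_nonneg assms)

lemma radial_imp_rayleigh_eq:
  assumes ij: "i \<noteq> j" and u: "H1_ball u" and radial: "\<not> nonradial i j u"
  shows "rayleigh i j \<alpha> m p u = rayleigh i j 0 m p u"
proof -
  have L2: "L2_ball u" and W: "has_weak_gradient u (weak_grad u)"
    using u weak_grad_works by (auto simp: H1_ball_def)
  have "(LINT x|ball_measure. (norm (weak_grad u x))\<^sup>2 - \<alpha>\<^sup>2 * (ang_deriv i j u x)\<^sup>2 + m * (u x)\<^sup>2)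
      = (LINT x|ball_measure. (norm (weak_grad u x))\<^sup>2 - 0\<^sup>2 * (ang_deriv i j u x)\<^sup>2 + m * (u x)\<^sup>2)"
    unfolding ang_deriv_def
    by (rule integral_cong_AE[OF borel_measurable_integrable[OF integrable_rayleigh_integrand[OF L2 W]]
          borel_measurable_integrable[OF integrable_rayleigh_integrand[OF L2 W]]])
       (use radial_imp_angular_derivative_0[OF ij u radial] in \<open>eventually_elim, simp add: ang_deriv_def\<close>)
  then show ?thesis by (simp add: rayleigh_def)
qed

theorem theorem1p4:
  fixes i j :: "'n::finite" and \<alpha> p :: real
  assumes "CARD('n) \<ge> 2" and "i \<noteq> j"
    and "0 < \<alpha>" and "\<alpha> < 1"
    and "2 < p" and "ereal p < critical_exponent CARD('n)"
  shows "\<exists>m\<^sub>0>0.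
    (\<forall>m\<ge>m\<^sub>0. ground_level i j \<alpha> m p < ground_level i j 0 m p) \<and>
    (\<forall>m\<ge>m\<^sub>0. \<forall>u :: real ^ 'n \<Rightarrow> real. ground_state i j \<alpha> m p u \<longrightarrow> nonradial i j u)"
proof -
  note ij = assms(2) and \<alpha> = assms(3,4) and p = assms(5,6)
  obtain S where S: "S > 0"
    "\<And>v :: real ^ 'n \<Rightarrow> real. Cc_smooth v \<Longrightarrow> S * (LINT x|lborel. \<bar>v x\<bar> powr p) powr (2 / p) \<le> energy v"
    "\<And>\<kappa>. \<kappa> > 1 \<Longrightarrow> \<exists>v :: real ^ 'n \<Rightarrow> real. Cc_smooth v \<and> (\<exists>x. v x \<noteq> 0) \<and>
        energy v < \<kappa> * S * (LINT x|lborel. \<bar>v x\<bar> powr p) powr (2 / p)"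
    by (rule optimal_Sobolev_constant[OF p]) blast
  define s where "s = sqrt (1 - \<alpha>\<^sup>2 / 16)"
  define q where "q = s powr (1 - 2 / p)"
  have "\<alpha>\<^sup>2 < 1" "0 < \<alpha>\<^sup>2" using \<alpha> by (auto simp: power_less_one_iff)
  then have s: "0 < s" "s < 1" by (simp_all add: s_def)
  have q: "0 < q" "q < 1"
    using s p(1) powr_less_mono'[of s 0 "1 - 2 / p"] by (simp_all add: q_def)
  \<comment> \<open>The gain \<open>q\<close> absorbs two factors \<open>\<kappa>\<close>: one from the choice of \<open>v\<close>, one from its localization.\<close>
  define \<kappa> where "\<kappa> = q powr (- 1 / 2)"
  have \<kappa>q: "\<kappa> * q * \<kappa> = 1"
  proof -
    have "\<kappa> * q * \<kappa> = q powr (- 1 / 2 + 1 + - 1 / 2)"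
      using q by (simp only: \<kappa>_def powr_add powr_one less_imp_le)
    then show ?thesis using q by simp
  qed
  have \<kappa>: "\<kappa> > 1"
    using q powr_less_mono'[of q "- 1 / 2" 0] by (simp add: \<kappa>_def)
  define \<eta> where "\<eta> = min (1 / 4) ((\<kappa> - 1) / 2)"
  have \<eta>: "0 < \<eta>" "\<eta> \<le> 1 / 4" "1 + 2 * \<eta> \<le> \<kappa>"
  proof -
    have "\<eta> \<le> (\<kappa> - 1) / 2" unfolding \<eta>_def by (rule min.cobounded2)
    then show "1 + 2 * \<eta> \<le> \<kappa>" by (simp add: field_simps)
  qed (use \<kappa> in \<open>simp_all add: \<eta>_def\<close>)
  obtain v :: "real ^ 'n \<Rightarrow> real" and y\<^sub>0 where v: "Cc_smooth v" "v y\<^sub>0 \<noteq> 0"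
    and vS: "energy v < \<kappa> * S * (LINT x|lborel. \<bar>v x\<bar> powr p) powr (2 / p)"
    using S(3)[OF \<kappa>] by blast
  obtain \<rho> where \<rho>: "\<rho> > 0" "\<And>x. v x \<noteq> 0 \<Longrightarrow> norm x \<le> \<rho>" using Cc_smooth_support[OF v(1)] by metis
  define m\<^sub>0 where "m\<^sub>0 = max 1 ((\<rho> / \<eta>)\<^sup>2)"
  have level: "ground_level i j \<alpha> m p < ground_level i j 0 m p" if m: "m \<ge> m\<^sub>0" for m
  proof -
    have m1: "m \<ge> 1" using m by (simp add: m\<^sub>0_def)
    have "\<rho> / \<eta> \<le> sqrt m" using m by (intro real_le_rsqrt) (simp add: m\<^sub>0_def)
    then have \<rho>m: "\<rho> \<le> sqrt m * \<eta>" using \<eta> by (simp add: pos_divide_le_eq)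
    define X where "X = m * (sqrt m ^ CARD('n)) powr (2 / p - 1)"
    define P where "P = (LINT x|lborel. \<bar>v x\<bar> powr p)"
    have X: "X > 0" using m1 by (simp add: X_def)
    have P: "P > 0" unfolding P_def using Cc_smooth_Lp_pos[OF v] p(1) by simp
    obtain w where w: "w \<in> H10_nonzero"
      "rayleigh i j \<alpha> m p w \<le> (1 + 2 * \<eta>) * q * X * (energy v / P powr (2 / p))"
      using concentrated_competitor[OF ij \<alpha> p(1) v \<rho>(2) \<eta>(1,2) _ \<rho>m] m1
      unfolding q_def s_def X_def P_def by fastforce
    have "ground_level i j \<alpha> m p \<le> rayleigh i j \<alpha> m p w"
      using ij \<alpha> m1 w(1) by (intro ground_level_le_rayleigh) auto
    also note w(2)
    also have "(1 + 2 * \<eta>) * q * X * (energy v / P powr (2 / p)) < (1 + 2 * \<eta>) * q * X * (\<kappa> * S)"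
      using vS P X q \<eta> unfolding P_def[symmetric] by (intro mult_strict_left_mono) (auto simp: pos_divide_less_eq)
    also have "\<dots> \<le> \<kappa> * q * X * (\<kappa> * S)"
      using \<eta> q X S(1) \<kappa> by (intro mult_right_mono) auto
    also have "\<dots> = (\<kappa> * q * \<kappa>) * (S * X)" by (simp only: mult_ac)
    also have "\<dots> = S * X" by (simp only: \<kappa>q mult_1_left)
    also have "S * X \<le> ground_level i j 0 m p"
      unfolding ground_level_def X_def
      by (rule cINF_greatest) (use w(1) rayleigh_lower_bound[OF S(1,2) p(1) m1] in auto)
    finally show ?thesis .
  qed
  have "nonradial i j u" if m: "m \<ge> m\<^sub>0" and u: "ground_state i j \<alpha> m p u" for m and u :: "real ^ 'n \<Rightarrow> real"
  proof (rule ccontr)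
    assume radial: "\<not> nonradial i j u"
    have uH: "u \<in> H10_nonzero" and ur: "rayleigh i j \<alpha> m p u = ground_level i j \<alpha> m p"
      using u by (auto simp: ground_state_def)
    have "ground_level i j 0 m p \<le> rayleigh i j 0 m p u"
      using ij m uH by (intro ground_level_le_rayleigh) (auto simp: m\<^sub>0_def)
    also have "\<dots> = rayleigh i j \<alpha> m p u"
      using uH by (intro radial_imp_rayleigh_eq[OF ij _ radial, symmetric]) (simp add: H10_nonzero_def H10_ball_def)
    also have "\<dots> < ground_level i j 0 m p" using level[OF m] ur by simp
    finally show False by simp
  qed
  moreover have "m\<^sub>0 > 0" by (simp add: m\<^sub>0_def)
  ultimately show ?thesis using level by blast
qed

end
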